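(* For any $h_1,h_2\in\Gamma(Herm^+(E))$, $$d(h_1,h_2)=\left[\int_M d_x(h_1(x),h_2(x))^2\,\mu_g(x)\right]^{\frac12},$$ where $d$ is the distance on $\Gamma(Herm^+(E))$ induced by the $L^2$ metric $(\cdot,\cdot)^\alpha$ and $d_x$ is the Riemannian distance on $Herm^+(E_x)$.
   Context: $M$ is a closed, oriented, smooth manifold, $E\to M$ a smooth complex vector bundle of rank $r$, $g$ a fixed smooth Riemannian metric on $M$ with volume form (and associated measure) $\mu_g$, and $\alpha:M\to\mathbb{R}$ a fixed smooth function with $\alpha>-1/r$. For a complex vector space $V$ of dimension $r$, $Herm(V)$ is the real vector space of Hermitian sesquilinear forms on $V$ (linear in the first, conjugate-linear in the second argument) and $Herm^+(V)$ the open subset of positive definite ones. For $h\in Herm^+(V)$, $v\in Herm(V)$, $h^{-1}v\in End(V)$ is defined by $v(a,b)=h(a,(h^{-1}v)b)$. $Herm(E)$, $Herm^+(E)$ are the bundles with fibers $Herm(E_x)$, $Herm^+(E_x)$, and $\Gamma(\cdot)$ denotes smooth sections. $\Gamma(Herm(E))$ is a Fréchet space with the $C^\infty$ topology and $\Gamma(Herm^+(E))$ is an open convex cone in it, with tangent spaces identified with $\Gamma(Herm(E))$. The weak Riemannian metric on $\Gamma(Herm^+(E))$ is $(v,w)_h^\alpha=\int_M\big(tr(h^{-1}vh^{-1}w)+\alpha\,tr(h^{-1}v)\,tr(h^{-1}w)\big)\mu_g$, and $d(h_1,h_2)$ is the infimum of $\int_0^1\sqrt{(\dot\gamma,\dot\gamma)^\alpha_{\gamma}}\,dt$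 over piecewise $C^1$ paths $\gamma$ in $\Gamma(Herm^+(E))$ from $h_1$ to $h_2$. For $x\in M$, $d_x$ is the Riemannian distance on $Herm^+(E_x)$ for the metric $\langle v,w\rangle_h=tr(h^{-1}vh^{-1}w)+\alpha(x)\,tr(h^{-1}v)\,tr(h^{-1}w)$. *)

theory Defs
  imports
    "HOL-Analysis.Analysis"
    "HOL-Library.Function_Algebras"
    "Jordan_Normal_Form.Determinant"
begin

no_notation Matrix.vec_index (infixl "$" 100)

section \<open>Functions form a real vector space\<close>

instantiation "fun" :: (type, real_vector) real_vector
begin

definition scaleR_fun :: "real \<Rightarrow> ('a \<Rightarrow> 'b) \<Rightarrow> 'a \<Rightarrow> 'b"
  where "scaleR_fun c f = (\<lambda>x. c *\<^sub>R f x)"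

instance
  by standard (auto simp: scaleR_fun_def fun_eq_iff algebra_simps)

end

section \<open>Length distance of a weak Riemannian metric\<close>

text \<open>
  The tangent vectors live in a real vector space whose topology is given by \<open>T\<close>; the
  underlying manifold is a subset \<open>P\<close> of it, open in \<open>T\<close>, and \<open>G p v w\<close> is the
  inner product of \<open>v\<close> and \<open>w\<close> at \<open>p\<close>.
\<close>

definition has_velocity :: "'v::real_vector topology \<Rightarrow> (real \<Rightarrow> 'v) \<Rightarrow> 'v \<Rightarrow> real \<Rightarrow> real set \<Rightarrow> bool"
  where "has_velocity T \<gamma> v t S \<longleftrightarrow>
    limitin T (\<lambda>s. (\<gamma> s - \<gamma> t) /\<^sub>R (s - t)) v (at t within S)"

definition C1_path_on :: "'v::real_vector topology \<Rightarrow> real \<Rightarrow> real \<Rightarrow> (real \<Rightarrow> 'v) \<Rightarrow> bool"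
  where "C1_path_on T a b \<gamma> \<longleftrightarrow>
    (\<exists>\<gamma>'. (\<forall>t\<in>{a..b}. has_velocity T \<gamma> (\<gamma>' t) t {a..b}) \<and>
          continuous_map (top_of_set {a..b}) T \<gamma>')"

definition piecewise_C1_path :: "'v::real_vector topology \<Rightarrow> (real \<Rightarrow> 'v) \<Rightarrow> bool"
  where "piecewise_C1_path T \<gamma> \<longleftrightarrow>
    (\<exists>(k::nat) \<tau>. \<tau> 0 = 0 \<and> \<tau> k = 1 \<and>
       (\<forall>i<k. \<tau> i < \<tau> (Suc i) \<and> C1_path_on T (\<tau> i) (\<tau> (Suc i)) \<gamma>))"

text \<open>Unspecified at the finitely many breakpoints, which do not affect the length.\<close>

definition velocity :: "'v::real_vector topology \<Rightarrow> (real \<Rightarrow> 'v) \<Rightarrow> real \<Rightarrow> 'v"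
  where "velocity T \<gamma> t = (THE v. has_velocity T \<gamma> v t {0..1})"

definition path_length ::
    "'v::real_vector topology \<Rightarrow> ('v \<Rightarrow> 'v \<Rightarrow> 'v \<Rightarrow> real) \<Rightarrow> (real \<Rightarrow> 'v) \<Rightarrow> real"
  where "path_length T G \<gamma> =
    integral {0..1} (\<lambda>t. sqrt (G (\<gamma> t) (velocity T \<gamma> t) (velocity T \<gamma> t)))"

definition riemannian_dist ::
    "'v::real_vector topology \<Rightarrow> 'v set \<Rightarrow> ('v \<Rightarrow> 'v \<Rightarrow> 'v \<Rightarrow> real) \<Rightarrow> 'v \<Rightarrow> 'v \<Rightarrow> real"
  where "riemannian_dist T P G p q =
    Inf {path_length T G \<gamma> | \<gamma>.
           piecewise_C1_path T \<gamma> \<and> (\<forall>t\<in>{0..1}. \<gamma> t \<in> P) \<and> \<gamma> 0 = p \<and> \<gamma> 1 = q}"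

section \<open>Smooth functions of \<open>n\<close> real variables\<close>

text \<open>
  \<open>n\<close>-space is realised by the extensional functions on \<open>{..<n}\<close>, the carrier of the
  product measure \<open>PiM {..<n} (\<lambda>_. lborel)\<close>; \<open>n = 0\<close> is allowed.
\<close>

definition Rn :: "nat \<Rightarrow> (nat \<Rightarrow> real) set"
  where "Rn n = (\<Pi>\<^sub>E i\<in>{..<n}. UNIV)"

definition partial :: "nat \<Rightarrow> ((nat \<Rightarrow> real) \<Rightarrow> 'b::real_normed_vector) \<Rightarrow> (nat \<Rightarrow> real) \<Rightarrow> 'b"
  where "partial i f y = vector_derivative (\<lambda>t. f (y(i := t))) (at (y i))"

definition partials ::
    "nat list \<Rightarrow> ((nat \<Rightarrow> real) \<Rightarrow> 'b::real_normed_vector) \<Rightarrow> (nat \<Rightarrow> real) \<Rightarrow> 'b"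
  where "partials is f = foldr partial is f"

text \<open>
  \<open>W\<close> is meant to be open in \<open>Rn n\<close>: all iterated partial derivatives exist and are continuous.
\<close>

definition smooth_on :: "nat \<Rightarrow> (nat \<Rightarrow> real) set \<Rightarrow> ((nat \<Rightarrow> real) \<Rightarrow> 'b::real_normed_vector) \<Rightarrow> bool"
  where "smooth_on n W f \<longleftrightarrow>
    (\<forall>is. set is \<subseteq> {..<n} \<longrightarrow>
       continuous_on W (partials is f) \<and>
       (\<forall>y\<in>W. \<forall>i<n. (\<lambda>t. partials is f (y(i := t))) differentiable (at (y i))))"

section \<open>Oriented smooth manifolds and Riemannian metrics\<close>

text \<open>The underlying space of the manifold is the whole type \<open>'m\<close>; a chart is a pair of its domain and map.\<close>

type_synonym 'm chart = "'m set \<times> ('m \<Rightarrow> nat \<Rightarrow> real)"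

definition oriented_smooth_manifold ::
    "nat \<Rightarrow> 'm::{t2_space, second_countable_topology} chart set \<Rightarrow> bool"
  where "oriented_smooth_manifold n A \<longleftrightarrow>
    (\<Union>(U, \<phi>)\<in>A. U) = UNIV \<and>
    (\<forall>(U, \<phi>)\<in>A. open U \<and> openin (top_of_set (Rn n)) (\<phi> ` U) \<and>
       homeomorphism U (\<phi> ` U) \<phi> (inv_into U \<phi>)) \<and>
    (\<forall>(U, \<phi>)\<in>A. \<forall>(V, \<psi>)\<in>A.
       (\<forall>i<n. smooth_on n (\<phi> ` (U \<inter> V)) (\<lambda>y. \<psi> (inv_into U \<phi> y) i)) \<and>
       (\<forall>y\<in>\<phi> ` (U \<inter> V).
          Determinant.det (Matrix.mat n n (\<lambda>(i, j). partial j (\<lambda>y. \<psi> (inv_into U \<phi> y) i) y)) > 0))"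

definition smooth_fun :: "nat \<Rightarrow> 'm chart set \<Rightarrow> 'm set \<Rightarrow> ('m \<Rightarrow> 'b::real_normed_vector) \<Rightarrow> bool"
  where "smooth_fun n A V f \<longleftrightarrow>
    (\<forall>(U, \<phi>)\<in>A. smooth_on n (\<phi> ` (U \<inter> V)) (\<lambda>y. f (inv_into U \<phi> y)))"

text \<open>
  Tangent vectors are derivations of the algebra of smooth functions, extended by \<open>0\<close> to the
  functions that are not smooth.
\<close>

definition tangent_space :: "nat \<Rightarrow> 'm chart set \<Rightarrow> 'm \<Rightarrow> (('m \<Rightarrow> real) \<Rightarrow> real) set"
  where "tangent_space n A p =
    {X. (\<forall>f. \<not> smooth_fun n A UNIV f \<longrightarrow> X f = 0) \<and>
        (\<forall>f g. smooth_fun n A UNIV f \<and> smooth_fun n A UNIV g \<longrightarrow>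
           (\<forall>a b. X (\<lambda>x. a * f x + b * g x) = a * X f + b * X g) \<and>
           X (\<lambda>x. f x * g x) = f p * X g + g p * X f)}"

definition coord_vector ::
    "nat \<Rightarrow> 'm chart set \<Rightarrow> 'm chart \<Rightarrow> nat \<Rightarrow> 'm \<Rightarrow> ('m \<Rightarrow> real) \<Rightarrow> real"
  where "coord_vector n A c i p f =
    (case c of (U, \<phi>) \<Rightarrow>
       if smooth_fun n A UNIV f then partial i (\<lambda>y. f (inv_into U \<phi> y)) (\<phi> p) else 0)"

type_synonym 'm metric_field = "'m \<Rightarrow> (('m \<Rightarrow> real) \<Rightarrow> real) \<Rightarrow> (('m \<Rightarrow> real) \<Rightarrow> real) \<Rightarrow> real"

definition riemannian_metric :: "nat \<Rightarrow> 'm chart set \<Rightarrow> 'm metric_field \<Rightarrow> bool"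
  where "riemannian_metric n A g \<longleftrightarrow>
    (\<forall>p. \<forall>X\<in>tangent_space n A p. \<forall>Y\<in>tangent_space n A p.
       g p X Y = g p Y X \<and>
       (\<forall>Z\<in>tangent_space n A p. \<forall>a b. g p (a *\<^sub>R X + b *\<^sub>R Y) Z = a * g p X Z + b * g p Y Z) \<and>
       (X \<noteq> 0 \<longrightarrow> g p X X > 0)) \<and>
    (\<forall>(U, \<phi>)\<in>A. \<forall>i<n. \<forall>j<n.
       smooth_fun n A U (\<lambda>p. g p (coord_vector n A (U, \<phi>) i p) (coord_vector n A (U, \<phi>) j p)))"

definition gram_matrix :: "nat \<Rightarrow> 'm chart set \<Rightarrow> 'm metric_field \<Rightarrow> 'm chart \<Rightarrow> 'm \<Rightarrow> real mat"
  where "gram_matrix n A g c p =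
    Matrix.mat n n (\<lambda>(i, j). g p (coord_vector n A c i p) (coord_vector n A c j p))"

text \<open>
  The Borel measure associated with the volume form, which in a positively oriented chart is
  \<open>sqrt (det (g\<^sub>i\<^sub>j)) dx\<^sub>1 \<and> \<dots> \<and> dx\<^sub>n\<close>. The local formula determines the measure uniquely.
\<close>

definition riemannian_volume ::
    "nat \<Rightarrow> 'm::topological_space chart set \<Rightarrow> 'm metric_field \<Rightarrow> 'm measure \<Rightarrow> bool"
  where "riemannian_volume n A g \<mu> \<longleftrightarrow>
    sets \<mu> = sets borel \<and>
    (\<forall>(U, \<phi>)\<in>A. \<forall>B\<in>sets borel. B \<subseteq> U \<longrightarrow>
       emeasure \<mu> B =
         (\<integral>\<^sup>+y. ennreal (sqrt (Determinant.det (gram_matrix n A g (U, \<phi>) (inv_into U \<phi> y)))) *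
               indicator (\<phi> ` B) y \<partial>PiM {..<n} (\<lambda>_. lborel)))"

section \<open>Smooth complex vector bundles\<close>

text \<open>
  The total space is the type \<open>'e\<close>. The operations \<open>vadd\<close> and \<open>vscale\<close> are only meaningful
  within a fibre. A trivialisation is given by its base domain and by its \<open>\<complex>\<^sup>r\<close>-component; the
  smooth structure of the total space is the one determined by the trivialisations.
\<close>

record ('m, 'e, 'r) vbundle =
  proj :: "'e \<Rightarrow> 'm"
  vadd :: "'e \<Rightarrow> 'e \<Rightarrow> 'e"
  vscale :: "complex \<Rightarrow> 'e \<Rightarrow> 'e"
  trivs :: "('m set \<times> ('e \<Rightarrow> complex ^ 'r)) set"

definition fibre :: "('m, 'e, 'r::finite) vbundle \<Rightarrow> 'm \<Rightarrow> 'e set"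
  where "fibre E x = {a. proj E a = x}"

definition fibre_iso :: "('m, 'e, 'r::finite) vbundle \<Rightarrow> 'm \<Rightarrow> ('e \<Rightarrow> complex ^ 'r) \<Rightarrow> bool"
  where "fibre_iso E x \<Phi> \<longleftrightarrow>
    bij_betw \<Phi> (fibre E x) UNIV \<and>
    (\<forall>a\<in>fibre E x. \<forall>b\<in>fibre E x. vadd E a b \<in> fibre E x \<and> \<Phi> (vadd E a b) = \<Phi> a + \<Phi> b) \<and>
    (\<forall>c. \<forall>a\<in>fibre E x. vscale E c a \<in> fibre E x \<and> \<Phi> (vscale E c a) = c *s \<Phi> a)"

definition frame :: "('m, 'e, 'r::finite) vbundle \<Rightarrow> ('e \<Rightarrow> complex ^ 'r) \<Rightarrow> 'm \<Rightarrow> 'r \<Rightarrow> 'e"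
  where "frame E \<Phi> x i = inv_into (fibre E x) \<Phi> (axis i 1)"

definition smooth_complex_vector_bundle ::
    "nat \<Rightarrow> 'm::topological_space chart set \<Rightarrow> ('m, 'e, 'r::finite) vbundle \<Rightarrow> bool"
  where "smooth_complex_vector_bundle n A E \<longleftrightarrow>
    (\<Union>(U, \<Phi>)\<in>trivs E. U) = UNIV \<and>
    (\<forall>(U, \<Phi>)\<in>trivs E. open U \<and> (\<forall>x\<in>U. fibre_iso E x \<Phi>)) \<and>
    (\<forall>(U, \<Phi>)\<in>trivs E. \<forall>(V, \<Psi>)\<in>trivs E. \<forall>i j.
       smooth_fun n A (U \<inter> V) (\<lambda>x. \<Psi> (frame E \<Phi> x j) $ i))"

definition fibre_End :: "('m, 'e, 'r::finite) vbundle \<Rightarrow> 'm \<Rightarrow> ('e \<Rightarrow> 'e) set"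
  where "fibre_End E x =
    {L \<in> fibre E x \<rightarrow>\<^sub>E fibre E x.
       (\<forall>a\<in>fibre E x. \<forall>b\<in>fibre E x. L (vadd E a b) = vadd E (L a) (L b)) \<and>
       (\<forall>c. \<forall>a\<in>fibre E x. L (vscale E c a) = vscale E c (L a))}"

text \<open>The trace of an endomorphism of a fibre: the trace of its matrix in any linear frame.\<close>

definition fibre_trace :: "('m, 'e, 'r::finite) vbundle \<Rightarrow> 'm \<Rightarrow> ('e \<Rightarrow> 'e) \<Rightarrow> complex"
  where "fibre_trace E x L =
    (THE t. \<forall>\<Phi>. fibre_iso E x \<Phi> \<longrightarrow> t = Determinants.trace (\<chi> i j. \<Phi> (L (frame E \<Phi> x j)) $ i))"

section \<open>Hermitian forms on the fibres\<close>

text \<open>Forms on a fibre are extended by \<open>0\<close>, so that they form a subspace of the function space.\<close>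

type_synonym 'e form = "'e \<Rightarrow> 'e \<Rightarrow> complex"

definition Herm :: "('m, 'e, 'r::finite) vbundle \<Rightarrow> 'm \<Rightarrow> 'e form set"
  where "Herm E x =
    {v. (\<forall>a b. a \<notin> fibre E x \<or> b \<notin> fibre E x \<longrightarrow> v a b = 0) \<and>
        (\<forall>a\<in>fibre E x. \<forall>b\<in>fibre E x. \<forall>a'\<in>fibre E x.
           v (vadd E a a') b = v a b + v a' b \<and> v b (vadd E a a') = v b a + v b a') \<and>
        (\<forall>a\<in>fibre E x. \<forall>b\<in>fibre E x. \<forall>c.
           v (vscale E c a) b = c * v a b \<and> v a (vscale E c b) = cnj c * v a b) \<and>
        (\<forall>a\<in>fibre E x. \<forall>b\<in>fibre E x. v b a = cnj (v a b))}"

text \<open>\<open>vscale E 0 a\<close> is the zero vector of the fibre of \<open>a\<close>; \<open>h a a\<close> is real for Hermitian \<open>h\<close>.\<close>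

definition Herm_pos :: "('m, 'e, 'r::finite) vbundle \<Rightarrow> 'm \<Rightarrow> 'e form set"
  where "Herm_pos E x =
    {h \<in> Herm E x. \<forall>a\<in>fibre E x. a \<noteq> vscale E 0 a \<longrightarrow> Re (h a a) > 0}"

definition h_inv :: "('m, 'e, 'r::finite) vbundle \<Rightarrow> 'm \<Rightarrow> 'e form \<Rightarrow> 'e form \<Rightarrow> 'e \<Rightarrow> 'e"
  where "h_inv E x h v =
    (THE L. L \<in> fibre_End E x \<and> (\<forall>a\<in>fibre E x. \<forall>b\<in>fibre E x. v a b = h a (L b)))"

text \<open>All three traces are real when \<open>h\<close>, \<open>v\<close>, \<open>w\<close> are Hermitian and \<open>h\<close> is positive definite.\<close>

definition fibre_metric ::
    "('m, 'e, 'r::finite) vbundle \<Rightarrow> ('m \<Rightarrow> real) \<Rightarrow> 'm \<Rightarrow> 'e form \<Rightarrow> 'e form \<Rightarrow> 'e form \<Rightarrow> real"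
  where "fibre_metric E \<alpha> x h v w =
    Re (fibre_trace E x (h_inv E x h v \<circ> h_inv E x h w)) +
    \<alpha> x * Re (fibre_trace E x (h_inv E x h v)) * Re (fibre_trace E x (h_inv E x h w))"

text \<open>
  The topology of pointwise convergence on \<^term>\<open>Herm E x\<close> is the usual topology of this
  finite-dimensional real vector space.
\<close>

definition fibre_dist ::
    "('m, 'e, 'r::finite) vbundle \<Rightarrow> ('m \<Rightarrow> real) \<Rightarrow> 'm \<Rightarrow> 'e form \<Rightarrow> 'e form \<Rightarrow> real"
  where "fibre_dist E \<alpha> x =
    riemannian_dist (subtopology euclidean (Herm E x)) (Herm_pos E x) (fibre_metric E \<alpha> x)"

section \<open>Spaces of sections\<close>

definition coefficient ::
    "('m, 'e, 'r::finite) vbundle \<Rightarrow> ('e \<Rightarrow> complex ^ 'r) \<Rightarrow> 'r \<Rightarrow> 'r \<Rightarrow> ('m \<Rightarrow> 'e form) \<Rightarrow> 'm \<Rightarrow> complex"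
  where "coefficient E \<Phi> i j s x = s x (frame E \<Phi> x i) (frame E \<Phi> x j)"

definition smooth_sections ::
    "nat \<Rightarrow> 'm chart set \<Rightarrow> ('m, 'e, 'r::finite) vbundle \<Rightarrow> ('m \<Rightarrow> 'e form set) \<Rightarrow> ('m \<Rightarrow> 'e form) set"
  where "smooth_sections n A E F =
    {s. (\<forall>x. s x \<in> F x) \<and>
        (\<forall>(U, \<Phi>)\<in>trivs E. \<forall>i j. smooth_fun n A U (coefficient E \<Phi> i j s))}"

text \<open>
  Uniform convergence of all partial derivatives of all local coefficients on compact subsets of
  the coordinate domains. The subbasic sets are the open balls of the corresponding seminorms.
\<close>

definition Cinf_topology ::
    "nat \<Rightarrow> 'm chart set \<Rightarrow> ('m, 'e, 'r::finite) vbundle \<Rightarrow> ('m \<Rightarrow> 'e form) topology"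
  where "Cinf_topology n A E =
    topology_generated_by
      {{s \<in> smooth_sections n A E (Herm E).
          \<forall>y\<in>K. norm (partials is (\<lambda>y. coefficient E \<Phi> i j (s - s0) (inv_into U \<phi> y)) y) < \<epsilon>}
       | s0 U \<phi> V \<Phi> K is i j \<epsilon>.
          s0 \<in> smooth_sections n A E (Herm E) \<and> (U, \<phi>) \<in> A \<and> (V, \<Phi>) \<in> trivs E \<and>
          K \<subseteq> \<phi> ` (U \<inter> V) \<and> compact K \<and> set is \<subseteq> {..<n} \<and> \<epsilon> > (0::real)}"

definition L2_metric ::
    "('m, 'e, 'r::finite) vbundle \<Rightarrow> ('m \<Rightarrow> real) \<Rightarrow> 'm measure \<Rightarrow>
     ('m \<Rightarrow> 'e form) \<Rightarrow> ('m \<Rightarrow> 'e form) \<Rightarrow> ('m \<Rightarrow> 'e form) \<Rightarrow> real"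
  where "L2_metric E \<alpha> \<mu> h v w = (\<integral>x. fibre_metric E \<alpha> x (h x) (v x) (w x) \<partial>\<mu>)"

definition L2_dist ::
    "nat \<Rightarrow> 'm chart set \<Rightarrow> ('m, 'e, 'r::finite) vbundle \<Rightarrow> ('m \<Rightarrow> real) \<Rightarrow> 'm measure \<Rightarrow>
     ('m \<Rightarrow> 'e form) \<Rightarrow> ('m \<Rightarrow> 'e form) \<Rightarrow> real"
  where "L2_dist n A E \<alpha> \<mu> =
    riemannian_dist (Cinf_topology n A E) (smooth_sections n A E (Herm_pos E)) (L2_metric E \<alpha> \<mu>)"

end

theory Submission
  imports Defs
begin

text \<open>
  No geodesics are used. Call the energy of a curve of sections at \<open>x\<close> the integral of its squared
  speed in the fibre over \<open>x\<close>; it bounds the square of \<open>D x = d\<^sub>x (h1 x, h2 x)\<close> from above. Consider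
  the curves from \<open>h1\<close> to \<open>h2\<close> that are finite sums of fixed smooth sections with real \<open>C\<^sup>1\<close>
  coefficients. Given \<open>x\<^sub>0\<close>, an almost minimal path in the fibre over \<open>x\<^sub>0\<close> can be made \<open>C\<^sup>1\<close> and of
  constant speed; transported by a local frame, cut off by a bump function and added to the
  straight line from \<open>h1\<close> to \<open>h2\<close>, it yields such a curve with energy almost \<open>D x\<^sub>0\<^sup>2\<close> at \<open>x\<^sub>0\<close>.
  Hence \<open>D\<^sup>2\<close> is the pointwise infimum of the continuous energies, so it is measurable and
  the infimum of countably many of them.

  Since the positive forms are a convex cone, two such curves can be combined with a smooth weight
  approximating the indicator of the set where the second one has less energy; by dominated
  convergence the energy of the combination is the minimum of both energies up to a small integral.
  Thus the integral of \<open>D\<^sup>2\<close> is approximated by integrated energies, and the Cauchy-Schwarz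
  inequality gives \<open>d\<^sup>2 \<le> \<integral> D\<^sup>2\<close>. Conversely, the fibrewise lengths of any path dominate \<open>D\<close>, and
  Fubini with Cauchy-Schwarz bounds its \<open>L\<^sup>2\<close> length from below.
\<close>

section \<open>Calculus of smooth functions of several variables\<close>

text \<open>Energies are used instead of lengths because an integrated energy is a sum of
  independent contributions of the points x, so it can be lowered fibre by fibre, whereas the L2
  length of a path mixes all fibres at each time. Returning to lengths costs nothing only if the
  fibre paths have almost constant speed; hence the reparametrisation. The obstacle is that
  \<open>fibre_dist\<close> is an infimum over uncountably many paths in one fibre, which says
  nothing about its dependence on x. Extending each almost minimal fibre path to a global curve
  supplies upper semicontinuity of the squared distance. Real coefficients in front of fixed
  sections reduce velocities in the C-infinity topology to derivatives of real functions, and smooth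
  weights in x are absorbed by the sections. The bound on \<alpha> enters through one inequality:
  removing from v the multiple of h that carries its trace shows tr((h^-1 v)^2) >= (tr h^-1 v)^2 /
  r. Compactness of M supplies the finite volume, the regularity behind the bump functions and the
  constant bounds for dominated convergence.\<close>

definition has_partial ::
    "nat \<Rightarrow> ((nat \<Rightarrow> real) \<Rightarrow> 'b::real_normed_vector) \<Rightarrow> 'b \<Rightarrow> (nat \<Rightarrow> real) \<Rightarrow> bool"
  where "has_partial i f D y \<longleftrightarrow> ((\<lambda>t. f (y(i := t))) has_vector_derivative D) (at (y i))"

lemma has_partial_imp_partial: "has_partial i f D y \<Longrightarrow> partial i f y = D"
  unfolding has_partial_def partial_def by (rule vector_derivative_at)

text \<open>\<open>partial\<close> has a value even where no derivative exists;
  \<open>has_partial\<close> records existence as well, so that the rules for derivatives apply to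
  it.\<close>

lemma has_partial_iff_differentiable:
  "(\<lambda>t. f (y(i := t))) differentiable (at (y i)) \<longleftrightarrow> has_partial i f (partial i f y) y"
  unfolding has_partial_def partial_def by (rule vector_derivative_works)

text \<open>Changing a coordinate with index below n keeps a point extensional, so openness relative
  to \<open>Rn n\<close> already makes partial derivatives depend only on values in W.\<close>

lemma eventually_line_in:
  assumes "openin (top_of_set (Rn n)) W" "y \<in> W" "i < n"
  shows "\<forall>\<^sub>F t in nhds (y i). y(i := t) \<in> W"
proof -
  obtain O' where O': "open O'" "W = Rn n \<inter> O'"
    using assms(1) by (auto simp: openin_open)
  have c: "continuous_on UNIV (\<lambda>t. y(i := t))"
    by (rule continuous_on_coordinatewise_then_product) (rename_tac j, case_tac "j = i", auto)
  have "open ((\<lambda>t. y(i := t)) -` O')"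
    using c O'(1) by (simp add: open_vimage)
  moreover have "y i \<in> (\<lambda>t. y(i := t)) -` O'"
    using assms(2) O' by simp
  moreover have "y(i := t) \<in> Rn n" for t
    using assms O'(2) by (auto simp: Rn_def PiE_iff extensional_def)
  ultimately show ?thesis
    using O'(2) by (auto simp: eventually_nhds)
qed

lemma has_partial_cong:
  assumes "openin (top_of_set (Rn n)) W" "y \<in> W" "i < n" "\<And>z. z \<in> W \<Longrightarrow> f z = g z"
  shows "has_partial i f D y \<longleftrightarrow> has_partial i g D y"
  unfolding has_partial_def
proof (rule has_vector_derivative_cong_ev)
  show "\<forall>\<^sub>F t in nhds (y i). t \<in> UNIV \<longrightarrow> f (y(i := t)) = g (y(i := t))"
    using eventually_line_in[OF assms(1-3)] by eventually_elim (simp add: assms(4))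
qed (simp add: assms)

lemma partial_cong:
  assumes "openin (top_of_set (Rn n)) W" "y \<in> W" "i < n" "\<And>z. z \<in> W \<Longrightarrow> f z = g z"
  shows "partial i f y = partial i g y"
  using has_partial_cong[where f = f and g = g, OF assms]
  by (simp add: partial_def vector_derivative_def has_partial_def)

text \<open>Smoothness graded by order, peeling off the derivative that is applied first.
  Quantifying over all index lists at once, as \<open>smooth_on\<close> does, gives no usable
  induction for products and compositions; the grading does. Level 0 already contains the existence
  of first partial derivatives.\<close>

primrec smooth_upto ::
    "nat \<Rightarrow> nat \<Rightarrow> (nat \<Rightarrow> real) set \<Rightarrow> ((nat \<Rightarrow> real) \<Rightarrow> 'b::real_normed_vector) \<Rightarrow> bool"
  where
    "smooth_upto n 0 W f \<longleftrightarrow> continuous_on W f \<and> (\<forall>y\<in>W. \<forall>i<n. has_partial i f (partial i f y) y)"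
  | "smooth_upto n (Suc k) W f \<longleftrightarrow> (continuous_on W f \<and> (\<forall>y\<in>W. \<forall>i<n. has_partial i f (partial i f y) y)) \<and>
      (\<forall>i<n. smooth_upto n k W (partial i f))"

lemma partials_snoc: "partials (is @ [i]) f = partials is (partial i f)"
  by (simp add: partials_def)

lemma partials_Nil [simp]: "partials [] f = f"
  by (simp add: partials_def)

text \<open>\<open>partials\<close> is a right fold, so the last entry of a list is the derivative
  taken first; splitting lists there matches the recursion of \<open>smooth_upto\<close>.\<close>

lemma smooth_upto_iff:
  "smooth_upto n k W f \<longleftrightarrow>
    (\<forall>is. set is \<subseteq> {..<n} \<and> length is \<le> k \<longrightarrow> smooth_upto n 0 W (partials is f))"
proof (induction k arbitrary: f)
  case (Suc k)
  have "(\<forall>is. set is \<subseteq> {..<n} \<and> length is \<le> Suc k \<longrightarrow> smooth_upto n 0 W (partials is f)) \<longleftrightarrow>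
     smooth_upto n 0 W f \<and> (\<forall>i is. i < n \<and> set is \<subseteq> {..<n} \<and> length is \<le> k \<longrightarrow>
        smooth_upto n 0 W (partials is (partial i f)))" (is "?L \<longleftrightarrow> ?R")
  proof
    assume L: ?L
    show ?R
    proof (intro conjI allI impI)
      show "smooth_upto n 0 W f"
        using L[rule_format, of "[]"] by simp
      fix i "is" assume "i < n \<and> set is \<subseteq> {..<n} \<and> length is \<le> k"
      then show "smooth_upto n 0 W (partials is (partial i f))"
        using L[rule_format, of "is @ [i]"] by (simp only: partials_snoc) auto
    qed
  next
    assume R: ?R
    show ?L
    proof (intro allI impI)
      fix "is" :: "nat list" assume a: "set is \<subseteq> {..<n} \<and> length is \<le> Suc k"
      show "smooth_upto n 0 W (partials is f)"
      proof (cases "is" rule: rev_cases)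
        case Nil then show ?thesis using R by simp
      next
        case (snoc js j)
        then show ?thesis using R a by (simp only: partials_snoc) auto
      qed
    qed
  qed
  then show ?case
    using Suc.IH by auto
qed simp

lemma smooth_on_iff_upto: "smooth_on n W f \<longleftrightarrow> (\<forall>k. smooth_upto n k W f)"
proof -
  have "smooth_on n W f \<longleftrightarrow> (\<forall>is. set is \<subseteq> {..<n} \<longrightarrow> smooth_upto n 0 W (partials is f))"
    by (simp add: smooth_on_def has_partial_iff_differentiable)
  then show ?thesis
    unfolding smooth_upto_iff[of n _ W f] by blast
qed

lemma smooth_on_partials:
  assumes "smooth_on n W f" "set is \<subseteq> {..<n}"
  shows "smooth_upto n 0 W (partials is f)"
  using assms unfolding smooth_on_iff_upto smooth_upto_iff[of n _ W f] by blast

lemma smooth_on_imp_continuous_on: "smooth_on n W f \<Longrightarrow> continuous_on W f"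
  using smooth_on_partials[of n W f "[]"] by simp

lemma smooth_on_subset: "smooth_on n W f \<Longrightarrow> W' \<subseteq> W \<Longrightarrow> smooth_on n W' f"
  unfolding smooth_on_def by (meson continuous_on_subset subsetD)

lemma smooth_upto_cong:
  assumes W: "openin (top_of_set (Rn n)) W" and "\<And>z. z \<in> W \<Longrightarrow> f z = g z"
  shows "smooth_upto n k W f \<longleftrightarrow> smooth_upto n k W g"
  using assms(2)
proof (induction k arbitrary: f g)
  case 0
  then show ?case
    using has_partial_cong[OF W, of _ _ f g] partial_cong[OF W, of _ _ f g]
    by (simp cong: continuous_on_cong)
next
  case (Suc k)
  have "smooth_upto n 0 W f \<longleftrightarrow> smooth_upto n 0 W g"
    using Suc.prems has_partial_cong[OF W, of _ _ f g] partial_cong[OF W, of _ _ f g]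
    by (simp cong: continuous_on_cong)
  moreover have "smooth_upto n k W (partial i f) \<longleftrightarrow> smooth_upto n k W (partial i g)" if "i < n" for i
    using Suc partial_cong[OF W _ that] by blast
  ultimately show ?case by simp
qed

lemma smooth_on_cong:
  assumes "openin (top_of_set (Rn n)) W" and "\<And>z. z \<in> W \<Longrightarrow> f z = g z"
  shows "smooth_on n W f \<longleftrightarrow> smooth_on n W g"
  using smooth_upto_cong[OF assms] by (simp add: smooth_on_iff_upto)

text \<open>Smoothness on an open set depends only on the values there, so any formula d that gives
  the partial derivatives on W may replace \<open>partial i f\<close>.\<close>

lemma smooth_upto_SucI:
  assumes W: "openin (top_of_set (Rn n)) W" and "continuous_on W f"
    and D: "\<And>i y. i < n \<Longrightarrow> y \<in> W \<Longrightarrow> has_partial i f (d i y) y"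
    and d: "\<And>i. i < n \<Longrightarrow> smooth_upto n k W (d i)"
  shows "smooth_upto n (Suc k) W f"
proof -
  have "smooth_upto n k W (partial i f)" if "i < n" for i
    using d[OF that] smooth_upto_cong[OF W, of "partial i f" "d i" k]
      has_partial_imp_partial[OF D[OF that]] by auto
  then show ?thesis
    using assms(2) D has_partial_imp_partial[OF D] by auto
qed

lemma smooth_upto_0I:
  assumes "continuous_on W f"
    and D: "\<And>i y. i < n \<Longrightarrow> y \<in> W \<Longrightarrow> has_partial i f (d i y) y"
  shows "smooth_upto n 0 W f"
  using assms has_partial_imp_partial[OF D] by auto

lemma smooth_upto_Suc_D: "smooth_upto n (Suc k) W f \<Longrightarrow> smooth_upto n k W f"
  by (induction k arbitrary: f) auto

lemma has_partial_add:
  "has_partial i f D y \<Longrightarrow> has_partial i g D' y \<Longrightarrow> has_partial i (\<lambda>y. f y + g y) (D + D') y"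
  unfolding has_partial_def by (rule has_vector_derivative_add)

lemma smooth_upto_add:
  assumes W: "openin (top_of_set (Rn n)) W"
  shows "smooth_upto n k W f \<Longrightarrow> smooth_upto n k W g \<Longrightarrow> smooth_upto n k W (\<lambda>y. f y + g y)"
proof (induction k arbitrary: f g)
  case 0
  then show ?case
    by (intro smooth_upto_0I[where d = "\<lambda>i y. partial i f y + partial i g y"] has_partial_add)
      (auto intro: continuous_intros)
next
  case (Suc k)
  then show ?case
    by (intro smooth_upto_SucI[OF W, where d = "\<lambda>i y. partial i f y + partial i g y"] has_partial_add)
      (auto intro: continuous_intros)
qed

lemma smooth_on_add:
  "openin (top_of_set (Rn n)) W \<Longrightarrow> smooth_on n W f \<Longrightarrow> smooth_on n W g \<Longrightarrow>
    smooth_on n W (\<lambda>y. f y + g y)"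
  by (simp add: smooth_on_iff_upto smooth_upto_add)

lemma smooth_on_const:
  assumes W: "openin (top_of_set (Rn n)) W"
  shows "smooth_on n W (\<lambda>y. c)"
proof -
  have "smooth_upto n k W (\<lambda>y. c)" for k
  proof (induction k arbitrary: c)
    case 0 show ?case
      by (rule smooth_upto_0I[where d = "\<lambda>i y. 0"]) (auto simp: has_partial_def)
  next
    case (Suc k) show ?case
      by (rule smooth_upto_SucI[OF W, where d = "\<lambda>i y. 0"]) (auto simp: has_partial_def Suc)
  qed
  then show ?thesis by (simp add: smooth_on_iff_upto)
qed

text \<open>The product rule writes each partial derivative as a sum of products of f, g and their
  first partial derivatives. The induction hypothesis needs all of these at order k, so f and g
  themselves are lowered from \<open>Suc k\<close> to k.\<close>

lemma smooth_upto_bilinear: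
  assumes W: "openin (top_of_set (Rn n)) W" and B: "bounded_bilinear B"
  shows "smooth_upto n k W f \<Longrightarrow> smooth_upto n k W g \<Longrightarrow> smooth_upto n k W (\<lambda>y. B (f y) (g y))"
proof (induction k arbitrary: f g)
  case 0
  then have "has_partial i (\<lambda>y. B (f y) (g y)) (B (f y) (partial i g y) + B (partial i f y) (g y)) y"
    if "i < n" "y \<in> W" for i y
    using bounded_bilinear.has_vector_derivative[OF B,
      of "\<lambda>t. f (y(i := t))" "partial i f y" "y i" UNIV "\<lambda>t. g (y(i := t))" "partial i g y"] that
    by (simp add: has_partial_def)
  then show ?case
    using 0 by (intro smooth_upto_0I) (auto intro: bounded_bilinear.continuous_on[OF B])
next
  case (Suc k)
  then have "has_partial i (\<lambda>y. B (f y) (g y)) (B (f y) (partial i g y) + B (partial i f y) (g y)) y"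
    if "i < n" "y \<in> W" for i y
    using bounded_bilinear.has_vector_derivative[OF B,
      of "\<lambda>t. f (y(i := t))" "partial i f y" "y i" UNIV "\<lambda>t. g (y(i := t))" "partial i g y"] that
    by (simp add: has_partial_def)
  moreover have "smooth_upto n k W f" "smooth_upto n k W g"
    using Suc.prems smooth_upto_Suc_D by blast+
  ultimately show ?case
    using Suc by (intro smooth_upto_SucI[OF W,
        where d = "\<lambda>i y. B (f y) (partial i g y) + B (partial i f y) (g y)"] smooth_upto_add[OF W])
      (auto intro: bounded_bilinear.continuous_on[OF B])
qed

lemma smooth_on_bilinear:
  "bounded_bilinear B \<Longrightarrow> openin (top_of_set (Rn n)) W \<Longrightarrow> smooth_on n W f \<Longrightarrow> smooth_on n W g \<Longrightarrow>
    smooth_on n W (\<lambda>y. B (f y) (g y))"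
  by (simp add: smooth_on_iff_upto smooth_upto_bilinear)

text \<open>A linear map is a bilinear one with a frozen argument: L (f y) is the value of (r, x) ->
  L (r x) at the constant r = 1.\<close>

lemma smooth_on_linear:
  fixes f :: "(nat \<Rightarrow> real) \<Rightarrow> 'b::real_normed_vector"
  assumes L: "bounded_linear L" and W: "openin (top_of_set (Rn n)) W" and f: "smooth_on n W f"
  shows "smooth_on n W (\<lambda>y. L (f y))"
proof -
  interpret bounded_linear L by fact
  have "bounded_bilinear (\<lambda>(r::real) x. L (r *\<^sub>R x))"
  proof -
    have "bounded_bilinear (\<lambda>(r::real) x. r *\<^sub>R L x)"
      using bounded_bilinear.comp[OF bounded_bilinear_scaleR bounded_linear_ident L] by simp
    then show ?thesis by (simp add: scaleR)
  qed
  from smooth_on_bilinear[OF this W smooth_on_const[OF W, of 1] f] show ?thesis by simp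
qed

text \<open>The family c lists all derivatives of the outer function. Treating every m at once keeps
  the induction to the one-step chain rule, which turns \<open>c m\<close> into
  \<open>c (Suc m)\<close> times a partial derivative of f.\<close>

lemma smooth_upto_compose:
  fixes c :: "nat \<Rightarrow> real \<Rightarrow> real"
  assumes W: "openin (top_of_set (Rn n)) W"
    and c: "\<And>m x. (c m has_real_derivative c (Suc m) x) (at x)"
  shows "smooth_upto n k W f \<Longrightarrow> smooth_upto n k W (\<lambda>y. c m (f y))"
proof -
  have cont: "continuous_on UNIV (c m)" for m
    by (rule DERIV_continuous_on[of UNIV "c m" "c (Suc m)"]) (simp add: c)
  show "smooth_upto n k W f \<Longrightarrow> smooth_upto n k W (\<lambda>y. c m (f y))"
  proof (induction k arbitrary: f m)
  case 0
  have "has_partial i (\<lambda>y. c m (f y)) (partial i f y * c (Suc m) (f y)) y" if "i < n" "y \<in> W" for i y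
  proof -
    have "((\<lambda>t. f (y(i := t))) has_vector_derivative partial i f y) (at (y i))"
      using 0 that by (simp add: has_partial_def)
    from vector_diff_chain_at[OF this, of "c m" "c (Suc m) (f y)"] show ?thesis
      using c[of m "f y"] by (simp add: has_partial_def o_def has_real_derivative_iff_has_vector_derivative)
  qed
  moreover have "continuous_on W (\<lambda>y. c m (f y))"
    using 0 by (intro continuous_on_compose2[OF cont]) auto
  ultimately show ?case
    by (rule smooth_upto_0I[rotated])
next
  case (Suc k)
  have f: "smooth_upto n k W f"
    using Suc.prems smooth_upto_Suc_D by blast
  have "has_partial i (\<lambda>y. c m (f y)) (partial i f y * c (Suc m) (f y)) y" if "i < n" "y \<in> W" for i y
  proof -
    have "((\<lambda>t. f (y(i := t))) has_vector_derivative partial i f y) (at (y i))"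
      using Suc.prems that by (simp add: has_partial_def)
    from vector_diff_chain_at[OF this, of "c m" "c (Suc m) (f y)"] show ?thesis
      using c[of m "f y"] by (simp add: has_partial_def o_def has_real_derivative_iff_has_vector_derivative)
  qed
  moreover have "continuous_on W (\<lambda>y. c m (f y))"
    using Suc.prems by (intro continuous_on_compose2[OF cont]) auto
  moreover have "smooth_upto n k W (\<lambda>y. partial i f y * c (Suc m) (f y))" if "i < n" for i
    using Suc that f by (intro smooth_upto_bilinear[OF W bounded_bilinear_mult]) auto
  ultimately show ?case
    by (intro smooth_upto_SucI[OF W, where d = "\<lambda>i y. partial i f y * c (Suc m) (f y)"])
  qed
qed

lemma smooth_on_compose:
  fixes c :: "nat \<Rightarrow> real \<Rightarrow> real"
  assumes "openin (top_of_set (Rn n)) W"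
    and "\<And>m x. (c m has_real_derivative c (Suc m) x) (at x)" and "smooth_on n W f"
  shows "smooth_on n W (\<lambda>y. c m (f y))"
  using assms by (simp add: smooth_on_iff_upto smooth_upto_compose)

lemma smooth_on_Un:
  assumes "openin (top_of_set (Rn n)) W1" "openin (top_of_set (Rn n)) W2"
    and "smooth_on n W1 f" "smooth_on n W2 f"
  shows "smooth_on n (W1 \<union> W2) f"
proof -
  have "openin (top_of_set (W1 \<union> W2)) W1" "openin (top_of_set (W1 \<union> W2)) W2"
    using assms(1,2) by (meson Un_subset_iff openin_imp_subset openin_subset_trans sup.cobounded1 sup.cobounded2)+
  then show ?thesis
    using assms(3,4) unfolding smooth_on_def
    by (auto intro!: continuous_on_Un_local_open)
qed

lemma partials_add:
  assumes W: "openin (top_of_set (Rn n)) W" and f: "smooth_on n W f" and g: "smooth_on n W g"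
    and "set is \<subseteq> {..<n}" "y \<in> W"
  shows "partials is (\<lambda>y. f y + g y) y = partials is f y + partials is g y"
  using assms(4,5)
proof (induction "is" arbitrary: y)
  case (Cons i "is")
  have "partials (i # is) (\<lambda>y. f y + g y) y = partial i (\<lambda>y. partials is f y + partials is g y) y"
    using partial_cong[OF W, of y i "partials is (\<lambda>y. f y + g y)"] Cons by (simp add: partials_def)
  also have "\<dots> = partials (i # is) f y + partials (i # is) g y"
    using Cons smooth_on_partials[OF f, of "is"] smooth_on_partials[OF g, of "is"]
    by (intro has_partial_imp_partial has_partial_add) (auto simp: partials_def)
  finally show ?case .
qed simp

lemma partials_scaleR:
  assumes W: "openin (top_of_set (Rn n)) W" and f: "smooth_on n W f"
    and "set is \<subseteq> {..<n}" "y \<in> W"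
  shows "partials is (\<lambda>y. c *\<^sub>R f y) y = c *\<^sub>R partials is f y"
  using assms(3,4)
proof (induction "is" arbitrary: y)
  case (Cons i "is")
  have "partials (i # is) (\<lambda>y. c *\<^sub>R f y) y = partial i (\<lambda>y. c *\<^sub>R partials is f y) y"
    using partial_cong[OF W, of y i "partials is (\<lambda>y. c *\<^sub>R f y)"] Cons by (simp add: partials_def)
  also have "has_partial i (partials is f) (partials (i # is) f y) y"
    using Cons smooth_on_partials[OF f, of "is"] by (auto simp: partials_def)
  then have "partial i (\<lambda>y. c *\<^sub>R partials is f y) y = c *\<^sub>R partials (i # is) f y"
    using bounded_linear.has_vector_derivative[OF bounded_linear_scaleR_right, of _ "partials (i # is) f y"]
    by (intro has_partial_imp_partial) (simp add: has_partial_def)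
  finally show ?case .
qed simp

section \<open>A flat function\<close>

text \<open>The derivatives of exp (-1/x) on x > 0 have the form p(u) exp (-u) with u = 1/x. As
  du/dx = -u^2, the next polynomial is u^2 (p - p').\<close>

primrec flat_poly :: "nat \<Rightarrow> real poly"
  where "flat_poly 0 = 1"
  | "flat_poly (Suc m) = [:0, 0, 1:] * (flat_poly m - pderiv (flat_poly m))"

definition flat :: "nat \<Rightarrow> real \<Rightarrow> real"
  where "flat m x = (if x > 0 then poly (flat_poly m) (1 / x) * exp (- (1 / x)) else 0)"

lemma poly_mult_exp_minus_tendsto_0:
  "((\<lambda>u. poly p u * exp (- u)) \<longlongrightarrow> 0) at_top" for p :: "real poly"
proof -
  have "((\<lambda>u. \<Sum>i\<le>degree p. coeff p i * (u ^ i / exp u)) \<longlongrightarrow> (\<Sum>i\<le>degree p. coeff p i * 0)) at_top"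
    by (intro tendsto_intros tendsto_power_div_exp_0)
  then show ?thesis
    by (simp add: poly_altdef sum_distrib_right exp_minus divide_inverse mult.assoc)
qed

lemma flat_at_0: "(flat m has_real_derivative 0) (at 0)"
proof -
  have "((\<lambda>h. flat m h / h) \<longlongrightarrow> 0) (at_right 0)"
  proof -
    \<comment> \<open>The factor \<open>[:0, 1:]\<close> is the 1/h of the difference quotient after
      the substitution u = 1/h.\<close>
    have "((\<lambda>u. poly ([:0, 1:] * flat_poly m) u * exp (- u)) \<longlongrightarrow> 0) at_top"
      by (rule poly_mult_exp_minus_tendsto_0)
    then have "((\<lambda>h. poly ([:0, 1:] * flat_poly m) (inverse h) * exp (- inverse h)) \<longlongrightarrow> 0) (at_right 0)"
      by (rule filterlim_compose[OF _ filterlim_inverse_at_top_right])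
    then show ?thesis
      by (rule Lim_transform_eventually)
        (auto simp: eventually_at_filter flat_def field_simps intro!: always_eventually)
  qed
  moreover have "((\<lambda>h. flat m h / h) \<longlongrightarrow> 0) (at_left 0)"
    by (rule tendsto_eventually) (auto simp: eventually_at_filter flat_def)
  ultimately have "((\<lambda>h. flat m h / h) \<longlongrightarrow> 0) (at 0)"
    by (simp add: filterlim_split_at)
  then show ?thesis
    by (simp add: has_field_derivative_iff flat_def)
qed

text \<open>This is the hypothesis on the derivative family in \<open>smooth_on_compose\<close>;
  index 0 is the classical flat function.\<close>

lemma flat_deriv: "(flat m has_real_derivative flat (Suc m) x) (at x)"
proof (cases x "0::real" rule: linorder_cases)
  case less
  have "((\<lambda>x. 0) has_real_derivative 0) (at x)" by simp
  then have "(flat m has_real_derivative 0) (at x)"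
    by (rule has_field_derivative_transform_within[where d = "- x"])
      (use less in \<open>auto simp: flat_def dist_real_def\<close>)
  then show ?thesis using less by (simp add: flat_def)
next
  case equal
  then show ?thesis using flat_at_0[of m] by (simp add: flat_def[of "Suc m"])
next
  case greater
  have "((\<lambda>x. poly (flat_poly m) (1 / x) * exp (- (1 / x))) has_real_derivative flat (Suc m) x) (at x)"
    using greater unfolding flat_def
    by (auto intro!: derivative_eq_intros DERIV_chain2[OF poly_DERIV]
        simp: field_simps power2_eq_square)
  then show ?thesis
    by (rule has_field_derivative_transform_within[where d = x])
      (use greater in \<open>auto simp: flat_def dist_real_def\<close>)
qed

lemma flat_0_pos: "flat 0 x > 0 \<longleftrightarrow> x > 0" and flat_0_nonneg: "flat 0 x \<ge> 0"
  by (auto simp: flat_def)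

lemma flat_0_mono: "x \<le> y \<Longrightarrow> flat 0 x \<le> flat 0 y"
  by (auto simp: flat_def frac_le)

section \<open>Smooth functions on compact manifolds\<close>

text \<open>Points of \<open>Rn n\<close> agree at all indices from n on, so only the first n sides
  of a product neighbourhood of c restrict them, and a Euclidean ball fits into those.\<close>

lemma Rn_ball_subset:
  assumes "openin (top_of_set (Rn n)) W" "c \<in> W"
  obtains \<epsilon> where "\<epsilon> > 0" "\<And>y. y \<in> Rn n \<Longrightarrow> (\<Sum>i<n. (y i - c i)\<^sup>2) < \<epsilon>\<^sup>2 \<Longrightarrow> y \<in> W"
proof -
  obtain O' where O': "open O'" "W = Rn n \<inter> O'"
    using assms(1) by (auto simp: openin_open)
  then obtain X where X: "c \<in> (\<Pi>\<^sub>E i\<in>UNIV. X i)" "\<And>i. open (X i)" "(\<Pi>\<^sub>E i\<in>UNIV. X i) \<subseteq> O'"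
    using product_topology_open_contains_basis[of "\<lambda>_. euclidean" UNIV O' c] assms(2)
    by (auto simp: open_fun_def)
  have "\<exists>e>0. \<forall>z. \<bar>z - c i\<bar> < e \<longrightarrow> z \<in> X i" for i
    using X(1) X(2)[of i] unfolding open_dist by (auto simp: PiE_iff dist_real_def)
  then obtain e where e: "\<And>i. e i > 0" "\<And>i z. \<bar>z - c i\<bar> < e i \<Longrightarrow> z \<in> X i"
    by metis
  \<comment> \<open>The element 1 keeps the minimum defined when n = 0.\<close>
  define \<epsilon> where "\<epsilon> = Min (insert 1 (e ` {..<n}))"
  have \<epsilon>: "\<epsilon> > 0" "\<And>i. i < n \<Longrightarrow> \<epsilon> \<le> e i"
    using e(1) by (auto simp: \<epsilon>_def)
  show ?thesis
  proof (rule that[OF \<epsilon>(1)])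
    fix y assume y: "y \<in> Rn n" "(\<Sum>i<n. (y i - c i)\<^sup>2) < \<epsilon>\<^sup>2"
    have "y i \<in> X i" for i
    proof (cases "i < n")
      case True
      have "(y i - c i)\<^sup>2 \<le> (\<Sum>i<n. (y i - c i)\<^sup>2)"
        using True by (intro member_le_sum) auto
      then have "\<bar>y i - c i\<bar>\<^sup>2 < \<epsilon>\<^sup>2"
        using y(2) by simp
      then have "\<bar>y i - c i\<bar> < \<epsilon>"
        using \<epsilon>(1) by (meson less_imp_le power_less_imp_less_base)
      then show ?thesis using e(2) \<epsilon>(2)[OF True] by force
    next
      case False
      then have "y i = c i"
        using y(1) assms(2) O'(2) by (auto simp: Rn_def PiE_iff extensional_def)
      then show ?thesis using e by simp
    qed
    then show "y \<in> W" using y(1) X(3) O'(2) by auto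
  qed
qed

locale compact_manifold =
  fixes n :: nat and A :: "'m::{t2_space, second_countable_topology} chart set"
  assumes compact_UNIV: "compact (UNIV :: 'm set)"
    and manifold: "oriented_smooth_manifold n A"
begin

text \<open>A compact Hausdorff space is regular. The closed set between the two open ones is what
  later permits smooth extension by zero.\<close>

lemma closed_nbhd:
  assumes "open W" "(x::'m) \<in> W"
  obtains N C where "open N" "closed C" "x \<in> N" "N \<subseteq> C" "C \<subseteq> W"
proof -
  have "Hausdorff_space (euclidean :: 'm topology)"
    unfolding Hausdorff_space_def disjnt_def by simp (metis hausdorff)
  then have "regular_space (euclidean :: 'm topology)"
    using compact_UNIV by (intro compact_Hausdorff_imp_regular_space) (auto simp: compact_space_def)
  moreover have "closed (- W)" "x \<notin> - W" using assms by auto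
  ultimately have "\<exists>U V. open U \<and> open V \<and> x \<in> U \<and> - W \<subseteq> V \<and> disjnt U V"
    unfolding regular_space_def by fastforce
  then obtain U V where "open U" "open V" "x \<in> U" "- W \<subseteq> V" "disjnt U V"
    by blast
  then show ?thesis
    by (intro that[of U "- V"]) (auto simp: disjnt_def)
qed

lemma
  assumes "(U, \<phi>) \<in> A"
  shows chart_open: "open U"
    and chart_homeomorphism: "homeomorphism U (\<phi> ` U) \<phi> (inv_into U \<phi>)"
    and chart_range_open: "openin (top_of_set (Rn n)) (\<phi> ` U)"
    and chart_coord_smooth: "i < n \<Longrightarrow> smooth_fun n A U (\<lambda>x. \<phi> x i)"
  using manifold assms unfolding oriented_smooth_manifold_def smooth_fun_def by fast+

lemma chart_at: obtains U \<phi> where "(U, \<phi>) \<in> A" "x \<in> U"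
proof -
  have "x \<in> (\<Union>(U, \<phi>)\<in>A. U)"
    using manifold unfolding oriented_smooth_manifold_def by simp
  then show ?thesis using that by auto
qed

lemma chart_inv: "(U, \<phi>) \<in> A \<Longrightarrow> x \<in> U \<Longrightarrow> inv_into U \<phi> (\<phi> x) = x"
  using chart_homeomorphism by (auto simp: homeomorphism_def)

lemma chart_continuous_on: "(U, \<phi>) \<in> A \<Longrightarrow> continuous_on U \<phi>"
  using chart_homeomorphism by (auto simp: homeomorphism_def)

lemma chart_image_open:
  assumes "(U, \<phi>) \<in> A" "open V"
  shows "openin (top_of_set (Rn n)) (\<phi> ` (U \<inter> V))"
proof -
  have "openin (top_of_set U) (U \<inter> V)"
    using assms(2) by (rule openin_open_Int)
  then have "openin (top_of_set (\<phi> ` U)) (\<phi> ` (U \<inter> V))"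
    by (rule homeomorphism_imp_open_map[OF chart_homeomorphism[OF assms(1)]])
  then show ?thesis
    using chart_range_open[OF assms(1)] by (rule openin_trans)
qed

lemma chart_image_subset_Rn: "(U, \<phi>) \<in> A \<Longrightarrow> x \<in> U \<Longrightarrow> \<phi> x \<in> Rn n"
  using openin_imp_subset[OF chart_range_open] by blast

section \<open>Smoothness in charts: locality, algebra and continuity\<close>

lemma smooth_fun_subset: "smooth_fun n A V f \<Longrightarrow> V' \<subseteq> V \<Longrightarrow> smooth_fun n A V' f"
  unfolding smooth_fun_def
  by (clarify, drule (1) bspec, clarify) (rule smooth_on_subset, assumption, auto)

lemma smooth_fun_cong:
  assumes "open V" "\<And>x. x \<in> V \<Longrightarrow> f x = g x"
  shows "smooth_fun n A V f \<longleftrightarrow> smooth_fun n A V g"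
proof -
  have "smooth_on n (\<phi> ` (U \<inter> V)) (\<lambda>y. f (inv_into U \<phi> y)) \<longleftrightarrow>
      smooth_on n (\<phi> ` (U \<inter> V)) (\<lambda>y. g (inv_into U \<phi> y))" if "(U, \<phi>) \<in> A" for U \<phi>
    by (rule smooth_on_cong[OF chart_image_open[OF that assms(1)]])
      (use chart_inv[OF that] assms in auto)
  then show ?thesis unfolding smooth_fun_def by fast
qed

lemma smooth_fun_Un:
  assumes "open V1" "open V2" "smooth_fun n A V1 f" "smooth_fun n A V2 f"
  shows "smooth_fun n A (V1 \<union> V2) f"
  unfolding smooth_fun_def
proof (clarify)
  fix U \<phi> assume c: "(U, \<phi>) \<in> A"
  then have "smooth_on n (\<phi> ` (U \<inter> V1)) (\<lambda>y. f (inv_into U \<phi> y))"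
    "smooth_on n (\<phi> ` (U \<inter> V2)) (\<lambda>y. f (inv_into U \<phi> y))"
    using assms(3,4) by (auto simp: smooth_fun_def)
  from smooth_on_Un[OF chart_image_open[OF c assms(1)] chart_image_open[OF c assms(2)] this]
  show "smooth_on n (\<phi> ` (U \<inter> (V1 \<union> V2))) (\<lambda>y. f (inv_into U \<phi> y))"
    by (simp add: Int_Un_distrib image_Un)
qed

lemma smooth_fun_add:
  "open V \<Longrightarrow> smooth_fun n A V f \<Longrightarrow> smooth_fun n A V g \<Longrightarrow> smooth_fun n A V (\<lambda>x. f x + g x)"
  unfolding smooth_fun_def using smooth_on_add[OF chart_image_open] by fast

lemma smooth_fun_const: "open V \<Longrightarrow> smooth_fun n A V (\<lambda>x. c)"
  unfolding smooth_fun_def using smooth_on_const[OF chart_image_open] by fast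

lemma smooth_fun_bilinear:
  assumes "bounded_bilinear B" "open V" "smooth_fun n A V f" "smooth_fun n A V g"
  shows "smooth_fun n A V (\<lambda>x. B (f x) (g x))"
  unfolding smooth_fun_def
proof (clarify)
  fix U \<phi> assume c: "(U, \<phi>) \<in> A"
  then have "smooth_on n (\<phi> ` (U \<inter> V)) (\<lambda>y. f (inv_into U \<phi> y))"
    "smooth_on n (\<phi> ` (U \<inter> V)) (\<lambda>y. g (inv_into U \<phi> y))"
    using assms(3,4) by (auto simp: smooth_fun_def)
  then show "smooth_on n (\<phi> ` (U \<inter> V)) (\<lambda>y. B (f (inv_into U \<phi> y)) (g (inv_into U \<phi> y)))"
    by (rule smooth_on_bilinear[OF assms(1) chart_image_open[OF c assms(2)]])
qed

lemmas smooth_fun_mult = smooth_fun_bilinear[OF bounded_bilinear_mult]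
lemmas smooth_fun_scaleR = smooth_fun_bilinear[OF bounded_bilinear_scaleR]

lemma smooth_fun_linear:
  assumes "bounded_linear L" "open V" "smooth_fun n A V f"
  shows "smooth_fun n A V (\<lambda>x. L (f x))"
  unfolding smooth_fun_def
proof (clarify)
  fix U \<phi> assume c: "(U, \<phi>) \<in> A"
  then have "smooth_on n (\<phi> ` (U \<inter> V)) (\<lambda>y. f (inv_into U \<phi> y))"
    using assms(3) by (auto simp: smooth_fun_def)
  then show "smooth_on n (\<phi> ` (U \<inter> V)) (\<lambda>y. L (f (inv_into U \<phi> y)))"
    by (rule smooth_on_linear[OF assms(1) chart_image_open[OF c assms(2)]])
qed

lemma smooth_fun_diff:
  assumes "open V" "smooth_fun n A V f" "smooth_fun n A V g"
  shows "smooth_fun n A V (\<lambda>x. f x - g x)"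
  using smooth_fun_add[OF assms(1,2) smooth_fun_linear[OF bounded_linear_minus[OF bounded_linear_ident] assms(1,3)]]
  by simp

lemma smooth_fun_compose:
  fixes c :: "nat \<Rightarrow> real \<Rightarrow> real"
  assumes "\<And>m x. (c m has_real_derivative c (Suc m) x) (at x)" "open V" "smooth_fun n A V f"
  shows "smooth_fun n A V (\<lambda>x. c m (f x))"
  unfolding smooth_fun_def
proof (clarify)
  fix U \<phi> assume ch: "(U, \<phi>) \<in> A"
  then have "smooth_on n (\<phi> ` (U \<inter> V)) (\<lambda>y. f (inv_into U \<phi> y))"
    using assms(3) by (auto simp: smooth_fun_def)
  then show "smooth_on n (\<phi> ` (U \<inter> V)) (\<lambda>y. c m (f (inv_into U \<phi> y)))"
    by (rule smooth_on_compose[where c = c, OF chart_image_open[OF ch assms(2)] assms(1)])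
qed

lemma smooth_fun_sum:
  assumes "open V" "\<And>a. a \<in> I \<Longrightarrow> smooth_fun n A V (f a)"
  shows "smooth_fun n A V (\<lambda>x. \<Sum>a\<in>I. f a x)"
  using assms(2) by (induction I rule: infinite_finite_induct)
    (auto intro!: smooth_fun_const smooth_fun_add assms(1))

lemma smooth_fun_power:
  fixes f :: "'m \<Rightarrow> real"
  shows "open V \<Longrightarrow> smooth_fun n A V f \<Longrightarrow> smooth_fun n A V (\<lambda>x. f x ^ k)"
  by (induction k) (auto intro!: smooth_fun_const smooth_fun_mult)

lemma smooth_fun_prod:
  fixes f :: "'a \<Rightarrow> 'm \<Rightarrow> real"
  assumes "open V" "\<And>a. a \<in> I \<Longrightarrow> smooth_fun n A V (f a)"
  shows "smooth_fun n A V (\<lambda>x. \<Prod>a\<in>I. f a x)"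
  using assms(2) by (induction I rule: infinite_finite_induct)
    (auto intro!: smooth_fun_const smooth_fun_mult assms(1))

lemma smooth_fun_continuous_on:
  assumes "smooth_fun n A V f" "open V"
  shows "continuous_on V f"
proof -
  have "isCont f x" if x: "x \<in> V" for x
  proof -
    obtain U \<phi> where c: "(U, \<phi>) \<in> A" "x \<in> U" by (rule chart_at)
    have "continuous_on (\<phi> ` (U \<inter> V)) (\<lambda>y. f (inv_into U \<phi> y))"
      using assms(1) c smooth_on_imp_continuous_on unfolding smooth_fun_def by fast
    then have "continuous_on (U \<inter> V) (\<lambda>x. f (inv_into U \<phi> (\<phi> x)))"
      by (rule continuous_on_compose2) (use continuous_on_subset[OF chart_continuous_on[OF c(1)]] in auto)
    then have "continuous_on (U \<inter> V) f"
      using chart_inv[OF c(1)] by (simp cong: continuous_on_cong_simp)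
    then show ?thesis
      using c x chart_open assms(2) by (meson IntI continuous_on_eq_continuous_at open_Int)
  qed
  then show ?thesis by (simp add: continuous_at_imp_continuous_on)
qed

text \<open>The open sets V \<inter> V' and V' - C cover V' because C \<subseteq> V, and on the
  second one f is the zero function.\<close>

lemma smooth_fun_extend:
  assumes "open V" "closed C" "C \<subseteq> V" "open V'" "smooth_fun n A (V \<inter> V') f"
    and "\<And>x. x \<in> V' - C \<Longrightarrow> f x = 0"
  shows "smooth_fun n A V' f"
proof -
  have "smooth_fun n A (V' - C) f"
    using smooth_fun_const[of "V' - C" 0] smooth_fun_cong[of "V' - C" f "\<lambda>_. 0"] assms
    by (auto simp: open_Diff)
  then have "smooth_fun n A ((V \<inter> V') \<union> (V' - C)) f"
    using assms by (intro smooth_fun_Un) auto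
  then show ?thesis
    by (rule smooth_fun_subset) (use assms(3) in auto)
qed

text \<open>The flat function is applied to \<epsilon>^2 minus the squared coordinate distance from
  x0 and divided by its value at x0. Its positivity set lies in N, and the closed set C between N
  and the chart domain permits extension by zero.\<close>

lemma bump_function:
  assumes "open W" "x0 \<in> W"
  obtains \<rho> :: "'m \<Rightarrow> real" and C where "smooth_fun n A UNIV \<rho>" "\<And>x. 0 \<le> \<rho> x" "\<And>x. \<rho> x \<le> 1" "\<rho> x0 = 1"
    "closed C" "C \<subseteq> W" "\<And>x. x \<notin> C \<Longrightarrow> \<rho> x = 0"
proof -
  obtain U \<phi> where c: "(U, \<phi>) \<in> A" "x0 \<in> U" by (rule chart_at)
  obtain N C where NC: "open N" "closed C" "x0 \<in> N" "N \<subseteq> C" "C \<subseteq> U \<inter> W"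
    by (rule closed_nbhd[of "U \<inter> W" x0]) (use assms c chart_open in auto)
  have "openin (top_of_set (Rn n)) (\<phi> ` (U \<inter> N))" "\<phi> x0 \<in> \<phi> ` (U \<inter> N)"
    using chart_image_open[OF c(1) NC(1)] NC c by auto
  then obtain \<epsilon> where \<epsilon>: "\<epsilon> > 0"
    "\<And>y. y \<in> Rn n \<Longrightarrow> (\<Sum>i<n. (y i - \<phi> x0 i)\<^sup>2) < \<epsilon>\<^sup>2 \<Longrightarrow> y \<in> \<phi> ` (U \<inter> N)"
    by (rule Rn_ball_subset) blast
  define s where "s = (\<lambda>x. \<Sum>i<n. (\<phi> x i - \<phi> x0 i)\<^sup>2)"
  define \<rho> where "\<rho> = (\<lambda>x. if x \<in> U then flat 0 (\<epsilon>\<^sup>2 - s x) / flat 0 (\<epsilon>\<^sup>2) else 0)"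
  have pos: "flat 0 (\<epsilon>\<^sup>2) > 0"
    using \<epsilon>(1) by (simp add: flat_0_pos)
  have out: "\<rho> x = 0" if "x \<notin> C" for x
  proof (rule ccontr)
    assume "\<rho> x \<noteq> 0"
    then have x: "x \<in> U" "flat 0 (\<epsilon>\<^sup>2 - s x) \<noteq> 0"
      by (auto simp: \<rho>_def split: if_splits)
    then have "s x < \<epsilon>\<^sup>2"
      using flat_0_nonneg[of "\<epsilon>\<^sup>2 - s x"] flat_0_pos[of "\<epsilon>\<^sup>2 - s x"] by linarith
    then have "\<phi> x \<in> \<phi> ` (U \<inter> N)"
      using \<epsilon>(2) chart_image_subset_Rn[OF c(1) x(1)] by (simp add: s_def)
    then obtain z where "z \<in> U" "z \<in> N" "\<phi> x = \<phi> z" by auto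
    then have "x \<in> N" using chart_inv[OF c(1)] x(1) by metis
    then show False using that NC by auto
  qed
  have "smooth_fun n A U s"
    unfolding s_def using chart_coord_smooth[OF c(1)] chart_open[OF c(1)]
    by (intro smooth_fun_sum smooth_fun_power smooth_fun_diff smooth_fun_const) auto
  then have "smooth_fun n A U (\<lambda>x. flat 0 (\<epsilon>\<^sup>2 - s x))"
    using chart_open[OF c(1)]
    by (intro smooth_fun_compose[of flat] flat_deriv smooth_fun_diff smooth_fun_const)
  then have "smooth_fun n A U (\<lambda>x. flat 0 (\<epsilon>\<^sup>2 - s x) * (1 / flat 0 (\<epsilon>\<^sup>2)))"
    using chart_open[OF c(1)] by (intro smooth_fun_mult smooth_fun_const)
  then have "smooth_fun n A U \<rho>"
    using smooth_fun_cong[OF chart_open[OF c(1)], of \<rho> "\<lambda>x. flat 0 (\<epsilon>\<^sup>2 - s x) * (1 / flat 0 (\<epsilon>\<^sup>2))"]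
    by (simp add: \<rho>_def)
  then have "smooth_fun n A UNIV \<rho>"
    using NC chart_open[OF c(1)] out by (intro smooth_fun_extend[of U C UNIV]) auto
  moreover have "s x \<ge> 0" for x
    by (simp add: s_def sum_nonneg)
  then have "0 \<le> \<rho> x" "\<rho> x \<le> 1" for x
    using pos flat_0_nonneg flat_0_mono[of "\<epsilon>\<^sup>2 - s x" "\<epsilon>\<^sup>2"] by (auto simp: \<rho>_def)
  moreover have "\<rho> x0 = 1"
    using c pos by (simp add: \<rho>_def s_def)
  ultimately show ?thesis
    using that[of \<rho> C] NC out by auto
qed

text \<open>Bump functions vanishing off W, with positivity sets covering W, are reduced to a
  sequence b by the Lindeloef property. The product over j < m of 1 - b j is 1 off W; at a point
  with b j x > 0 it is eventually at most 1 - b j x < 1, and the m-th power drives it to 0.\<close>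

lemma smooth_indicator_approx:
  assumes W: "open (W :: 'm set)"
  obtains \<rho> :: "nat \<Rightarrow> 'm \<Rightarrow> real" where "\<And>m. smooth_fun n A UNIV (\<rho> m)"
    "\<And>m x. 0 \<le> \<rho> m x" "\<And>m x. \<rho> m x \<le> 1"
    "\<And>x. (\<lambda>m. \<rho> m x) \<longlonglongrightarrow> indicator W x"
proof -
  define B where "B = {\<rho>. smooth_fun n A UNIV \<rho> \<and> (\<forall>x. 0 \<le> \<rho> x \<and> \<rho> x \<le> 1 \<and> (x \<notin> W \<longrightarrow> \<rho> x = (0::real)))}"
  define S where "S = (\<lambda>\<rho>::'m \<Rightarrow> real. {x. \<rho> x > 0})"
  have S: "open (S \<rho>)" if "\<rho> \<in> B" for \<rho>
  proof -
    have "continuous_on UNIV \<rho>"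
      using that smooth_fun_continuous_on by (auto simp: B_def)
    then show ?thesis unfolding S_def by (intro open_Collect_less continuous_on_const)
  qed
  obtain F where F: "F \<subseteq> S ` B" "countable F" "\<Union>F = \<Union>(S ` B)"
    by (rule Lindelof[of "S ` B"]) (use S in auto)
  then obtain B' where B': "B' \<subseteq> B" "countable B'" "\<Union>(S ` B') = \<Union>(S ` B)"
    using countable_subset_image[of F S B] by auto
  have zero: "(\<lambda>_. 0) \<in> B"
    using smooth_fun_const by (auto simp: B_def)
  \<comment> \<open>The zero function makes the enumerated set nonempty, also when W is
    empty.\<close>
  define b where "b = from_nat_into (insert (\<lambda>_. 0) B')"
  have b: "range b = insert (\<lambda>_. 0) B'"
    unfolding b_def using B' by (intro range_from_nat_into) auto
  then have bB: "b j \<in> B" for j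
    using B' zero by (metis insert_subset rangeI subsetD)
  then have b01: "0 \<le> b j x" "b j x \<le> 1" "x \<notin> W \<Longrightarrow> b j x = 0" "smooth_fun n A UNIV (b j)" for j x
    by (auto simp: B_def)
  have cov: "\<exists>j. b j x > 0" if x: "x \<in> W" for x
  proof -
    obtain \<rho> C where "smooth_fun n A UNIV \<rho>" "\<And>x. 0 \<le> \<rho> x" "\<And>x. \<rho> x \<le> 1" "\<rho> x = 1"
      "closed C" "C \<subseteq> W" "\<And>x. x \<notin> C \<Longrightarrow> \<rho> x = (0::real)"
      using bump_function[OF W x] by metis
    then have "\<rho> \<in> B" "x \<in> S \<rho>" by (auto simp: B_def S_def)
    then have "x \<in> \<Union>(S ` B')" using B'(3) by blast
    then obtain \<rho>' where "\<rho>' \<in> B'" "\<rho>' x > 0" by (auto simp: S_def)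
    then show ?thesis using b by (metis insertCI rangeE)
  qed
  define \<rho> where "\<rho> = (\<lambda>m x. 1 - (\<Prod>j<m. 1 - b j x) ^ m)"
  have p01: "0 \<le> (\<Prod>j<m. 1 - b j x)" "(\<Prod>j<m. 1 - b j x) \<le> 1" for m x
    using b01 by (auto intro!: prod_nonneg prod_le_1)
  have "(\<lambda>m. \<rho> m x) \<longlonglongrightarrow> indicator W x" for x
  proof (cases "x \<in> W")
    case False
    then show ?thesis using b01(3) by (simp add: \<rho>_def)
  next
    case True
    then obtain j where j: "b j x > 0" using cov by blast
    have "(\<lambda>m. (\<Prod>j<m. 1 - b j x) ^ m) \<longlonglongrightarrow> 0"
    proof (rule tendsto_sandwich[where f = "\<lambda>_. 0" and h = "\<lambda>m. (1 - b j x) ^ m"])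
      show "\<forall>\<^sub>F m in sequentially. (\<Prod>j<m. 1 - b j x) ^ m \<le> (1 - b j x) ^ m"
        using eventually_gt_at_top[of j]
      proof eventually_elim
        case (elim m)
        have "(\<Prod>j<m. 1 - b j x) = (1 - b j x) * (\<Prod>i\<in>{..<m} - {j}. 1 - b i x)"
          using elim by (intro prod.remove) auto
        also have "\<dots> \<le> (1 - b j x) * 1"
          using b01 by (intro mult_left_mono prod_le_1) auto
        finally show ?case using p01 by (simp add: power_mono)
      qed
      show "(\<lambda>m. (1 - b j x) ^ m) \<longlonglongrightarrow> 0"
        using j b01(1,2)[where j = j and x = x] by (intro LIMSEQ_power_zero) auto
    qed (auto simp: p01)
    from tendsto_diff[OF tendsto_const[of 1] this] show ?thesis
      using True by (simp add: \<rho>_def)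
  qed
  moreover have "smooth_fun n A UNIV (\<rho> m)" for m
    unfolding \<rho>_def using b01(4)
    by (intro smooth_fun_diff smooth_fun_power smooth_fun_prod smooth_fun_const) auto
  moreover have "0 \<le> \<rho> m x" "\<rho> m x \<le> 1" for m x
    using p01[where m = m and x = x] by (auto simp: \<rho>_def power_le_one)
  ultimately show ?thesis
    using that[of \<rho>] by blast
qed

end

section \<open>Positive definite Hermitian matrices\<close>

text \<open>This is x^T M conj(x): forms are linear in the first argument, so the conjugate belongs
  to the second index of the matrix h(e_i, e_j).\<close>

definition hform :: "complex ^ 'r ^ 'r \<Rightarrow> complex ^ 'r \<Rightarrow> complex"
  where "hform M x = (\<Sum>i\<in>UNIV. \<Sum>j\<in>UNIV. x $ i * cnj (x $ j) * M $ i $ j)"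

text \<open>Hermitian symmetry is kept apart as \<open>adj M = M\<close>. The set is then open among
  all matrices, as the perturbation of curves requires.\<close>

definition posdef :: "(complex ^ 'r ^ 'r) set"
  where "posdef = {M. \<forall>x. x \<noteq> 0 \<longrightarrow> Re (hform M x) > 0}"

definition adj :: "complex ^ 'r ^ 'r \<Rightarrow> complex ^ 'r ^ 'r"
  where "adj M = (\<chi> i j. cnj (M $ j $ i))"

definition mat_metric :: "real \<Rightarrow> complex ^ 'r ^ 'r \<Rightarrow> complex ^ 'r ^ 'r \<Rightarrow> real"
  where "mat_metric a H V =
    Re (Determinants.trace ((matrix_inv H ** V) ** (matrix_inv H ** V))) +
    a * (Re (Determinants.trace (matrix_inv H ** V)))\<^sup>2"

lemma hform_add: "hform (M + N) x = hform M x + hform N x"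
  by (simp add: hform_def sum.distrib algebra_simps)

lemma hform_scaleR: "hform (c *\<^sub>R M) x = c *\<^sub>R hform M x"
  by (simp add: hform_def scaleR_sum_right)

lemma hform_scaleR_vec: "hform M (c *\<^sub>R x) = c\<^sup>2 *\<^sub>R hform M x"
  by (simp add: hform_def scaleR_sum_right power2_eq_square)

lemma invertible_matrix_inv:
  assumes "invertible (M :: 'a::semiring_1 ^ 'n ^ 'm)"
  shows "M ** matrix_inv M = Finite_Cartesian_Product.mat 1" "matrix_inv M ** M = Finite_Cartesian_Product.mat 1"
  using someI_ex[OF assms[unfolded invertible_def]] unfolding matrix_inv_def by auto

lemma posdef_convex:
  assumes "M \<in> posdef" "N \<in> posdef" "0 \<le> u" "0 \<le> v" "u + v = 1"
  shows "u *\<^sub>R M + v *\<^sub>R N \<in> posdef"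
proof -
  have "0 < u * Re (hform M x) + v * Re (hform N x)" if "x \<noteq> 0" for x
  proof (cases "u = 0")
    case True then show ?thesis using assms that by (simp add: posdef_def)
  next
    case False
    then have "0 < u * Re (hform M x)" "0 \<le> v * Re (hform N x)"
      using assms that by (auto simp: posdef_def less_imp_le)
    then show ?thesis by linarith
  qed
  then show ?thesis by (simp add: posdef_def hform_add hform_scaleR)
qed

text \<open>By homogeneity only unit vectors matter, and compactness of the sphere turns witnesses
  of failure along a convergent sequence of matrices into a witness for the limit.\<close>

lemma posdef_open: "open (posdef :: (complex ^ 'r ^ 'r) set)"
proof -
  let ?S = "sphere (0 :: complex ^ 'r) 1"
  define Q where "Q = {M :: complex ^ 'r ^ 'r. \<exists>x\<in>?S. Re (hform M x) \<le> 0}"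
  have "closed Q"
    unfolding closed_sequential_limits
  proof (intro allI impI, elim conjE)
    fix M L assume M: "\<forall>k. M k \<in> Q" and L: "M \<longlonglongrightarrow> L"
    from M obtain x where x: "\<And>k. x k \<in> ?S" "\<And>k. Re (hform (M k) (x k)) \<le> 0"
      unfolding Q_def mem_Collect_eq by metis
    have "compact ?S" by simp
    then obtain l r where l: "l \<in> ?S" "strict_mono r" "(x \<circ> r) \<longlonglongrightarrow> l"
      using x(1) unfolding compact_def by metis
    have "(M \<circ> r) \<longlonglongrightarrow> L"
      using L l(2) by (rule LIMSEQ_subseq_LIMSEQ)
    with l(3) have "(\<lambda>k. Re (hform ((M \<circ> r) k) ((x \<circ> r) k))) \<longlonglongrightarrow> Re (hform L l)"
      unfolding hform_def by (intro tendsto_intros)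
    then have "Re (hform L l) \<le> 0"
      by (rule LIMSEQ_le_const2) (use x(2) in auto)
    then show "L \<in> Q" using l(1) by (auto simp: Q_def)
  qed
  moreover have "posdef = - Q"
  proof -
    have "Re (hform M x) > 0" if M: "M \<notin> Q" and x: "x \<noteq> 0" for M x
    proof -
      have "Re (hform M ((1 / norm x) *\<^sub>R x)) > 0" using M x by (auto simp: Q_def not_le)
      then show ?thesis
        using x by (simp add: hform_scaleR_vec zero_less_mult_iff)
    qed
    moreover have "M \<notin> Q" if "M \<in> posdef" for M
    proof
      assume "M \<in> Q"
      then obtain x where "norm x = 1" "Re (hform M x) \<le> 0" by (auto simp: Q_def)
      moreover have "x \<noteq> 0" using \<open>norm x = 1\<close> by auto
      ultimately show False using that by (auto simp: posdef_def not_le[symmetric])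
    qed
    ultimately show ?thesis unfolding posdef_def by blast
  qed
  ultimately show ?thesis by (simp add: closed_def)
qed

lemma posdef_invertible:
  assumes "M \<in> posdef"
  shows "invertible M"
proof -
  have "y = 0" if "M *v y = 0" for y
  proof (rule ccontr)
    assume y: "y \<noteq> 0"
    \<comment> \<open>\<open>hform M x\<close> pairs x with M applied to the conjugate of x, so a
      kernel vector has to be conjugated before it is tested.\<close>
    define x where "x = (\<chi> i. cnj (y $ i))"
    have "x \<noteq> 0"
    proof
      assume "x = 0"
      then have "cnj (y $ i) = 0" for i unfolding x_def by (metis vec_lambda_beta zero_index)
      then show False using y by (simp add: Finite_Cartesian_Product.vec_eq_iff)
    qed
    moreover have "hform M x = (\<Sum>i\<in>UNIV. x $ i * (M *v y) $ i)"
      by (simp add: hform_def x_def matrix_vector_mult_def sum_distrib_left mult_ac)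
    then have "hform M x = 0" using that by simp
    ultimately show False using assms by (auto simp: posdef_def)
  qed
  then show ?thesis
    by (meson invertible_left_inverse matrix_left_invertible_ker)
qed

text \<open>Cramer's rule. The entries of the inverse become quotients of polynomials in the entries
  of M, from which continuity of inversion is read off.\<close>

lemma matrix_inv_component:
  fixes M :: "complex ^ 'r ^ 'r"
  assumes "invertible M"
  shows "matrix_inv M $ k $ l = Determinants.det (\<chi> i j. if j = k then axis l 1 $ i else M $ i $ j) / Determinants.det M"
proof -
  have "M *v (matrix_inv M *v axis l 1) = axis l 1"
    using assms by (simp add: matrix_vector_mul_assoc invertible_matrix_inv)
  then have "matrix_inv M *v axis l 1 =
      (\<chi> k. Determinants.det (\<chi> i j. if j = k then axis l 1 $ i else M $ i $ j) / Determinants.det M)"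
    using cramer[of M "matrix_inv M *v axis l 1" "axis l 1"] assms by (simp add: invertible_det_nz)
  then have "(matrix_inv M *v axis l 1) $ k =
      Determinants.det (\<chi> i j. if j = k then axis l 1 $ i else M $ i $ j) / Determinants.det M"
    by simp
  then show ?thesis
    by (simp add: matrix_vector_mult_def axis_def if_distrib cong: if_cong)
qed

lemma continuous_on_det:
  fixes f :: "'z::topological_space \<Rightarrow> complex ^ 'r ^ 'r"
  assumes "\<And>i j. continuous_on S (\<lambda>z. f z $ i $ j)"
  shows "continuous_on S (\<lambda>z. Determinants.det (f z))"
  unfolding Determinants.det_def by (intro continuous_intros assms)

lemma continuous_on_matrix_inv:
  fixes f :: "'z::topological_space \<Rightarrow> complex ^ 'r ^ 'r"
  assumes f: "continuous_on S f" and "\<And>z. z \<in> S \<Longrightarrow> invertible (f z)"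
  shows "continuous_on S (\<lambda>z. matrix_inv (f z))"
proof -
  have c: "continuous_on S (\<lambda>z. f z $ i $ j)" for i j
    by (intro continuous_intros f)
  have "continuous_on S (\<lambda>z. matrix_inv (f z) $ k $ l)" for k l
  proof -
    have "continuous_on S (\<lambda>z. Determinants.det (\<chi> i j. if j = k then axis l 1 $ i else f z $ i $ j) / Determinants.det (f z))"
    proof (intro continuous_on_divide continuous_on_det)
      fix i j show "continuous_on S (\<lambda>z. (\<chi> i j. if j = k then axis l 1 $ i else f z $ i $ j) $ i $ j)"
        using c by (cases "j = k") (auto intro: continuous_intros)
    qed (use c assms(2) invertible_det_nz in auto)
    then show ?thesis
      by (rule continuous_on_eq) (simp add: matrix_inv_component assms(2))
  qed
  then have "continuous_on S (\<lambda>z. \<chi> k l. matrix_inv (f z) $ k $ l)"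
    by (intro continuous_on_vec_lambda)
  then show ?thesis by simp
qed

lemma continuous_on_matrix_mult [continuous_intros]:
  fixes f g :: "'z::topological_space \<Rightarrow> complex ^ 'r ^ 'r"
  assumes "continuous_on S f" "continuous_on S g"
  shows "continuous_on S (\<lambda>z. f z ** g z)"
  unfolding matrix_matrix_mult_def by (intro continuous_intros continuous_on_vec_lambda assms)

lemma continuous_on_mat_metric:
  assumes "continuous_on S a" "continuous_on S f" "continuous_on S g" "\<And>z. z \<in> S \<Longrightarrow> f z \<in> posdef"
  shows "continuous_on S (\<lambda>z. mat_metric (a z) (f z) (g z))"
  unfolding mat_metric_def Determinants.trace_def
  by (intro continuous_intros continuous_on_matrix_inv assms posdef_invertible) auto

section \<open>Positive semidefinite matrices as sums of rank one matrices\<close>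

definition sesq :: "complex ^ 'r ^ 'r \<Rightarrow> complex ^ 'r \<Rightarrow> complex ^ 'r \<Rightarrow> complex"
  where "sesq M x y = (\<Sum>i\<in>UNIV. \<Sum>j\<in>UNIV. x $ i * cnj (y $ j) * M $ i $ j)"

lemma hform_sesq: "hform M x = sesq M x x"
  by (simp add: hform_def sesq_def)

lemma sesq_add_left: "sesq M (x + y) z = sesq M x z + sesq M y z"
  and sesq_add_right: "sesq M z (x + y) = sesq M z x + sesq M z y"
  by (simp_all add: sesq_def sum.distrib algebra_simps)

lemma sesq_axis_right: "sesq M x (c *s axis a 1) = cnj c * (\<Sum>i\<in>UNIV. x $ i * M $ i $ a)"
proof -
  have "(\<Sum>j\<in>UNIV. x $ i * cnj ((c *s axis a 1) $ j) * M $ i $ j) =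
      (\<Sum>j\<in>UNIV. if j = a then cnj c * (x $ i * M $ i $ a) else 0)" for i
    by (intro sum.cong) (auto simp: axis_def)
  then show ?thesis by (simp add: sesq_def sum_distrib_left)
qed

lemma adj_component: "adj K = K \<Longrightarrow> cnj (K $ i $ j) = K $ j $ i"
  by (simp add: adj_def Finite_Cartesian_Product.vec_eq_iff)

lemma sesq_flip:
  assumes "adj M = M"
  shows "sesq M y x = cnj (sesq M x y)"
  unfolding sesq_def by (subst sum.swap) (simp add: adj_component[OF assms] mult_ac)

text \<open>A quadratic polynomial in c. Its nonnegativity for all c forces the a-th column to
  vanish, or to be dominated through the diagonal entry, in the decomposition that follows.\<close>

lemma hform_shift:
  assumes "adj K = K"
  shows "Re (hform K (x + c *s axis a 1)) =
    Re (hform K x) + 2 * Re (cnj c * (\<Sum>i\<in>UNIV. x $ i * K $ i $ a)) + (cmod c)\<^sup>2 * Re (K $ a $ a)"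
proof -
  let ?y = "c *s axis a (1 :: complex)"
  let ?s = "\<Sum>i\<in>UNIV. x $ i * K $ i $ a"
  have "hform K (x + ?y) = hform K x + sesq K x ?y + cnj (sesq K x ?y) + sesq K ?y ?y"
    using sesq_flip[OF assms, of ?y x]
    by (simp only: hform_sesq sesq_add_left sesq_add_right) simp
  moreover have "(\<Sum>i\<in>UNIV. ?y $ i * K $ i $ a) = (\<Sum>i\<in>UNIV. if i = a then c * K $ a $ a else 0)"
    by (intro sum.cong) (auto simp: axis_def)
  then have "sesq K ?y ?y = (cmod c)\<^sup>2 * K $ a $ a"
    unfolding sesq_axis_right by (simp only: sum.delta finite UNIV_I if_True complex_norm_square mult_ac)
  then have "Re (sesq K ?y ?y) = (cmod c)\<^sup>2 * Re (K $ a $ a)"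
    by (simp del: of_real_power add: of_real_power[symmetric])
  moreover have "sesq K x ?y = cnj c * ?s"
    by (rule sesq_axis_right)
  ultimately have "Re (hform K (x + ?y)) =
      Re (hform K x) + Re (cnj c * ?s) + Re (cnj (cnj c * ?s)) + (cmod c)\<^sup>2 * Re (K $ a $ a)"
    by (simp only: plus_complex.sel)
  then show ?thesis
    by (simp only: cnj.sel)
qed

text \<open>A step of the Cholesky decomposition removes one index from the support.\<close>

lemma psd_rank_one_sum:
  fixes K :: "complex ^ 'r ^ 'r"
  assumes "finite I" "adj K = K" "\<And>x. Re (hform K x) \<ge> 0"
    and "\<And>i j. i \<notin> I \<or> j \<notin> I \<Longrightarrow> K $ i $ j = 0"
  shows "\<exists>N q. \<forall>i j. K $ i $ j = (\<Sum>m<(N::nat). q m i * cnj (q m j))"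
  using assms
proof (induction I arbitrary: K rule: finite_induct)
  case empty
  then show ?case by (intro exI[of _ 0]) auto
next
  case (insert a I)
  have K: "cnj (K $ i $ j) = K $ j $ i" for i j
    using insert.prems(1) by (rule adj_component)
  have Kaa: "Im (K $ a $ a) = 0"
    using K[of a a] by (simp add: complex_eq_iff)
  define d where "d = Re (K $ a $ a)"
  have d: "K $ a $ a = of_real d"
    using Kaa by (simp add: d_def complex_eq_iff)
  have shift: "0 \<le> Re (hform K x) + 2 * Re (cnj c * (\<Sum>i\<in>UNIV. x $ i * K $ i $ a)) + (cmod c)\<^sup>2 * d"
    for x c
    using insert.prems(2)[of "x + c *s axis a 1"] hform_shift[OF insert.prems(1), of x c a]
    by (simp add: d_def)
  have d0: "d \<ge> 0"
    using shift[of 0 1] by (simp add: hform_def)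
  show ?case
  proof (cases "d = 0")
    case True
    have s0: "(\<Sum>i\<in>UNIV. x $ i * K $ i $ a) = 0" for x
    proof (rule ccontr)
      define s where "s = (\<Sum>i\<in>UNIV. x $ i * K $ i $ a)"
      assume "(\<Sum>i\<in>UNIV. x $ i * K $ i $ a) \<noteq> 0"
      then have s: "s \<noteq> 0" by (simp add: s_def)
      \<comment> \<open>With a vanishing diagonal entry the polynomial is affine in t along c = - t
        s; this t makes it equal to -1.\<close>
      define t where "t = (Re (hform K x) + 1) / (2 * (cmod s)\<^sup>2)"
      have "cnj (- (of_real t) * s) * s = of_real (- t * (cmod s)\<^sup>2)"
        by (simp add: complex_norm_square mult_ac del: of_real_power)
      then have "Re (cnj (- (of_real t) * s) * s) = - t * (cmod s)\<^sup>2"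
        by (simp only: Re_complex_of_real)
      then have "0 \<le> Re (hform K x) - 2 * t * (cmod s)\<^sup>2"
        using shift[of x "- (of_real t) * s"] True by (simp add: s_def[symmetric])
      moreover have "2 * t * (cmod s)\<^sup>2 = Re (hform K x) + 1"
        using s by (simp add: t_def)
      ultimately show False by linarith
    qed
    have "K $ j $ a = 0" for j
    proof -
      have "(\<Sum>i\<in>UNIV. axis j 1 $ i * K $ i $ a) = (\<Sum>i\<in>UNIV. if i = j then K $ i $ a else 0)"
        by (intro sum.cong) (auto simp: axis_def)
      then show ?thesis using s0[of "axis j 1"] by simp
    qed
    then have "K $ i $ j = 0" if "i \<notin> I \<or> j \<notin> I" for i j
      using insert.prems(3)[of i j] K[of j i] that by (cases "i = a"; cases "j = a") auto
    then show ?thesis using insert.IH[of K] insert.prems by blast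
  next
    case False
    then have dpos: "d > 0" using d0 by simp
    \<comment> \<open>The Schur complement of the diagonal entry d; its row and column a are
      zero.\<close>
    define K' where "K' = (\<chi> i j. K $ i $ j - K $ i $ a * K $ a $ j / of_real d)"
    have "adj K' = K'"
      by (simp add: adj_def K'_def Finite_Cartesian_Product.vec_eq_iff K mult.commute)
    moreover have "Re (hform K' x) \<ge> 0" for x
    proof -
      define s where "s = (\<Sum>i\<in>UNIV. x $ i * K $ i $ a)"
      have "hform K' x = hform K x -
          (\<Sum>i\<in>UNIV. \<Sum>j\<in>UNIV. (x $ i * K $ i $ a) * (cnj (x $ j) * K $ a $ j)) / of_real d"
        unfolding hform_def K'_def
        by (simp add: sum_subtractf sum_divide_distrib algebra_simps)
      also have "(\<Sum>i\<in>UNIV. \<Sum>j\<in>UNIV. (x $ i * K $ i $ a) * (cnj (x $ j) * K $ a $ j)) = s * cnj s"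
        by (simp add: sum_product K s_def)
      also have "s * cnj s / of_real d = of_real ((cmod s)\<^sup>2 / d)"
        by (simp only: complex_norm_square of_real_divide)
      finally have "Re (hform K' x) = Re (hform K x) - (cmod s)\<^sup>2 / d"
        by (simp del: of_real_divide)
      \<comment> \<open>The choice c = - s/d minimises the quadratic polynomial, and the minimum is
        the value of the form of \<open>K'\<close> at x.\<close>
      moreover have "0 \<le> Re (hform K x) + 2 * Re (cnj (- s / of_real d) * s) + (cmod (- s / of_real d))\<^sup>2 * d"
        unfolding s_def by (rule shift)
      moreover have "cnj (- s / of_real d) * s = of_real (- (cmod s)\<^sup>2 / d)"
        by (simp only: complex_cnj_minus complex_cnj_divide complex_cnj_complex_of_real of_real_divide of_real_minus complex_norm_square) (simp add: mult.commute)
      then have "Re (cnj (- s / of_real d) * s) = - (cmod s)\<^sup>2 / d"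
        by (simp only: Re_complex_of_real)
      moreover have "(cmod (- s / of_real d))\<^sup>2 * d = (cmod s)\<^sup>2 / d"
        using dpos by (simp add: norm_divide power_divide power2_eq_square)
      ultimately have "0 \<le> Re (hform K' x) + (cmod s)\<^sup>2 / d + 2 * (- (cmod s)\<^sup>2 / d) + (cmod s)\<^sup>2 / d"
        by (simp only: diff_add_cancel)
      then show ?thesis by simp
    qed
    moreover have "K' $ i $ j = 0" if "i \<notin> I \<or> j \<notin> I" for i j
      using insert.prems(3)[of i j] insert.prems(3)[of i a] insert.prems(3)[of a j] that d False
      by (cases "i = a"; cases "j = a") (auto simp: K'_def)
    ultimately obtain N :: nat and q where q: "\<And>i j. K' $ i $ j = (\<Sum>m<N. q m i * cnj (q m j))"
      using insert.IH[of K'] by blast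
    \<comment> \<open>The additional vector is column a divided by the square root of d; its rank
      one matrix is what the Schur complement has removed.\<close>
    define p where "p = (\<lambda>m i. if m < N then q m i else K $ i $ a / of_real (sqrt d))"
    have "K $ i $ j = (\<Sum>m<Suc N. p m i * cnj (p m j))" for i j
    proof -
      have "p N i * cnj (p N j) = K $ i $ a * K $ a $ j / of_real d"
        using dpos by (simp add: p_def K flip: of_real_mult)
      then have "(\<Sum>m<Suc N. p m i * cnj (p m j)) = K' $ i $ j + K $ i $ a * K $ a $ j / of_real d"
        by (simp add: q p_def)
      then show ?thesis by (simp add: K'_def)
    qed
    then show ?thesis by blast
  qed
qed

lemma adj_mult: "adj (M ** N) = adj N ** adj M"
  by (simp add: adj_def matrix_matrix_mult_def Finite_Cartesian_Product.vec_eq_iff mult.commute)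

lemma adj_mat_1: "adj (Finite_Cartesian_Product.mat 1) = Finite_Cartesian_Product.mat 1"
  by (simp add: adj_def Finite_Cartesian_Product.mat_def Finite_Cartesian_Product.vec_eq_iff)

text \<open>Symmetry holds because the adjoint of the inverse is again an inverse. For positivity,
  let w be the conjugate of M^-1 applied to the conjugate of x: the form of M^-1 at x equals the
  form of M at w.\<close>

lemma
  assumes "M \<in> posdef" "adj M = M"
  shows matrix_inv_hermitian: "adj (matrix_inv M) = matrix_inv M"
    and matrix_inv_psd: "Re (hform (matrix_inv M) x) \<ge> 0"
proof -
  have inv: "M ** matrix_inv M = Finite_Cartesian_Product.mat 1" "matrix_inv M ** M = Finite_Cartesian_Product.mat 1"
    using posdef_invertible[OF assms(1)] by (simp_all add: invertible_matrix_inv)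
  have "adj (matrix_inv M) ** M = Finite_Cartesian_Product.mat 1"
    using arg_cong[OF inv(1), of adj] by (simp add: adj_mult adj_mat_1 assms)
  then have "adj (matrix_inv M) ** (M ** matrix_inv M) = matrix_inv M"
    by (simp add: matrix_mul_assoc)
  then show "adj (matrix_inv M) = matrix_inv M"
    by (simp add: inv)
  define u where "u = (\<chi> i. cnj (x $ i))"
  define y where "y = matrix_inv M *v u"
  define w where "w = (\<chi> i. cnj (y $ i))"
  have My: "M *v y = u"
    by (simp add: y_def matrix_vector_mul_assoc inv)
  have M: "cnj (M $ i $ j) = M $ j $ i" for i j
    using assms(2) by (rule adj_component)
  have "hform (matrix_inv M) x = (\<Sum>i\<in>UNIV. x $ i * y $ i)"
    by (simp add: hform_def y_def u_def matrix_vector_mult_def sum_distrib_left mult_ac)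
  also have "\<dots> = (\<Sum>i\<in>UNIV. cnj ((M *v y) $ i) * y $ i)"
    by (simp add: My u_def)
  also have "\<dots> = (\<Sum>i\<in>UNIV. \<Sum>j\<in>UNIV. cnj (y $ j) * y $ i * M $ j $ i)"
    by (simp add: matrix_vector_mult_def sum_distrib_right sum_distrib_left M mult_ac)
  also have "\<dots> = hform M w"
    unfolding hform_def w_def by (subst sum.swap) simp
  finally have "hform (matrix_inv M) x = hform M w" .
  moreover have "Re (hform M w) \<ge> 0"
    using assms(1) by (cases "w = 0") (auto simp: posdef_def hform_def less_imp_le)
  ultimately show "Re (hform (matrix_inv M) x) \<ge> 0" by simp
qed

text \<open>Write K as the sum of the products q_m q_m^H with conjugate transposes. The trace
  becomes the double sum of z m p times z p m, where z m p = q_m^H W q_p, and for Hermitian W each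
  such product is |z m p|^2. Square roots and eigenvectors of matrices are thereby avoided.\<close>

lemma trace_square_nonneg:
  fixes K W :: "complex ^ 'r ^ 'r"
  assumes "adj K = K" "\<And>x. Re (hform K x) \<ge> 0" "adj W = W"
  shows "Re (Determinants.trace ((K ** W) ** (K ** W))) \<ge> 0"
proof -
  obtain N :: nat and q where q: "\<And>i j. K $ i $ j = (\<Sum>m<N. q m i * cnj (q m j))"
    using psd_rank_one_sum[of UNIV K] assms by auto
  have W: "cnj (W $ i $ j) = W $ j $ i" for i j
    using assms(3) by (rule adj_component)
  define z where "z = (\<lambda>m p. \<Sum>j\<in>UNIV. \<Sum>k\<in>UNIV. cnj (q m j) * W $ j $ k * q p k)"
  have z: "z p m = cnj (z m p)" for m p
    unfolding z_def by (subst sum.swap) (simp add: W mult_ac)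
  have "Determinants.trace ((K ** W) ** (K ** W)) =
      (\<Sum>i\<in>UNIV. \<Sum>k\<in>UNIV. (\<Sum>j\<in>UNIV. K $ i $ j * W $ j $ k) * (\<Sum>l\<in>UNIV. K $ k $ l * W $ l $ i))"
    by (simp add: Determinants.trace_def matrix_matrix_mult_def)
  also have "\<dots> = (\<Sum>i\<in>UNIV. \<Sum>k\<in>UNIV. (\<Sum>m<N. q m i * (\<Sum>j\<in>UNIV. cnj (q m j) * W $ j $ k)) *
      (\<Sum>p<N. q p k * (\<Sum>l\<in>UNIV. cnj (q p l) * W $ l $ i)))"
  proof -
    have "(\<Sum>j\<in>UNIV. K $ i $ j * W $ j $ k) = (\<Sum>m<N. q m i * (\<Sum>j\<in>UNIV. cnj (q m j) * W $ j $ k))" for i k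
      by (simp add: q sum_distrib_right sum_distrib_left mult.assoc) (rule sum.swap)
    then show ?thesis by simp
  qed
  also have "\<dots> = (\<Sum>i\<in>UNIV. \<Sum>k\<in>UNIV. \<Sum>m<N. \<Sum>p<N.
      ((\<Sum>j\<in>UNIV. cnj (q m j) * W $ j $ k) * q p k) * ((\<Sum>l\<in>UNIV. cnj (q p l) * W $ l $ i) * q m i))"
    by (simp add: sum_product mult_ac)
  also have "\<dots> = (\<Sum>m<N. \<Sum>p<N. \<Sum>i\<in>UNIV. \<Sum>k\<in>UNIV.
      ((\<Sum>j\<in>UNIV. cnj (q m j) * W $ j $ k) * q p k) * ((\<Sum>l\<in>UNIV. cnj (q p l) * W $ l $ i) * q m i))"
  proof -
    have "(\<Sum>i\<in>UNIV. \<Sum>k\<in>UNIV. \<Sum>m<N. \<Sum>p<N. f i k m p) = (\<Sum>m<N. \<Sum>p<N. \<Sum>i\<in>UNIV. \<Sum>k\<in>UNIV. f i k m p)"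
      for f :: "'r \<Rightarrow> 'r \<Rightarrow> nat \<Rightarrow> nat \<Rightarrow> complex"
    proof -
      have "(\<Sum>i\<in>UNIV. \<Sum>k\<in>UNIV. \<Sum>m<N. \<Sum>p<N. f i k m p) =
          (\<Sum>i\<in>UNIV. \<Sum>m<N. \<Sum>k\<in>UNIV. \<Sum>p<N. f i k m p)"
        by (intro sum.cong refl) (rule sum.swap)
      also have "\<dots> = (\<Sum>m<N. \<Sum>i\<in>UNIV. \<Sum>p<N. \<Sum>k\<in>UNIV. f i k m p)"
        by (subst sum.swap) (intro sum.cong refl sum.swap)
      also have "\<dots> = (\<Sum>m<N. \<Sum>p<N. \<Sum>i\<in>UNIV. \<Sum>k\<in>UNIV. f i k m p)"
        by (intro sum.cong refl) (rule sum.swap)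
      finally show ?thesis .
    qed
    then show ?thesis .
  qed
  also have "\<dots> = (\<Sum>m<N. \<Sum>p<N. z m p * z p m)"
  proof -
    have "(\<Sum>k\<in>UNIV. (\<Sum>j\<in>UNIV. cnj (q m j) * W $ j $ k) * q p k) = z m p" for m p
      unfolding z_def by (subst sum.swap) (simp add: sum_distrib_right)
    moreover have "(\<Sum>i\<in>UNIV. \<Sum>k\<in>UNIV. F k * G i) = (\<Sum>k\<in>UNIV. F k) * (\<Sum>i\<in>UNIV. G i)"
      for F G :: "'r \<Rightarrow> complex"
      by (subst sum.swap) (simp add: sum_product)
    ultimately show ?thesis by (simp only:)
  qed
  also have "\<dots> = (\<Sum>m<N. \<Sum>p<N. of_real ((cmod (z m p))\<^sup>2))"
    by (intro sum.cong refl) (simp only: complex_norm_square z[symmetric])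
  finally show ?thesis by (simp add: sum_nonneg)
qed

lemma matrix_diff_left: "(A - B) ** C = A ** C - B ** (C :: complex ^ 'r ^ 'r)"
  and matrix_diff_right: "C ** (A - B) = C ** A - C ** (B :: complex ^ 'r ^ 'r)"
  and matrix_scaleR_left: "(c *\<^sub>R A) ** C = c *\<^sub>R (A ** (C :: complex ^ 'r ^ 'r))"
  and matrix_scaleR_right: "C ** (c *\<^sub>R A) = c *\<^sub>R (C ** (A :: complex ^ 'r ^ 'r))"
  by (simp_all add: Finite_Cartesian_Product.vec_eq_iff matrix_matrix_mult_def sum_subtractf scaleR_sum_right algebra_simps)

text \<open>Let t be the real part of the trace of H^-1 V. Applying the previous inequality to W = V
  - (t/r) H, which removes the trace, gives tr((H^-1 V)^2) >= t^2 / r, and a >= -1/r absorbs the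
  second term of the metric.\<close>

lemma mat_metric_nonneg:
  fixes H V :: "complex ^ 'r ^ 'r"
  assumes H: "H \<in> posdef" "adj H = H" and V: "adj V = V" and a: "a \<ge> - 1 / real CARD('r)"
  shows "mat_metric a H V \<ge> 0"
proof -
  let ?K = "matrix_inv H"
  let ?r = "real CARD('r)"
  let ?t = "Re (Determinants.trace (?K ** V))"
  define s where "s = ?t / ?r"
  define W where "W = V - s *\<^sub>R H"
  have KW: "?K ** W = ?K ** V - s *\<^sub>R Finite_Cartesian_Product.mat 1"
  proof -
    have "?K ** H = Finite_Cartesian_Product.mat 1" using posdef_invertible[OF H(1)] by (rule invertible_matrix_inv)
    then show ?thesis
      by (simp add: W_def matrix_diff_right matrix_scaleR_right)
  qed
  have "adj W = W"
    using H(2) V by (simp add: W_def adj_def Finite_Cartesian_Product.vec_eq_iff)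
  then have "0 \<le> Re (Determinants.trace ((?K ** W) ** (?K ** W)))"
    using H matrix_inv_hermitian matrix_inv_psd by (intro trace_square_nonneg) auto
  also have "(?K ** W) ** (?K ** W) = (?K ** V) ** (?K ** V) - (2 * s) *\<^sub>R (?K ** V) + (s\<^sup>2) *\<^sub>R Finite_Cartesian_Product.mat 1"
    unfolding KW
    by (simp add: matrix_diff_left matrix_diff_right matrix_scaleR_left matrix_scaleR_right
        scaleR_diff_right scaleR_2 power2_eq_square scaleR_add_left flip: scaleR_scaleR)
  also have "Re (Determinants.trace \<dots>) =
      Re (Determinants.trace ((?K ** V) ** (?K ** V))) - 2 * s * ?t + s\<^sup>2 * ?r"
    by (simp add: Determinants.trace_def sum.distrib sum_subtractf Finite_Cartesian_Product.mat_def sum_distrib_left algebra_simps)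
  also have "\<dots> = Re (Determinants.trace ((?K ** V) ** (?K ** V))) - ?t\<^sup>2 / ?r"
    by (simp add: s_def power2_eq_square field_simps)
  finally have "?t\<^sup>2 / ?r \<le> Re (Determinants.trace ((?K ** V) ** (?K ** V)))" by simp
  moreover have "- ?t\<^sup>2 / ?r \<le> a * ?t\<^sup>2"
    using mult_right_mono[OF a, of "?t\<^sup>2"] by simp
  ultimately show ?thesis
    by (simp add: mat_metric_def)
qed

section \<open>Hermitian forms on a fibre as matrices\<close>

lemma linear_functional_eq:
  fixes f :: "complex ^ 'r \<Rightarrow> complex"
  assumes add: "\<And>u v. f (u + v) = f u + f v" and scale: "\<And>c u. f (c *s u) = c * f u"
  shows "f u = (\<Sum>i\<in>UNIV. u $ i * f (axis i 1))"
proof -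
  have 0: "f 0 = 0" using scale[of 0 0] by simp
  have "f (\<Sum>i\<in>I. u $ i *s axis i 1) = (\<Sum>i\<in>I. u $ i * f (axis i 1))" if "finite I" for I
    using that by (induction I rule: finite_induct) (auto simp: 0 add scale)
  from this[of UNIV] show ?thesis by (simp add: basis_expansion)
qed

lemma linear_map_eq:
  fixes F :: "complex ^ 'r \<Rightarrow> complex ^ 'r"
  assumes "\<And>u v. F (u + v) = F u + F v" and "\<And>c u. F (c *s u) = c *s F u"
  shows "F u = (\<chi> i j. F (axis j 1) $ i) *v u"
  using linear_functional_eq[of "\<lambda>u. F u $ i" u for i] assms
  by (simp add: Finite_Cartesian_Product.vec_eq_iff matrix_vector_mult_def mult.commute)

text \<open>Forms are conjugate-linear in the second argument, where the endomorphism h^-1 v acts;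
  therefore its matrix is the entrywise conjugate of H^-1 V.\<close>

definition cnj_mat :: "complex ^ 'r ^ 'r \<Rightarrow> complex ^ 'r ^ 'r"
  where "cnj_mat M = (\<chi> i j. cnj (M $ i $ j))"

lemma cnj_mat_mult: "cnj_mat (M ** N) = cnj_mat M ** cnj_mat N"
  by (simp add: cnj_mat_def matrix_matrix_mult_def)

lemma trace_cnj_mat: "Determinants.trace (cnj_mat M) = cnj (Determinants.trace M)"
  by (simp add: cnj_mat_def Determinants.trace_def)

text \<open>Like \<open>fibre_End\<close> but without extensionality, because the composition of two
  \<open>h_inv\<close> in the metric need not be extensional.\<close>

definition fibre_linear :: "('m, 'e, 'r::finite) vbundle \<Rightarrow> 'm \<Rightarrow> ('e \<Rightarrow> 'e) \<Rightarrow> bool"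
  where "fibre_linear E x L \<longleftrightarrow> (\<forall>a\<in>fibre E x. L a \<in> fibre E x) \<and>
       (\<forall>a\<in>fibre E x. \<forall>b\<in>fibre E x. L (vadd E a b) = vadd E (L a) (L b)) \<and>
       (\<forall>c. \<forall>a\<in>fibre E x. L (vscale E c a) = vscale E c (L a))"

definition form_mat ::
    "('m, 'e, 'r::finite) vbundle \<Rightarrow> ('e \<Rightarrow> complex ^ 'r) \<Rightarrow> 'm \<Rightarrow> 'e form \<Rightarrow> complex ^ 'r ^ 'r"
  where "form_mat E \<Phi> x h = (\<chi> i j. h (frame E \<Phi> x i) (frame E \<Phi> x j))"

definition mat_form ::
    "('m, 'e, 'r::finite) vbundle \<Rightarrow> ('e \<Rightarrow> complex ^ 'r) \<Rightarrow> 'm \<Rightarrow> complex ^ 'r ^ 'r \<Rightarrow> 'e form"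
  where "mat_form E \<Phi> x M = (\<lambda>a b. if a \<in> fibre E x \<and> b \<in> fibre E x
     then \<Sum>i\<in>UNIV. \<Sum>j\<in>UNIV. \<Phi> a $ i * cnj (\<Phi> b $ j) * M $ i $ j else 0)"

lemma HermD:
  assumes "v \<in> Herm E x"
  shows "a \<notin> fibre E x \<or> b \<notin> fibre E x \<Longrightarrow> v a b = 0"
    and "a \<in> fibre E x \<Longrightarrow> b \<in> fibre E x \<Longrightarrow> c \<in> fibre E x \<Longrightarrow> v (vadd E a c) b = v a b + v c b"
    and "a \<in> fibre E x \<Longrightarrow> b \<in> fibre E x \<Longrightarrow> c \<in> fibre E x \<Longrightarrow> v b (vadd E a c) = v b a + v b c"
    and "a \<in> fibre E x \<Longrightarrow> b \<in> fibre E x \<Longrightarrow> v (vscale E z a) b = z * v a b"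
    and "a \<in> fibre E x \<Longrightarrow> b \<in> fibre E x \<Longrightarrow> v a (vscale E z b) = cnj z * v a b"
    and "a \<in> fibre E x \<Longrightarrow> b \<in> fibre E x \<Longrightarrow> v b a = cnj (v a b)"
  using assms unfolding Herm_def mem_Collect_eq by blast+

lemma HermI:
  assumes "\<And>a b. a \<notin> fibre E x \<or> b \<notin> fibre E x \<Longrightarrow> v a b = 0"
    and "\<And>a b c. a \<in> fibre E x \<Longrightarrow> b \<in> fibre E x \<Longrightarrow> c \<in> fibre E x \<Longrightarrow> v (vadd E a c) b = v a b + v c b"
    and "\<And>a b c. a \<in> fibre E x \<Longrightarrow> b \<in> fibre E x \<Longrightarrow> c \<in> fibre E x \<Longrightarrow> v b (vadd E a c) = v b a + v b c"
    and "\<And>a b z. a \<in> fibre E x \<Longrightarrow> b \<in> fibre E x \<Longrightarrow> v (vscale E z a) b = z * v a b"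
    and "\<And>a b z. a \<in> fibre E x \<Longrightarrow> b \<in> fibre E x \<Longrightarrow> v a (vscale E z b) = cnj z * v a b"
    and "\<And>a b. a \<in> fibre E x \<Longrightarrow> b \<in> fibre E x \<Longrightarrow> v b a = cnj (v a b)"
  shows "v \<in> Herm E x"
  unfolding Herm_def mem_Collect_eq
  by (intro conjI ballI allI impI) (rule assms; assumption)+

lemma Herm_add:
  assumes v: "v \<in> Herm E x" and w: "w \<in> Herm E x" shows "v + w \<in> Herm E x"
proof (rule HermI)
  fix a b assume "a \<in> fibre E x" "b \<in> fibre E x"
  then show "(v + w) b a = cnj ((v + w) a b)"
    using HermD(6)[OF v, of a b] HermD(6)[OF w, of a b] by simp
qed (simp_all add: HermD(1-5)[OF v] HermD(1-5)[OF w] algebra_simps)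

lemma Herm_scaleR:
  assumes v: "v \<in> Herm E x" shows "c *\<^sub>R v \<in> Herm E x"
proof (rule HermI)
  fix a b assume "a \<in> fibre E x" "b \<in> fibre E x"
  then show "(c *\<^sub>R v) b a = cnj ((c *\<^sub>R v) a b)"
    using HermD(6)[OF v, of a b] by (simp add: scaleR_fun_def)
qed (simp_all add: scaleR_fun_def HermD(1-5)[OF v] algebra_simps)

lemma form_mat_add: "form_mat E \<Phi> x (v + w) = form_mat E \<Phi> x v + form_mat E \<Phi> x w"
  and form_mat_diff: "form_mat E \<Phi> x (v - w) = form_mat E \<Phi> x v - form_mat E \<Phi> x w"
  and form_mat_scaleR: "form_mat E \<Phi> x (c *\<^sub>R v) = c *\<^sub>R form_mat E \<Phi> x v"
  by (simp_all add: form_mat_def Finite_Cartesian_Product.vec_eq_iff scaleR_fun_def)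

locale fibre_frame =
  fixes E :: "('m, 'e, 'r::finite) vbundle" and x :: 'm and \<Phi> :: "'e \<Rightarrow> complex ^ 'r"
  assumes iso: "fibre_iso E x \<Phi>"
begin

abbreviation F where "F \<equiv> fibre E x"
definition T where "T = inv_into F \<Phi>"

lemma bij: "bij_betw \<Phi> F UNIV"
  using iso by (simp add: fibre_iso_def)

lemma T_in [simp]: "T u \<in> F" and \<Phi>_T [simp]: "\<Phi> (T u) = u"
  using bij by (auto simp: T_def bij_betw_def inv_into_into f_inv_into_f)

lemma T_\<Phi> [simp]: "a \<in> F \<Longrightarrow> T (\<Phi> a) = a"
  using bij by (auto simp: T_def bij_betw_def)

lemma vadd [simp]: "a \<in> F \<Longrightarrow> b \<in> F \<Longrightarrow> vadd E a b \<in> F" "a \<in> F \<Longrightarrow> b \<in> F \<Longrightarrow> \<Phi> (vadd E a b) = \<Phi> a + \<Phi> b"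
  and vscale [simp]: "a \<in> F \<Longrightarrow> vscale E c a \<in> F" "a \<in> F \<Longrightarrow> \<Phi> (vscale E c a) = c *s \<Phi> a"
  using iso by (auto simp: fibre_iso_def)

lemma eqI: "a \<in> F \<Longrightarrow> b \<in> F \<Longrightarrow> \<Phi> a = \<Phi> b \<Longrightarrow> a = b"
  using bij by (auto simp: bij_betw_def inj_on_def)

lemma T_add: "T (u + v) = vadd E (T u) (T v)" and T_scale: "T (c *s u) = vscale E c (T u)"
  by (auto intro: eqI)

lemma frame_T: "frame E \<Phi> x i = T (axis i 1)"
  by (simp add: frame_def T_def)

lemma Herm_expand:
  assumes "h \<in> Herm E x" "a \<in> F" "b \<in> F"
  shows "h a b = (\<Sum>i\<in>UNIV. \<Sum>j\<in>UNIV. \<Phi> a $ i * cnj (\<Phi> b $ j) * form_mat E \<Phi> x h $ i $ j)"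
proof -
  have "h (T u) b = (\<Sum>i\<in>UNIV. u $ i * h (T (axis i 1)) b)" for u
    by (intro linear_functional_eq)
      (simp_all add: T_add T_scale HermD(2,4)[OF assms(1)] assms(3))
  from this[of "\<Phi> a"] have "h a b = (\<Sum>i\<in>UNIV. \<Phi> a $ i * h (T (axis i 1)) b)"
    using assms by simp
  moreover have "h (T (axis i 1)) b = (\<Sum>j\<in>UNIV. cnj (\<Phi> b $ j) * h (T (axis i 1)) (T (axis j 1)))" for i
  proof -
    \<comment> \<open>Conjugation makes the dependence on the second argument linear, so the
      expansion of linear functionals applies.\<close>
    have "cnj (h (T (axis i 1)) (T u)) = (\<Sum>j\<in>UNIV. u $ j * cnj (h (T (axis i 1)) (T (axis j 1))))" for u
      by (intro linear_functional_eq)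
        (simp_all add: T_add T_scale HermD(3,5)[OF assms(1)])
    from arg_cong[OF this[of "\<Phi> b"], of cnj] show ?thesis using assms by simp
  qed
  ultimately show ?thesis
    by (simp add: form_mat_def frame_T sum_distrib_left mult.assoc)
qed

lemma form_mat_form: "form_mat E \<Phi> x (mat_form E \<Phi> x M) = M"
proof -
  have "(\<Sum>l\<in>UNIV. axis i 1 $ k * cnj (axis j 1 $ l) * M $ k $ l) =
      (\<Sum>l\<in>UNIV. if l = j then (if k = i then M $ i $ j else 0) else 0)" for i j k
    by (intro sum.cong refl) (auto simp: axis_def)
  then show ?thesis
    by (simp add: form_mat_def mat_form_def frame_T Finite_Cartesian_Product.vec_eq_iff)
qed

lemma Herm_adj: "h \<in> Herm E x \<Longrightarrow> adj (form_mat E \<Phi> x h) = form_mat E \<Phi> x h"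
  by (simp add: adj_def form_mat_def Finite_Cartesian_Product.vec_eq_iff frame_T HermD(6)[symmetric])

lemma mat_form_Herm:
  assumes "adj M = M" shows "mat_form E \<Phi> x M \<in> Herm E x"
proof -
  have "cnj (mat_form E \<Phi> x M a b) = mat_form E \<Phi> x M b a" if "a \<in> F" "b \<in> F" for a b
    using that unfolding mat_form_def
    by simp (subst sum.swap, simp add: adj_component[OF assms] mult_ac)
  then show ?thesis
    by (intro HermI, goal_cases)
      (auto simp: mat_form_def sum.distrib sum_distrib_left algebra_simps simp del: cnj_sum)
qed

lemma Herm_pos_iff: "h \<in> Herm_pos E x \<longleftrightarrow> h \<in> Herm E x \<and> form_mat E \<Phi> x h \<in> posdef"
proof -
  have "h (T u) (T u) = hform (form_mat E \<Phi> x h) u" if "h \<in> Herm E x" for u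
    using Herm_expand[OF that, of "T u" "T u"] by (simp add: hform_def)
  moreover have "a \<noteq> vscale E 0 a \<longleftrightarrow> \<Phi> a \<noteq> 0" if "a \<in> F" for a
    using that eqI[of a "vscale E 0 a"] by auto (metis vscale(2) vector_smult_lzero)
  then have "(\<forall>a\<in>F. a \<noteq> vscale E 0 a \<longrightarrow> P a) \<longleftrightarrow> (\<forall>u. u \<noteq> 0 \<longrightarrow> P (T u))" for P
    by (metis T_\<Phi> T_in \<Phi>_T)
  ultimately show ?thesis
    by (auto simp: Herm_pos_def posdef_def)
qed

definition end_mat where "end_mat L = (\<chi> i j. \<Phi> (L (frame E \<Phi> x j)) $ i)"

lemma end_mat_mult:
  assumes "fibre_linear E x L" "a \<in> F"
  shows "\<Phi> (L a) = end_mat L *v \<Phi> a"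
proof -
  have "\<Phi> (L (T u)) = end_mat L *v u" for u
    unfolding end_mat_def frame_T
    by (rule linear_map_eq) (use assms in \<open>auto simp: fibre_linear_def T_add T_scale\<close>)
  from this[of "\<Phi> a"] show ?thesis using assms by simp
qed

end

text \<open>Two frames differ by mutually inverse matrices P and Q, so the matrices of L are
  similar. This is what makes the definite description in \<open>fibre_trace\<close> denote.\<close>

lemma end_mat_similar:
  assumes "fibre_frame E x \<Phi>" "fibre_frame E x \<Psi>" "fibre_linear E x L"
  shows "Determinants.trace (fibre_frame.end_mat E x \<Phi> L) = Determinants.trace (fibre_frame.end_mat E x \<Psi> L)"
proof -
  interpret a: fibre_frame E x \<Phi> by fact
  interpret b: fibre_frame E x \<Psi> by fact
  define P where "P = (\<chi> i j. \<Psi> (a.T (axis j 1)) $ i)"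
  define Q where "Q = (\<chi> i j. \<Phi> (b.T (axis j 1)) $ i)"
  have P: "\<Psi> (a.T u) = P *v u" for u
    unfolding P_def by (rule linear_map_eq) (auto simp: a.T_add a.T_scale)
  have Q: "\<Phi> (b.T u) = Q *v u" for u
    unfolding Q_def by (rule linear_map_eq) (auto simp: b.T_add b.T_scale)
  have "(Q ** P) *v u = u" for u
  proof -
    have "Q *v (P *v u) = \<Phi> (b.T (\<Psi> (a.T u)))" by (simp only: P Q)
    then show ?thesis by (simp add: matrix_vector_mul_assoc)
  qed
  then have QP: "Q ** P = Finite_Cartesian_Product.mat 1"
    by (simp add: matrix_eq)
  have "(b.end_mat L ** P) *v u = (P ** a.end_mat L) *v u" for u
  proof -
    have La: "L (a.T u) \<in> fibre E x" using assms(3) by (simp add: fibre_linear_def)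
    have "b.end_mat L *v (P *v u) = \<Psi> (L (a.T u))"
      using b.end_mat_mult[OF assms(3), of "a.T u"] by (simp add: P)
    also have "\<dots> = P *v (\<Phi> (L (a.T u)))"
      using P[of "\<Phi> (L (a.T u))"] La by simp
    also have "\<dots> = P *v (a.end_mat L *v u)"
      using a.end_mat_mult[OF assms(3), of "a.T u"] by simp
    finally show ?thesis by (simp add: matrix_vector_mul_assoc)
  qed
  then have eq: "b.end_mat L ** P = P ** a.end_mat L"
    by (simp add: matrix_eq)
  have "Determinants.trace (a.end_mat L) = Determinants.trace ((Q ** P) ** a.end_mat L)"
    by (simp add: QP)
  also have "\<dots> = Determinants.trace (Q ** (b.end_mat L ** P))"
    by (simp add: eq matrix_mul_assoc)
  also have "\<dots> = Determinants.trace ((b.end_mat L ** P) ** Q)"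
    by (rule trace_mul_sym)
  also have "(b.end_mat L ** P) ** Q = b.end_mat L"
    using QP by (simp add: matrix_mul_assoc[symmetric] matrix_left_right_inverse)
  finally show ?thesis .
qed

context fibre_frame
begin

lemma fibre_trace_eq:
  assumes "fibre_linear E x L"
  shows "fibre_trace E x L = Determinants.trace (end_mat L)"
  unfolding fibre_trace_def
proof (rule the_equality)
  have ff: "fibre_frame E x \<Phi>" by unfold_locales
  show "\<forall>\<Psi>. fibre_iso E x \<Psi> \<longrightarrow> Determinants.trace (end_mat L) =
      Determinants.trace (\<chi> i j. \<Psi> (L (frame E \<Psi> x j)) $ i)"
    using end_mat_similar[OF ff _ assms] by (auto simp: fibre_frame_def fibre_frame.end_mat_def)
  fix t
  assume "\<forall>\<Psi>. fibre_iso E x \<Psi> \<longrightarrow> t = Determinants.trace (\<chi> i j. \<Psi> (L (frame E \<Psi> x j)) $ i)"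
  then show "t = Determinants.trace (end_mat L)"
    using iso by (simp add: end_mat_def)
qed

text \<open>The relation v(a, b) = h(a, L b) reads V = H N in matrices, with N the conjugate of the
  matrix of L; invertibility of H gives existence and uniqueness.\<close>

lemma h_inv_eq:
  assumes h: "h \<in> Herm_pos E x" and v: "v \<in> Herm E x"
  defines "C \<equiv> cnj_mat (matrix_inv (form_mat E \<Phi> x h) ** form_mat E \<Phi> x v)"
  shows "fibre_linear E x (h_inv E x h v)" and "end_mat (h_inv E x h v) = C"
proof -
  let ?H = "form_mat E \<Phi> x h" and ?V = "form_mat E \<Phi> x v"
  have hH: "h \<in> Herm E x" and H: "?H \<in> posdef"
    using h by (auto simp: Herm_pos_iff)
  have inv: "?H ** (matrix_inv ?H ** M) = M" "matrix_inv ?H ** (?H ** M) = M" for M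
    using invertible_matrix_inv[OF posdef_invertible[OF H]] by (simp_all add: matrix_mul_assoc)
  have pair: "h a (T (cnj_mat N *v \<Phi> b)) =
      (\<Sum>i\<in>UNIV. \<Sum>k\<in>UNIV. \<Phi> a $ i * cnj (\<Phi> b $ k) * (?H ** N) $ i $ k)" if "a \<in> F" "b \<in> F" for a b N
  proof -
    have "h a (T (cnj_mat N *v \<Phi> b)) =
        (\<Sum>i\<in>UNIV. \<Sum>j\<in>UNIV. \<Sum>k\<in>UNIV. \<Phi> a $ i * cnj (\<Phi> b $ k) * (?H $ i $ j * N $ j $ k))"
      using Herm_expand[OF hH, of a "T (cnj_mat N *v \<Phi> b)"] that
      by (simp add: cnj_mat_def matrix_vector_mult_def sum_distrib_left sum_distrib_right mult_ac)
    also have "\<dots> = (\<Sum>i\<in>UNIV. \<Sum>k\<in>UNIV. \<Sum>j\<in>UNIV. \<Phi> a $ i * cnj (\<Phi> b $ k) * (?H $ i $ j * N $ j $ k))"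
      by (intro sum.cong refl sum.swap)
    finally show ?thesis
      by (simp add: matrix_matrix_mult_def sum_distrib_left)
  qed
  \<comment> \<open>\<open>fibre_End\<close> contains only extensional maps, so the candidate is cut
    off outside the fibre.\<close>
  define L where "L = restrict (\<lambda>b. T (C *v \<Phi> b)) F"
  have L: "L \<in> fibre_End E x" "\<forall>a\<in>F. \<forall>b\<in>F. v a b = h a (L b)"
  proof -
    show "L \<in> fibre_End E x"
      by (auto simp: fibre_End_def L_def matrix_vector_right_distrib vec.scale T_add T_scale)
    show "\<forall>a\<in>F. \<forall>b\<in>F. v a b = h a (L b)"
      using Herm_expand[OF v] unfolding C_def by (simp add: L_def pair inv C_def)
  qed
  have lin: "fibre_linear E x L'" if "L' \<in> fibre_End E x" for L'
    using that by (auto simp: fibre_End_def fibre_linear_def)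
  have mat: "end_mat L' = C" if L': "L' \<in> fibre_End E x" "\<forall>a\<in>F. \<forall>b\<in>F. v a b = h a (L' b)" for L'
  proof -
    let ?N = "cnj_mat (end_mat L')"
    have cc: "cnj_mat ?N = end_mat L'" by (simp add: cnj_mat_def)
    have "v a b = mat_form E \<Phi> x (?H ** ?N) a b" if "a \<in> F" "b \<in> F" for a b
    proof -
      have "L' b \<in> F" using L' that by (auto simp: fibre_End_def)
      then have "L' b = T (cnj_mat ?N *v \<Phi> b)"
        unfolding cc using end_mat_mult[OF lin[OF L'(1)] that(2)] by (metis T_\<Phi>)
      then show ?thesis
        using pair[OF that, of ?N] L'(2) that by (simp add: mat_form_def)
    qed
    then have "v = mat_form E \<Phi> x (?H ** ?N)"
      using HermD(1)[OF v] by (fastforce simp: fun_eq_iff mat_form_def)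
    then have "?V = ?H ** ?N" by (simp add: form_mat_form)
    then have "matrix_inv ?H ** ?V = ?N" by (simp add: inv)
    then show ?thesis by (simp add: C_def cc)
  qed
  have "h_inv E x h v = L"
    unfolding h_inv_def
  proof (rule the_equality)
    show "L \<in> fibre_End E x \<and> (\<forall>a\<in>F. \<forall>b\<in>F. v a b = h a (L b))" using L by blast
    fix L' assume L': "L' \<in> fibre_End E x \<and> (\<forall>a\<in>F. \<forall>b\<in>F. v a b = h a (L' b))"
    show "L' = L"
    proof
      fix b show "L' b = L b"
      proof (cases "b \<in> F")
        case True
        have "L' b \<in> F" "L b \<in> F" using L L' True by (auto simp: fibre_End_def)
        moreover have "\<Phi> (L' b) = \<Phi> (L b)"
          using end_mat_mult[OF lin True] mat L L' by metis
        ultimately show ?thesis by (rule eqI)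
      next
        case False
        then show ?thesis using L L' by (auto simp: fibre_End_def PiE_iff extensional_def)
      qed
    qed
  qed
  then show "fibre_linear E x (h_inv E x h v)" "end_mat (h_inv E x h v) = C"
    using lin mat L by auto
qed

text \<open>Entrywise conjugation conjugates the traces, and the metric keeps only their real parts,
  so H^-1 V may stand for the matrix of h^-1 v. All analysis of the metric passes through this
  formula.\<close>

lemma fibre_metric_eq:
  assumes "h \<in> Herm_pos E x" "v \<in> Herm E x"
  shows "fibre_metric E \<alpha> x h v v = mat_metric (\<alpha> x) (form_mat E \<Phi> x h) (form_mat E \<Phi> x v)"
proof -
  let ?L = "h_inv E x h v"
  let ?X = "matrix_inv (form_mat E \<Phi> x h) ** form_mat E \<Phi> x v"
  note L = h_inv_eq[OF assms]
  have L2: "fibre_linear E x (?L \<circ> ?L)"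
    using L(1) by (auto simp: fibre_linear_def)
  have "end_mat (?L \<circ> ?L) *v u = (end_mat ?L ** end_mat ?L) *v u" for u
  proof -
    have "?L (T u) \<in> F" using L(1) by (simp add: fibre_linear_def)
    then have "\<Phi> (?L (?L (T u))) = end_mat ?L *v (end_mat ?L *v u)"
      using end_mat_mult[OF L(1), of "?L (T u)"] end_mat_mult[OF L(1), of "T u"] by simp
    then show ?thesis
      using end_mat_mult[OF L2, of "T u"] by (simp add: matrix_vector_mul_assoc)
  qed
  then have "end_mat (?L \<circ> ?L) = cnj_mat (?X ** ?X)"
    by (simp add: matrix_eq L(2) cnj_mat_mult)
  then show ?thesis
    using fibre_trace_eq[OF L(1)] fibre_trace_eq[OF L2]
    by (simp add: fibre_metric_def mat_metric_def L(2) trace_cnj_mat power2_eq_square)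
qed

end

section \<open>Velocities\<close>

text \<open>\<open>has_velocity\<close> uses difference quotients, which make sense in any topology;
  in normed spaces this connects them with the derivative calculus.\<close>

lemma has_vector_derivative_iff_quotient:
  "(f has_vector_derivative D) (at t within S) \<longleftrightarrow>
    ((\<lambda>s. (f s - f t) /\<^sub>R (s - t)) \<longlongrightarrow> D) (at t within S)"
proof -
  have eq: "norm ((1 / norm (s - t)) *\<^sub>R (f s - (f t + (s - t) *\<^sub>R D))) = norm ((f s - f t) /\<^sub>R (s - t) - D)"
    if "s \<noteq> t" for s
  proof -
    have "(f s - f t) /\<^sub>R (s - t) - D = (f s - (f t + (s - t) *\<^sub>R D)) /\<^sub>R (s - t)"
      using that by (simp add: scaleR_diff_right scaleR_add_right)
    then show ?thesis by (simp add: divide_inverse mult.commute)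
  qed
  have "(f has_vector_derivative D) (at t within S) \<longleftrightarrow>
      ((\<lambda>s. (1 / norm (s - t)) *\<^sub>R (f s - (f t + (s - t) *\<^sub>R D))) \<longlongrightarrow> 0) (at t within S)"
    by (simp add: has_vector_derivative_def has_derivative_within bounded_linear_scaleR_left)
  also have "\<dots> \<longleftrightarrow> ((\<lambda>s. (f s - f t) /\<^sub>R (s - t) - D) \<longlongrightarrow> 0) (at t within S)"
    unfolding tendsto_norm_zero_iff[symmetric, of "\<lambda>s. (1 / norm (s - t)) *\<^sub>R (f s - (f t + (s - t) *\<^sub>R D))"]
      tendsto_norm_zero_iff[symmetric, of "\<lambda>s. (f s - f t) /\<^sub>R (s - t) - D"]
    by (rule filterlim_cong[OF refl refl], unfold eventually_at_filter, rule always_eventually)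
      (intro allI impI eq)
  finally show ?thesis by (simp add: LIM_zero_iff)
qed

lemma tendsto_fun_iff:
  fixes f :: "'a \<Rightarrow> 'b \<Rightarrow> 'c::topological_space"
  shows "(f \<longlongrightarrow> l) F \<longleftrightarrow> (\<forall>i. ((\<lambda>x. f x i) \<longlongrightarrow> l i) F)"
  using limitin_componentwise[of "\<lambda>_. euclidean" UNIV f l F]
  by (simp add: euclidean_product_topology)

text \<open>\<open>velocity\<close> is a definite description and T is an arbitrary topology, so
  uniqueness of limits has to be supplied in each application.\<close>

lemma velocity_eq:
  assumes "has_velocity T \<gamma> v t {0..1}" "\<And>w. has_velocity T \<gamma> w t {0..1} \<Longrightarrow> w = v"
  shows "velocity T \<gamma> t = v"
  unfolding velocity_def using assms by (rule the_equality)

lemma breakpoint_interval: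
  fixes \<tau> :: "nat \<Rightarrow> real"
  assumes "\<tau> 0 \<le> t" "t \<le> \<tau> k" "t \<notin> \<tau> ` {..k}"
  obtains i where "i < k" "\<tau> i < t" "t < \<tau> (Suc i)"
proof -
  have lt: "\<tau> 0 < t" "t < \<tau> k" using assms by (auto simp: order_le_less)
  define j where "j = (LEAST j. t < \<tau> j)"
  have j: "t < \<tau> j" "j \<le> k" "\<And>i. i < j \<Longrightarrow> \<tau> i \<le> t"
    unfolding j_def using lt by (auto intro: LeastI Least_le dest: not_less_Least)
  have "j \<noteq> 0" using j lt by (metis less_asym)
  then obtain i where "j = Suc i" by (cases j) auto
  moreover from this have "\<tau> i \<noteq> t" using assms(3) j(2) by (metis Suc_leD atMost_iff image_eqI)
  ultimately show ?thesis using that[of i] j(1,2) j(3)[of i] by (simp add: order_le_less)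
qed

lemma breakpoints_mono:
  fixes \<tau> :: "nat \<Rightarrow> real"
  assumes "\<And>i. i < k \<Longrightarrow> \<tau> i < \<tau> (Suc i)" "i \<le> j" "j \<le> k"
  shows "\<tau> i \<le> \<tau> j"
  using assms(2,3)
proof (induction j rule: dec_induct)
  case (step j)
  then show ?case using assms(1)[of j] by simp
qed simp

text \<open>At interior points of a piece, limits within the piece and within the unit interval
  coincide.\<close>

lemma piecewise_C1_velocity:
  assumes \<tau>: "\<tau> 0 = 0" "\<tau> k = 1" "\<And>i. i < k \<Longrightarrow> \<tau> i < \<tau> (Suc i)"
    and "i < k" "\<tau> i < t" "t < \<tau> (Suc i)" "has_velocity T \<gamma> v t {\<tau> i..\<tau> (Suc i)}"
  shows "has_velocity T \<gamma> v t {0..1}"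
proof -
  have "0 \<le> \<tau> i" "\<tau> (Suc i) \<le> 1"
    using breakpoints_mono[of k \<tau> 0 i] breakpoints_mono[of k \<tau> "Suc i" k] assms(4) \<tau> by auto
  then have "t \<in> interior {0..1}" "t \<in> interior {\<tau> i..\<tau> (Suc i)}"
    using assms(5,6) by auto
  then have "at t within {\<tau> i..\<tau> (Suc i)} = at t within {0..1}"
    by (simp only: at_within_interior)
  then show ?thesis using assms(7) by (simp add: has_velocity_def)
qed

lemma path_length_eq:
  assumes "finite N" "\<And>t. t \<in> {0..1} - N \<Longrightarrow> velocity T \<gamma> t = v t"
  shows "path_length T G \<gamma> = integral {0..1} (\<lambda>t. sqrt (G (\<gamma> t) (v t) (v t)))"
  unfolding path_length_def
  by (rule integral_spike[of N]) (use assms in \<open>auto intro: negligible_finite\<close>)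

section \<open>Paths in a fibre\<close>

abbreviation fibre_top :: "('m, 'e, 'r::finite) vbundle \<Rightarrow> 'm \<Rightarrow> 'e form topology"
  where "fibre_top E x \<equiv> subtopology euclidean (Herm E x)"

lemma limitin_fibre_top:
  "limitin (fibre_top E x) f l F \<longleftrightarrow> l \<in> Herm E x \<and> (\<forall>\<^sub>F s in F. f s \<in> Herm E x) \<and>
    (\<forall>a b. ((\<lambda>s. f s a b) \<longlongrightarrow> l a b) F)"
  by (auto simp: limitin_subtopology tendsto_fun_iff)

lemma has_velocity_fibre_unique:
  assumes "has_velocity (fibre_top E x) \<gamma> v t {0..1}" "has_velocity (fibre_top E x) \<gamma> w t {0..1}" "t \<in> {0..1}"
  shows "w = v"
proof (intro ext)
  fix a b
  have "at t within {0..1} \<noteq> bot"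
    using assms(3) by (simp add: trivial_limit_within)
  moreover have "((\<lambda>s. ((\<gamma> s - \<gamma> t) /\<^sub>R (s - t)) a b) \<longlongrightarrow> v a b) (at t within {0..1})"
    "((\<lambda>s. ((\<gamma> s - \<gamma> t) /\<^sub>R (s - t)) a b) \<longlongrightarrow> w a b) (at t within {0..1})"
    using assms(1,2) unfolding has_velocity_def limitin_fibre_top by blast+
  ultimately show "w a b = v a b"
    using tendsto_unique by blast
qed

lemma velocity_fibre:
  assumes "has_velocity (fibre_top E x) \<gamma> v t {0..1}" "t \<in> {0..1}"
  shows "velocity (fibre_top E x) \<gamma> t = v"
  by (rule velocity_eq[OF assms(1)]) (rule has_velocity_fibre_unique[OF assms(1) _ assms(2)])

lemma fibre_metric_nonneg:
  fixes E :: "('m, 'e, 'r::finite) vbundle"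
  assumes "fibre_iso E x \<Phi>" "h \<in> Herm_pos E x" "v \<in> Herm E x" "\<alpha> x > - 1 / real CARD('r)"
  shows "fibre_metric E \<alpha> x h v v \<ge> 0"
proof -
  interpret fibre_frame E x \<Phi> by unfold_locales fact
  show ?thesis
    using assms Herm_pos_iff Herm_adj by (auto simp: fibre_metric_eq intro!: mat_metric_nonneg)
qed

lemma has_velocity_in_Herm: "has_velocity (fibre_top E x) \<gamma> v t S \<Longrightarrow> v \<in> Herm E x"
  by (simp add: has_velocity_def limitin_fibre_top)

text \<open>Nonnegativity of the metric bounds the set of lengths below, and only then does
  \<open>Inf\<close> lie below each of its elements.\<close>

lemma
  fixes E :: "('m, 'e, 'r::finite) vbundle"
  assumes iso: "fibre_iso E x \<Phi>" and \<alpha>: "\<alpha> x > - 1 / real CARD('r)"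
  shows fibre_path_length_nonneg: "\<And>\<gamma>. piecewise_C1_path (fibre_top E x) \<gamma> \<Longrightarrow> (\<forall>t\<in>{0..1}. \<gamma> t \<in> Herm_pos E x) \<Longrightarrow>
      0 \<le> path_length (fibre_top E x) (fibre_metric E \<alpha> x) \<gamma>"
    and fibre_dist_le: "\<And>\<gamma>. piecewise_C1_path (fibre_top E x) \<gamma> \<Longrightarrow> (\<forall>t\<in>{0..1}. \<gamma> t \<in> Herm_pos E x) \<Longrightarrow>
      fibre_dist E \<alpha> x (\<gamma> 0) (\<gamma> 1) \<le> path_length (fibre_top E x) (fibre_metric E \<alpha> x) \<gamma>"
proof -
  show nn: "0 \<le> path_length (fibre_top E x) (fibre_metric E \<alpha> x) \<gamma>"
    if \<gamma>: "piecewise_C1_path (fibre_top E x) \<gamma>" "\<forall>t\<in>{0..1}. \<gamma> t \<in> Herm_pos E x" for \<gamma>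
  proof -
    obtain k :: nat and \<tau> where \<tau>: "\<tau> 0 = 0" "\<tau> k = 1" "\<And>i. i < k \<Longrightarrow> \<tau> i < \<tau> (Suc i)"
      and C1: "\<And>i. i < k \<Longrightarrow> C1_path_on (fibre_top E x) (\<tau> i) (\<tau> (Suc i)) \<gamma>"
      using \<gamma>(1) unfolding piecewise_C1_path_def by blast
    let ?N = "\<tau> ` {..k}"
    have vel: "velocity (fibre_top E x) \<gamma> t \<in> Herm E x" if t: "t \<in> {0..1} - ?N" for t
    proof -
      obtain i where i: "i < k" "\<tau> i < t" "t < \<tau> (Suc i)"
        using breakpoint_interval[of \<tau> t k] t \<tau>(1,2) by auto
      then obtain v where "has_velocity (fibre_top E x) \<gamma> v t {\<tau> i..\<tau> (Suc i)}"
        using C1[OF i(1)] unfolding C1_path_on_def by (meson atLeastAtMost_iff less_imp_le)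
      then have "has_velocity (fibre_top E x) \<gamma> v t {0..1}"
        using piecewise_C1_velocity[OF \<tau> i] by blast
      then show ?thesis
        using velocity_fibre has_velocity_in_Herm t by fastforce
    qed
    \<comment> \<open>At breakpoints \<open>velocity\<close> may be arbitrary; the value 0 there
      changes no integral and keeps the integrand nonnegative everywhere.\<close>
    define v where "v = (\<lambda>t. if t \<in> {0..1} - ?N then velocity (fibre_top E x) \<gamma> t else 0)"
    have "path_length (fibre_top E x) (fibre_metric E \<alpha> x) \<gamma> =
        integral {0..1} (\<lambda>t. sqrt (fibre_metric E \<alpha> x (\<gamma> t) (v t) (v t)))"
      by (rule path_length_eq[of ?N]) (auto simp: v_def)
    moreover have "0 \<le> sqrt (fibre_metric E \<alpha> x (\<gamma> t) (v t) (v t))" if "t \<in> {0..1}" for t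
    proof -
      have "0 \<in> Herm E x" by (rule HermI) simp_all
      then have "v t \<in> Herm E x" using that vel by (auto simp: v_def)
      then show ?thesis using fibre_metric_nonneg[OF iso, of "\<gamma> t" "v t" \<alpha>] \<gamma>(2) that \<alpha> by simp
    qed
    \<comment> \<open>A non-integrable integrand has \<open>integral\<close> 0, which is nonnegative
      too.\<close>
    ultimately show ?thesis
      by (cases "(\<lambda>t. sqrt (fibre_metric E \<alpha> x (\<gamma> t) (v t) (v t))) integrable_on {0..1}")
        (auto intro: integral_nonneg simp: not_integrable_integral)
  qed
  show "fibre_dist E \<alpha> x (\<gamma> 0) (\<gamma> 1) \<le> path_length (fibre_top E x) (fibre_metric E \<alpha> x) \<gamma>"
    if \<gamma>: "piecewise_C1_path (fibre_top E x) \<gamma>" "\<forall>t\<in>{0..1}. \<gamma> t \<in> Herm_pos E x" for \<gamma>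
    unfolding fibre_dist_def riemannian_dist_def
  proof (rule cInf_lower)
    show "bdd_below {path_length (fibre_top E x) (fibre_metric E \<alpha> x) \<gamma>' |\<gamma>'.
        piecewise_C1_path (fibre_top E x) \<gamma>' \<and> (\<forall>t\<in>{0..1}. \<gamma>' t \<in> Herm_pos E x) \<and> \<gamma>' 0 = \<gamma> 0 \<and> \<gamma>' 1 = \<gamma> 1}"
      using nn by (intro bdd_belowI[of _ 0]) auto
  qed (use \<gamma> in auto)
qed

section \<open>Smooth sections\<close>

locale hermitian_bundle = compact_manifold n A
  for n :: nat and A :: "'m::{t2_space, second_countable_topology} chart set" +
  fixes E :: "('m, 'e, 'r::finite) vbundle"
  assumes smooth_bundle: "smooth_complex_vector_bundle n A E"
begin

lemma
  assumes "(V, \<Phi>) \<in> trivs E"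
  shows triv_open: "open V" and triv_iso: "x \<in> V \<Longrightarrow> fibre_iso E x \<Phi>"
    and triv_transition: "(V', \<Psi>) \<in> trivs E \<Longrightarrow> smooth_fun n A (V \<inter> V') (\<lambda>x. \<Psi> (frame E \<Phi> x j) $ i)"
  using assms smooth_bundle unfolding smooth_complex_vector_bundle_def by fast+

lemma triv_at: obtains V \<Phi> where "(V, \<Phi>) \<in> trivs E" "x \<in> V" "fibre_iso E x \<Phi>"
proof -
  have "x \<in> (\<Union>(V, \<Phi>)\<in>trivs E. V)"
    using smooth_bundle unfolding smooth_complex_vector_bundle_def by simp
  then show ?thesis using that triv_iso by auto
qed

abbreviation "SS \<equiv> smooth_sections n A E (Herm E)"
abbreviation "SP \<equiv> smooth_sections n A E (Herm_pos E)"
abbreviation "CT \<equiv> Cinf_topology n A E"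

lemma coefficient_form_mat: "coefficient E \<Phi> i j s x = form_mat E \<Phi> x (s x) $ i $ j"
  by (simp add: coefficient_def form_mat_def)

lemma coefficient_add: "coefficient E \<Phi> i j (s + s') x = coefficient E \<Phi> i j s x + coefficient E \<Phi> i j s' x"
  and coefficient_diff: "coefficient E \<Phi> i j (s - s') x = coefficient E \<Phi> i j s x - coefficient E \<Phi> i j s' x"
  and coefficient_scaleR: "coefficient E \<Phi> i j (c *\<^sub>R s) x = c *\<^sub>R coefficient E \<Phi> i j s x"
  by (simp_all add: coefficient_def scaleR_fun_def)

lemma SS_iff: "s \<in> SS \<longleftrightarrow> (\<forall>x. s x \<in> Herm E x) \<and>
    (\<forall>V \<Phi>. (V, \<Phi>) \<in> trivs E \<longrightarrow> (\<forall>i j. smooth_fun n A V (coefficient E \<Phi> i j s)))"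
  by (auto simp: smooth_sections_def)

lemma SP_iff: "s \<in> SP \<longleftrightarrow> s \<in> SS \<and> (\<forall>x. s x \<in> Herm_pos E x)"
  by (auto simp: smooth_sections_def Herm_pos_def)

lemma SS_smooth: "s \<in> SS \<Longrightarrow> (V, \<Phi>) \<in> trivs E \<Longrightarrow> smooth_fun n A V (coefficient E \<Phi> i j s)"
  by (simp add: SS_iff)

lemma SS_add:
  assumes "s \<in> SS" "s' \<in> SS" shows "s + s' \<in> SS"
proof -
  have "coefficient E \<Phi> i j (s + s') = (\<lambda>x. coefficient E \<Phi> i j s x + coefficient E \<Phi> i j s' x)" for \<Phi> i j
    by (simp add: coefficient_add fun_eq_iff)
  then show ?thesis
    using assms triv_open by (auto simp: SS_iff intro!: Herm_add smooth_fun_add)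
qed

lemma SS_smooth_scale:
  assumes "s \<in> SS" "smooth_fun n A UNIV \<rho>" shows "(\<lambda>x. \<rho> x *\<^sub>R s x) \<in> SS"
proof -
  have "coefficient E \<Phi> i j (\<lambda>x. \<rho> x *\<^sub>R s x) = (\<lambda>x. \<rho> x *\<^sub>R coefficient E \<Phi> i j s x)" for \<Phi> i j
    by (simp add: coefficient_def scaleR_fun_def fun_eq_iff)
  then show ?thesis
    using assms triv_open smooth_fun_subset[OF assms(2)]
    by (auto simp: SS_iff intro!: Herm_scaleR smooth_fun_scaleR)
qed

lemma SS_scaleR: "s \<in> SS \<Longrightarrow> c *\<^sub>R s \<in> SS"
  using SS_smooth_scale[of s "\<lambda>_. c"] smooth_fun_const[of UNIV c] by (simp add: scaleR_fun_def)

lemma SS_diff: "s \<in> SS \<Longrightarrow> s' \<in> SS \<Longrightarrow> s - s' \<in> SS"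
  using SS_add[of s "(-1) *\<^sub>R s'"] SS_scaleR[of s' "-1"] by simp

section \<open>Convergence in the topology of smooth sections\<close>

text \<open>Convergence in each defining seminorm, centred at the limit. The generated topology has
  balls about arbitrary centres as a subbasis, for which sums are awkward;
  \<open>sconv_imp_limitin\<close> makes the transition.\<close>

definition sconv :: "('a \<Rightarrow> 'm \<Rightarrow> 'e form) \<Rightarrow> ('m \<Rightarrow> 'e form) \<Rightarrow> 'a filter \<Rightarrow> bool"
  where "sconv f l F \<longleftrightarrow> l \<in> SS \<and> (\<forall>\<^sub>F t in F. f t \<in> SS) \<and>
    (\<forall>U \<phi> V \<Phi> K is i j \<epsilon>. (U, \<phi>) \<in> A \<longrightarrow> (V, \<Phi>) \<in> trivs E \<longrightarrow> K \<subseteq> \<phi> ` (U \<inter> V) \<longrightarrow> compact K \<longrightarrow>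
       set is \<subseteq> {..<n} \<longrightarrow> (0::real) < \<epsilon> \<longrightarrow>
       (\<forall>\<^sub>F t in F. \<forall>y\<in>K. norm (partials is (\<lambda>y. coefficient E \<Phi> i j (f t - l) (inv_into U \<phi> y)) y) < \<epsilon>))"

lemma coefficient_smooth_on:
  assumes "s \<in> SS" "(U, \<phi>) \<in> A" "(V, \<Phi>) \<in> trivs E"
  shows "smooth_on n (\<phi> ` (U \<inter> V)) (\<lambda>y. coefficient E \<Phi> i j s (inv_into U \<phi> y))"
  using SS_smooth[OF assms(1,3), of i j] assms(2) unfolding smooth_fun_def by fast

lemma chart_triv_open: "(U, \<phi>) \<in> A \<Longrightarrow> (V, \<Phi>) \<in> trivs E \<Longrightarrow> openin (top_of_set (Rn n)) (\<phi> ` (U \<inter> V))"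
  using chart_image_open triv_open by blast

lemma partials_coefficient_add:
  assumes "s \<in> SS" "s' \<in> SS" "(U, \<phi>) \<in> A" "(V, \<Phi>) \<in> trivs E" "set is \<subseteq> {..<n}" "y \<in> \<phi> ` (U \<inter> V)"
  shows "partials is (\<lambda>y. coefficient E \<Phi> i j (s + s') (inv_into U \<phi> y)) y =
    partials is (\<lambda>y. coefficient E \<Phi> i j s (inv_into U \<phi> y)) y +
    partials is (\<lambda>y. coefficient E \<Phi> i j s' (inv_into U \<phi> y)) y"
  unfolding coefficient_add
  by (rule partials_add[OF chart_triv_open[OF assms(3,4)]]) (use assms coefficient_smooth_on in auto)

lemma partials_coefficient_scaleR:
  assumes "s \<in> SS" "(U, \<phi>) \<in> A" "(V, \<Phi>) \<in> trivs E" "set is \<subseteq> {..<n}" "y \<in> \<phi> ` (U \<inter> V)"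
  shows "partials is (\<lambda>y. coefficient E \<Phi> i j (c *\<^sub>R s) (inv_into U \<phi> y)) y =
    c *\<^sub>R partials is (\<lambda>y. coefficient E \<Phi> i j s (inv_into U \<phi> y)) y"
  unfolding coefficient_scaleR
  by (rule partials_scaleR[OF chart_triv_open[OF assms(2,3)]]) (use assms coefficient_smooth_on in auto)

lemma partials_coefficient_bounded:
  assumes "s \<in> SS" "(U, \<phi>) \<in> A" "(V, \<Phi>) \<in> trivs E" "set is \<subseteq> {..<n}" "K \<subseteq> \<phi> ` (U \<inter> V)" "compact K" "K \<noteq> {}"
  obtains z where "z \<in> K" "\<And>y. y \<in> K \<Longrightarrow> norm (partials is (\<lambda>y. coefficient E \<Phi> i j s (inv_into U \<phi> y)) y) \<le>
     norm (partials is (\<lambda>y. coefficient E \<Phi> i j s (inv_into U \<phi> y)) z)"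
proof -
  have "continuous_on K (partials is (\<lambda>y. coefficient E \<Phi> i j s (inv_into U \<phi> y)))"
    using smooth_on_partials[OF coefficient_smooth_on[OF assms(1-3)] assms(4)] assms(5)
    by (auto intro: continuous_on_subset)
  then have "continuous_on K (\<lambda>y. norm (partials is (\<lambda>y. coefficient E \<Phi> i j s (inv_into U \<phi> y)) y))"
    by (rule continuous_on_norm)
  then show ?thesis
    using continuous_attains_sup[OF assms(6,7)] that by blast
qed

lemma sconv_add:
  assumes f: "sconv f l F" and g: "sconv g m F"
  shows "sconv (\<lambda>t. f t + g t) (l + m) F"
  unfolding sconv_def
proof (intro conjI allI impI)
  have lm: "l \<in> SS" "m \<in> SS" and ev: "\<forall>\<^sub>F t in F. f t \<in> SS" "\<forall>\<^sub>F t in F. g t \<in> SS"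
    using f g by (auto simp: sconv_def)
  show "l + m \<in> SS" using lm by (rule SS_add)
  show "\<forall>\<^sub>F t in F. f t + g t \<in> SS" using ev by eventually_elim (rule SS_add)
  fix U \<phi> V \<Phi> K "is" i j and \<epsilon> :: real
  assume a: "(U, \<phi>) \<in> A" "(V, \<Phi>) \<in> trivs E" "K \<subseteq> \<phi> ` (U \<inter> V)" "compact K" "set is \<subseteq> {..<n}" "0 < \<epsilon>"
  have "\<forall>\<^sub>F t in F. \<forall>y\<in>K. norm (partials is (\<lambda>y. coefficient E \<Phi> i j (f t - l) (inv_into U \<phi> y)) y) < \<epsilon> / 2"
    "\<forall>\<^sub>F t in F. \<forall>y\<in>K. norm (partials is (\<lambda>y. coefficient E \<Phi> i j (g t - m) (inv_into U \<phi> y)) y) < \<epsilon> / 2"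
    using f g a unfolding sconv_def by (meson half_gt_zero)+
  with ev show "\<forall>\<^sub>F t in F. \<forall>y\<in>K.
      norm (partials is (\<lambda>y. coefficient E \<Phi> i j (f t + g t - (l + m)) (inv_into U \<phi> y)) y) < \<epsilon>"
  proof eventually_elim
    case (elim t)
    show ?case
    proof
      fix y assume y: "y \<in> K"
      have eq: "f t + g t - (l + m) = (f t - l) + (g t - m)" by simp
      have "partials is (\<lambda>y. coefficient E \<Phi> i j (f t + g t - (l + m)) (inv_into U \<phi> y)) y =
          partials is (\<lambda>y. coefficient E \<Phi> i j (f t - l) (inv_into U \<phi> y)) y +
          partials is (\<lambda>y. coefficient E \<Phi> i j (g t - m) (inv_into U \<phi> y)) y"
        unfolding eq
        by (rule partials_coefficient_add) (use elim(1,2) lm a y in \<open>auto intro: SS_diff\<close>)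
      then show "norm (partials is (\<lambda>y. coefficient E \<Phi> i j (f t + g t - (l + m)) (inv_into U \<phi> y)) y) < \<epsilon>"
        using elim(3,4) y by (metis norm_triangle_lt field_sum_of_halves add_strict_mono)
    qed
  qed
qed

text \<open>Each seminorm of the difference is |a t - a0| times a seminorm of s, which is finite on
  the compact K. Convergence of one real coefficient thus gives convergence of all derivatives in
  x.\<close>

lemma sconv_scaleR:
  assumes s: "s \<in> SS" and a: "(a \<longlongrightarrow> a0) F"
  shows "sconv (\<lambda>t. a t *\<^sub>R s) (a0 *\<^sub>R s) F"
  unfolding sconv_def
proof (intro conjI allI impI)
  show "a0 *\<^sub>R s \<in> SS" using s by (rule SS_scaleR)
  show "\<forall>\<^sub>F t in F. a t *\<^sub>R s \<in> SS" using s by (auto intro: always_eventually SS_scaleR)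
  fix U \<phi> V \<Phi> K "is" i j and \<epsilon> :: real
  assume b: "(U, \<phi>) \<in> A" "(V, \<Phi>) \<in> trivs E" "K \<subseteq> \<phi> ` (U \<inter> V)" "compact K" "set is \<subseteq> {..<n}" "0 < \<epsilon>"
  let ?p = "\<lambda>s y. partials is (\<lambda>y. coefficient E \<Phi> i j s (inv_into U \<phi> y)) y"
  show "\<forall>\<^sub>F t in F. \<forall>y\<in>K. norm (?p (a t *\<^sub>R s - a0 *\<^sub>R s) y) < \<epsilon>"
  proof (cases "K = {}")
    case False
    obtain z where z: "\<And>y. y \<in> K \<Longrightarrow> norm (?p s y) \<le> norm (?p s z)"
      using partials_coefficient_bounded[OF s b(1,2,5,3,4) False] by metis
    have "((\<lambda>t. norm (a t - a0) * norm (?p s z)) \<longlongrightarrow> norm (a0 - a0) * norm (?p s z)) F"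
      by (intro tendsto_intros a)
    then have "\<forall>\<^sub>F t in F. norm (a t - a0) * norm (?p s z) < \<epsilon>"
      using b(6) by (auto dest: order_tendstoD(2))
    then show ?thesis
    proof eventually_elim
      case (elim t)
      show ?case
      proof
        fix y assume y: "y \<in> K"
        have "?p (a t *\<^sub>R s - a0 *\<^sub>R s) y = (a t - a0) *\<^sub>R ?p s y"
          using partials_coefficient_scaleR[of s U \<phi> V \<Phi> "is" y i j "a t - a0"] s b y
          by (auto simp: scaleR_diff_left)
        then have "norm (?p (a t *\<^sub>R s - a0 *\<^sub>R s) y) \<le> norm (a t - a0) * norm (?p s z)"
          using z[OF y] by (simp add: mult_left_mono)
        then show "norm (?p (a t *\<^sub>R s - a0 *\<^sub>R s) y) < \<epsilon>" using elim by linarith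
      qed
    qed
  qed auto
qed

section \<open>The topology generated by the seminorm balls\<close>

definition Cinf_ball where
  "Cinf_ball s0 U \<phi> V \<Phi> K is i j \<epsilon> = {s \<in> SS.
     \<forall>y\<in>K. norm (partials is (\<lambda>y. coefficient E \<Phi> i j (s - s0) (inv_into U \<phi> y)) y) < (\<epsilon>::real)}"

lemma Cinf_ball_open:
  assumes "s0 \<in> SS" "(U, \<phi>) \<in> A" "(V, \<Phi>) \<in> trivs E" "K \<subseteq> \<phi> ` (U \<inter> V)" "compact K" "set is \<subseteq> {..<n}" "0 < \<epsilon>"
  shows "openin CT (Cinf_ball s0 U \<phi> V \<Phi> K is i j \<epsilon>)"
  unfolding Cinf_topology_def Cinf_ball_def
  by (rule topology_generated_by_Basis) (use assms in blast)

lemma topspace_CT: "topspace CT = SS"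
proof
  show "topspace CT \<subseteq> SS"
    unfolding Cinf_topology_def topology_generated_by_topspace by blast
  show "SS \<subseteq> topspace CT"
  proof
    fix s assume s: "s \<in> SS"
    obtain U \<phi> where U: "(U, \<phi>) \<in> A" using chart_at by metis
    obtain V \<Phi> where V: "(V, \<Phi>) \<in> trivs E" using triv_at by metis
    \<comment> \<open>With K empty the condition is void, so this subbasic set is all of
      \<open>SS\<close>.\<close>
    have "openin CT (Cinf_ball s U \<phi> V \<Phi> {} [] undefined undefined 1)"
      using s U V by (intro Cinf_ball_open) auto
    moreover have "s \<in> Cinf_ball s U \<phi> V \<Phi> {} [] undefined undefined 1"
      using s by (simp add: Cinf_ball_def)
    ultimately show "s \<in> topspace CT" by (auto simp: topspace_def)
  qed
qed

lemma sconv_imp_limitin: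
  assumes "sconv f l F"
  shows "limitin CT f l F"
  unfolding limitin_def
proof (intro conjI allI impI)
  have l: "l \<in> SS" and ev: "\<forall>\<^sub>F t in F. f t \<in> SS"
    using assms by (auto simp: sconv_def)
  show "l \<in> topspace CT" using l by (simp add: topspace_CT)
  fix O' assume "openin CT O' \<and> l \<in> O'"
  then have "generate_topology_on {Cinf_ball s0 U \<phi> V \<Phi> K is i j \<epsilon> | s0 U \<phi> V \<Phi> K is i j \<epsilon>.
       s0 \<in> SS \<and> (U, \<phi>) \<in> A \<and> (V, \<Phi>) \<in> trivs E \<and> K \<subseteq> \<phi> ` (U \<inter> V) \<and> compact K \<and>
       set is \<subseteq> {..<n} \<and> \<epsilon> > (0::real)} O'" and "l \<in> O'"
    by (auto simp: Cinf_topology_def Cinf_ball_def openin_topology_generated_by_iff)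
  then show "\<forall>\<^sub>F t in F. f t \<in> O'"
  proof (induction rule: generate_topology_on.induct)
    case (Int a b)
    then show ?case by (auto intro: eventually_conj)
  next
    case (UN S)
    then obtain k where "k \<in> S" "l \<in> k" by blast
    then have "\<forall>\<^sub>F t in F. f t \<in> k" using UN by blast
    then show ?case by eventually_elim (use \<open>k \<in> S\<close> in blast)
  next
    case (Basis B)
    then obtain s0 U \<phi> V \<Phi> K "is" i j \<epsilon> where B: "B = Cinf_ball s0 U \<phi> V \<Phi> K is i j \<epsilon>"
      and b: "s0 \<in> SS" "(U, \<phi>) \<in> A" "(V, \<Phi>) \<in> trivs E" "K \<subseteq> \<phi> ` (U \<inter> V)" "compact K"
        "set is \<subseteq> {..<n}" "\<epsilon> > (0::real)"
      by blast
    let ?p = "\<lambda>s y. partials is (\<lambda>y. coefficient E \<Phi> i j s (inv_into U \<phi> y)) y"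
    show ?case
    proof (cases "K = {}")
      case True
      then show ?thesis using ev by (simp add: B Cinf_ball_def)
    next
      case False
      \<comment> \<open>The ball is centred at s0 rather than at l. The seminorm of
        \<open>l - s0\<close> is attained on the compact K, hence strictly below \<epsilon>, and the
        remaining margin is available for \<open>f t - l\<close>.\<close>
      obtain z where z: "z \<in> K" "\<And>y. y \<in> K \<Longrightarrow> norm (?p (l - s0) y) \<le> norm (?p (l - s0) z)"
        using partials_coefficient_bounded[OF SS_diff[OF l b(1)] b(2,3,6,4,5) False] by metis
      have "norm (?p (l - s0) z) < \<epsilon>"
        using Basis(2) z(1) by (auto simp: B Cinf_ball_def)
      then have "0 < \<epsilon> - norm (?p (l - s0) z)" by simp
      then have "\<forall>\<^sub>F t in F. \<forall>y\<in>K. norm (?p (f t - l) y) < \<epsilon> - norm (?p (l - s0) z)"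
        using assms b unfolding sconv_def by blast
      with ev show ?thesis
      proof eventually_elim
        case (elim t)
        have "norm (?p (f t - s0) y) < \<epsilon>" if y: "y \<in> K" for y
        proof -
          have "?p (f t - s0) y = ?p (f t - l) y + ?p (l - s0) y"
            using partials_coefficient_add[of "f t - l" "l - s0" U \<phi> V \<Phi> "is" y i j] elim l b y SS_diff by auto
          then have "norm (?p (f t - s0) y) \<le> norm (?p (f t - l) y) + norm (?p (l - s0) y)"
            by (simp add: norm_triangle_ineq)
          moreover have "norm (?p (f t - l) y) < \<epsilon> - norm (?p (l - s0) z)" using elim y by blast
          ultimately show ?thesis using z(2)[OF y] by linarith
        qed
        then show ?case using elim by (simp add: B Cinf_ball_def)
      qed
    qed
  qed simp
qed

text \<open>Extracts only the seminorms without derivatives; the metric involves no derivatives in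
  x.\<close>

lemma limitin_CT_uniform:
  assumes "limitin CT f l F" "(V, \<Phi>) \<in> trivs E" "(U, \<phi>) \<in> A" "K \<subseteq> U \<inter> V" "compact K" "0 < (\<epsilon>::real)"
  shows "\<forall>\<^sub>F t in F. \<forall>x\<in>K. norm (coefficient E \<Phi> i j (f t) x - coefficient E \<Phi> i j l x) < \<epsilon>"
proof -
  have l: "l \<in> SS" using assms(1) by (simp add: limitin_def topspace_CT)
  have "compact (\<phi> ` K)"
    using assms(4,5) chart_continuous_on[OF assms(3)]
    by (intro compact_continuous_image) (auto intro: continuous_on_subset)
  then have "openin CT (Cinf_ball l U \<phi> V \<Phi> (\<phi> ` K) [] i j \<epsilon>)"
    using assms l by (intro Cinf_ball_open) auto
  moreover have "l \<in> Cinf_ball l U \<phi> V \<Phi> (\<phi> ` K) [] i j \<epsilon>"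
    using l assms(6) by (simp add: Cinf_ball_def coefficient_def)
  ultimately have "\<forall>\<^sub>F t in F. f t \<in> Cinf_ball l U \<phi> V \<Phi> (\<phi> ` K) [] i j \<epsilon>"
    using assms(1) by (simp add: limitin_def)
  then show ?thesis
  proof eventually_elim
    case (elim t)
    then show ?case
      using assms(4) chart_inv[OF assms(3)]
      by (auto simp: Cinf_ball_def coefficient_diff subset_iff)
  qed
qed

text \<open>A single point is a compact set, so the coefficients at x converge, and the value of a
  form on two vectors is a finite combination of them.\<close>

lemma limitin_CT_eval:
  assumes "limitin CT f l G"
  shows "limitin (fibre_top E x) (\<lambda>t. f t x) (l x) G"
  unfolding limitin_fibre_top
proof (intro conjI allI)
  have l: "l \<in> SS" using assms by (simp add: limitin_def topspace_CT)
  then show lx: "l x \<in> Herm E x" by (simp add: SS_iff)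
  have "\<forall>\<^sub>F t in G. f t \<in> SS"
    using assms topspace_CT openin_topspace[of CT] l by (simp add: limitin_def)
  then show ev: "\<forall>\<^sub>F t in G. f t x \<in> Herm E x"
    by eventually_elim (simp add: SS_iff)
  obtain V \<Phi> where V: "(V, \<Phi>) \<in> trivs E" "x \<in> V" "fibre_iso E x \<Phi>" by (rule triv_at)
  interpret fibre_frame E x \<Phi> by unfold_locales fact
  obtain U \<phi> where U: "(U, \<phi>) \<in> A" "x \<in> U" by (rule chart_at)
  have c: "((\<lambda>t. form_mat E \<Phi> x (f t x) $ i $ j) \<longlongrightarrow> form_mat E \<Phi> x (l x) $ i $ j) G" for i j
    unfolding tendsto_iff
  proof (intro allI impI)
    fix e :: real assume "e > 0"
    then show "\<forall>\<^sub>F t in G. dist (form_mat E \<Phi> x (f t x) $ i $ j) (form_mat E \<Phi> x (l x) $ i $ j) < e"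
      using limitin_CT_uniform[OF assms V(1) U(1), of "{x}" e i j] U V
      by (simp add: coefficient_form_mat dist_norm)
  qed
  fix a b
  show "((\<lambda>t. f t x a b) \<longlongrightarrow> l x a b) G"
  proof (cases "a \<in> F \<and> b \<in> F")
    case True
    have "((\<lambda>t. \<Sum>i\<in>UNIV. \<Sum>j\<in>UNIV. \<Phi> a $ i * cnj (\<Phi> b $ j) * form_mat E \<Phi> x (f t x) $ i $ j) \<longlongrightarrow>
        (\<Sum>i\<in>UNIV. \<Sum>j\<in>UNIV. \<Phi> a $ i * cnj (\<Phi> b $ j) * form_mat E \<Phi> x (l x) $ i $ j)) G"
      by (intro tendsto_intros c)
    then show ?thesis
      using True lx ev by (auto simp: Herm_expand[symmetric] elim!: Lim_transform_eventually eventually_mono)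
  next
    case False
    then have z: "v a b = 0" if "v \<in> Herm E x" for v
      using HermD(1)[OF that] by blast
    have "\<forall>\<^sub>F t in G. f t x a b = 0"
      using ev by eventually_elim (rule z)
    then show ?thesis using z[OF lx] by (simp add: tendsto_eventually)
  qed
qed

end

section \<open>Approximation by paths of constant speed\<close>

definition C1_curve :: "(real \<Rightarrow> 'b::real_normed_vector) \<Rightarrow> (real \<Rightarrow> 'b) \<Rightarrow> bool"
  where "C1_curve w w' \<longleftrightarrow> continuous_on {0..1} w' \<and>
    (\<forall>t\<in>{0..1}. (w has_vector_derivative w' t) (at t within {0..1}))"

lemma C1_curve_continuous: "C1_curve w w' \<Longrightarrow> continuous_on {0..1} w"
  unfolding C1_curve_def continuous_on_eq_continuous_within by (meson has_vector_derivative_continuous)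

text \<open>The derivative is damped near the corners; the end point is then corrected linearly.\<close>

lemma corner_smoothing:
  fixes c c' :: "real \<Rightarrow> 'b::euclidean_space" and G :: "'b \<Rightarrow> 'b \<Rightarrow> real"
  assumes N: "finite N" and "0 \<in> N" "1 \<in> N"
    and c: "continuous_on {0..1} c"
    and der: "\<And>t. t \<in> {0..1} - N \<Longrightarrow> (c has_vector_derivative c' t) (at t)"
    and c': "continuous_on ({0..1} - N) c'" and B: "\<And>t. t \<in> {0..1} - N \<Longrightarrow> norm (c' t) \<le> B"
    and P: "open P" "\<And>t. t \<in> {0..1} \<Longrightarrow> c t \<in> P"
    and G: "continuous_on (P \<times> UNIV) (\<lambda>z. G (fst z) (snd z))"
    and J: "bounded_linear J" "\<And>t. t \<in> {0..1} \<Longrightarrow> J (c t) = c t" "\<And>t. t \<in> {0..1} - N \<Longrightarrow> J (c' t) = c' t"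
    and \<epsilon>: "\<epsilon> > 0"
  shows "\<exists>w w'. C1_curve w w' \<and> (\<forall>t\<in>{0..1}. w t \<in> P \<and> J (w t) = w t \<and> J (w' t) = w' t) \<and>
    w 0 = c 0 \<and> w 1 = c 1 \<and>
    integral {0..1} (\<lambda>t. G (w t) (w' t)) < integral {0..1} (\<lambda>t. G (c t) (c' t)) + \<epsilon>"
proof -
  interpret J: bounded_linear J by fact
  define B' where "B' = max B 0"
  have B': "B' \<ge> 0" "\<And>t. t \<in> {0..1} - N \<Longrightarrow> norm (c' t) \<le> B'"
    using B by (auto simp: B'_def le_max_iff_disj)
  \<comment> \<open>Vanishes exactly at the corners. The cut-off \<open>\<kappa> m\<close> built
    from it is 0 there and tends to 1 elsewhere.\<close>
  define \<pi> where "\<pi> = (\<lambda>t. \<Prod>p\<in>N. \<bar>t - p\<bar>)"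
  have \<pi>: "continuous_on S \<pi>" "\<pi> t \<ge> 0" "\<pi> t = 0 \<longleftrightarrow> t \<in> N" for S t
    using N by (auto simp: \<pi>_def intro!: continuous_intros prod_nonneg)
  define \<kappa> where "\<kappa> = (\<lambda>m t. min 1 (real m * \<pi> t))"
  have \<kappa>: "continuous_on S (\<kappa> m)" "0 \<le> \<kappa> m t" "\<kappa> m t \<le> 1" for S m t
    using \<pi> by (auto simp: \<kappa>_def intro!: continuous_intros)
  have \<kappa>_lim: "(\<lambda>m. \<kappa> m t) \<longlonglongrightarrow> 1" if "t \<notin> N" for t
  proof (rule tendsto_eventually)
    have "\<pi> t > 0" using \<pi>(2)[of t] \<pi>(3)[of t] that by simp
    moreover have "filterlim (\<lambda>m. real m) at_top sequentially" by (rule filterlim_real_sequentially)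
    then have "\<forall>\<^sub>F m in sequentially. 1 / \<pi> t \<le> real m" by (simp add: filterlim_at_top)
    ultimately show "\<forall>\<^sub>F m in sequentially. \<kappa> m t = 1"
      by (auto elim!: eventually_mono simp: \<kappa>_def field_simps min_def)
  qed
  \<comment> \<open>Continuous even at the corners, because \<open>c'\<close> is bounded and
    \<open>\<kappa> m\<close> vanishes there.\<close>
  define u where "u = (\<lambda>m t. if t \<in> N then 0 else \<kappa> m t *\<^sub>R c' t)"
  have u_norm: "norm (u m t) \<le> \<kappa> m t * B'" if "t \<in> {0..1}" for m t
    using B'(2)[of t] \<kappa>(2)[of m t] that by (auto simp: u_def B'(1) intro!: mult_left_mono)
  have u_norm': "norm (u m t) \<le> B'" if "t \<in> {0..1}" for m t
    using u_norm[OF that, of m] mult_left_le_one_le[OF B'(1) \<kappa>(2,3)[of m t]] by linarith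
  have u_cont: "continuous_on {0..1} (u m)" for m
    unfolding continuous_on_eq_continuous_within
  proof
    fix t :: real assume t: "t \<in> {0..1}"
    show "continuous (at t within {0..1}) (u m)"
    proof (cases "t \<in> N")
      case True
      have "((\<lambda>s. \<kappa> m s * B') \<longlongrightarrow> \<kappa> m t * B') (at t within {0..1})"
        using \<kappa>(1)[of "{0..1}" m] t by (intro tendsto_intros) (auto simp: continuous_on_def)
      moreover have "\<pi> t = 0" using True \<pi>(3) by blast
      then have "\<kappa> m t = 0" by (simp add: \<kappa>_def)
      ultimately have "((\<lambda>s. \<kappa> m s * B') \<longlongrightarrow> 0) (at t within {0..1})" by simp
      then have "(u m \<longlongrightarrow> 0) (at t within {0..1})"
        by (rule Lim_null_comparison[rotated]) (auto simp: eventually_at_filter u_norm)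
      then show ?thesis using True by (simp add: continuous_within u_def)
    next
      case False
      have "continuous_on ({0..1} - N) (\<lambda>t. \<kappa> m t *\<^sub>R c' t)"
        by (intro continuous_intros c' \<kappa>)
      then have "continuous (at t within ({0..1} - N)) (\<lambda>t. \<kappa> m t *\<^sub>R c' t)"
        using t False by (simp add: continuous_on_eq_continuous_within)
      moreover have "at t within ({0..1} - N) = at t within {0..1}"
      proof (rule at_within_nhd)
        show "open (- N)" using N by (simp add: finite_imp_closed open_Compl)
      qed (use False in auto)
      ultimately have "((\<lambda>t. \<kappa> m t *\<^sub>R c' t) \<longlongrightarrow> u m t) (at t within {0..1})"
        using False by (simp add: continuous_within u_def)
      moreover have "\<forall>\<^sub>F s in at t within {0..1}. s \<in> - N"
        unfolding eventually_at_topological using False finite_imp_closed[OF N] by (intro exI[of _ "- N"]) auto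
      then have "\<forall>\<^sub>F s in at t within {0..1}. \<kappa> m s *\<^sub>R c' s = u m s"
        by eventually_elim (simp add: u_def)
      ultimately have "(u m \<longlongrightarrow> u m t) (at t within {0..1})"
        by (rule Lim_transform_eventually)
      then show ?thesis by (simp add: continuous_within)
    qed
  qed
  have u_int: "u m integrable_on {0..t}" if "t \<in> {0..1}" for m t
    by (rule integrable_continuous_real) (use that continuous_on_subset[OF u_cont] in auto)
  define c0 where "c0 = (\<lambda>t. if t \<in> N then 0 else c' t)"
  have c0_int: "(c0 has_integral (c t - c 0)) {0..t}" if t: "t \<in> {0..1}" for t
  proof (rule fundamental_theorem_of_calculus_interior_strong[OF N])
    show "(c has_vector_derivative c0 s) (at s)" if "s \<in> {0<..<t} - N" for s
      using der[of s] that t by (simp add: c0_def)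
  qed (use t continuous_on_subset[OF c] in auto)
  \<comment> \<open>Bounds, uniformly in t, the error of integrating \<open>u m\<close> in place of
    \<open>c'\<close>; it tends to 0 by dominated convergence.\<close>
  define r where "r = (\<lambda>m. integral {0..1} (\<lambda>t. (1 - \<kappa> m t) * B'))"
  have k_int: "(\<lambda>t. (1 - \<kappa> m t) * B') integrable_on {0..t}" if "t \<in> {0..1}" for m t
    by (intro integrable_continuous_real continuous_intros \<kappa>)
  have "(\<lambda>m. integral ({0..1}) (\<lambda>t. if t \<in> N then 0 else (1 - \<kappa> m t) * B')) \<longlonglongrightarrow> integral {0..1} (\<lambda>t::real. 0::real)"
  proof (rule Equivalence_Lebesgue_Henstock_Integration.dominated_convergence(2)[where h = "\<lambda>_. B'"])
    show "(\<lambda>t. if t \<in> N then 0 else (1 - \<kappa> m t) * B') integrable_on {0..1}" for m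
      by (rule integrable_spike[OF k_int[of 1 m], of N]) (use N in \<open>auto simp: negligible_finite\<close>)
    show "norm (if t \<in> N then 0 else (1 - \<kappa> m t) * B') \<le> B'" for m t
      using \<kappa>(2,3)[of m t] B'(1) by (auto simp: abs_mult intro!: mult_left_le_one_le)
    show "(\<lambda>m. if t \<in> N then 0 else (1 - \<kappa> m t) * B') \<longlonglongrightarrow> 0" for t
      using tendsto_mult[OF tendsto_diff[OF tendsto_const[of 1] \<kappa>_lim[of t]] tendsto_const[of B']] by (cases "t \<in> N") auto
  qed auto
  moreover have "integral ({0..1}) (\<lambda>t. if t \<in> N then 0 else (1 - \<kappa> m t) * B') = r m" for m
    unfolding r_def by (rule integral_spike[of N]) (use N in \<open>auto simp: negligible_finite\<close>)
  ultimately have r: "r \<longlonglongrightarrow> 0" by simp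
  have diff: "norm (c t - c 0 - integral {0..t} (u m)) \<le> r m" if t: "t \<in> {0..1}" for m t
  proof -
    have "c t - c 0 - integral {0..t} (u m) = integral {0..t} (\<lambda>s. c0 s - u m s)"
      using c0_int[OF t] u_int[OF t] integral_diff[of c0 "{0..t}" "u m"]
      by (metis has_integral_integrable integral_unique)
    also have "norm \<dots> \<le> integral {0..t} (\<lambda>s. (1 - \<kappa> m s) * B')"
    proof (rule integral_norm_bound_integral)
      show "(\<lambda>s. c0 s - u m s) integrable_on {0..t}"
        using c0_int[OF t] u_int[OF t] by (intro integrable_diff) auto
      fix s assume s: "s \<in> {0..t}"
      show "norm (c0 s - u m s) \<le> (1 - \<kappa> m s) * B'"
      proof (cases "s \<in> N")
        case False
        then have "c0 s - u m s = (1 - \<kappa> m s) *\<^sub>R c' s"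
          by (simp add: c0_def u_def scaleR_diff_left)
        then show ?thesis
          using \<kappa>(3)[of m s] B'(2)[of s] s t False by (auto intro!: mult_left_mono)
      qed (use \<kappa>(3)[of m s] B'(1) in \<open>auto simp: c0_def u_def\<close>)
    qed (use k_int t in auto)
    also have "\<dots> \<le> r m"
      unfolding r_def using t \<kappa>(3) B'(1)
      by (intro integral_subset_le k_int) auto
    finally show ?thesis .
  qed
  define d where "d = (\<lambda>m. c 1 - c 0 - integral {0..1} (u m))"
  have d: "norm (d m) \<le> r m" for m
    unfolding d_def using diff[of 1 m] by simp
  define w where "w = (\<lambda>m t. c 0 + integral {0..t} (u m) + t *\<^sub>R d m)"
  define w' where "w' = (\<lambda>m t. u m t + d m)"
  have C1: "C1_curve (w m) (w' m)" for m
    unfolding C1_curve_def w_def w'_def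
    by (auto intro!: continuous_intros u_cont derivative_eq_intros integral_has_vector_derivative)
  \<comment> \<open>Integrals and combinations of values fixed by a bounded linear J are fixed by J.
    With J = \<open>adj\<close> this keeps the smoothed curve Hermitian.\<close>
  have Jw: "J (w m t) = w m t" "J (w' m t) = w' m t" if t: "t \<in> {0..1}" for m t
  proof -
    have Ju: "J (u m s) = u m s" if "s \<in> {0..1}" for s
      using that J(3)[of s] by (auto simp: u_def J.scaleR J.zero)
    have Ji: "J (integral {0..t} (u m)) = integral {0..t} (u m)" if t: "t \<in> {0..1}" for t
    proof -
      have "integral {0..t} (J \<circ> u m) = integral {0..t} (u m)"
        by (rule integral_cong) (use Ju t in auto)
      then show ?thesis using integral_linear[OF u_int[OF t, of m] J(1)] by simp
    qed
    have Jd: "J (d m) = d m"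
      using J(2)[of 0] J(2)[of 1] by (simp add: d_def J.diff Ji)
    show "J (w m t) = w m t" "J (w' m t) = w' m t"
      using Ji[OF t] Ju[OF t] J(2)[of 0] by (simp_all add: w_def w'_def J.add J.scaleR Jd)
  qed
  have wc: "norm (w m t - c t) \<le> 2 * r m" if t: "t \<in> {0..1}" for m t
  proof -
    have "norm (w m t - c t) = norm (t *\<^sub>R d m - (c t - c 0 - integral {0..t} (u m)))"
      unfolding w_def by (rule arg_cong[where f = norm]) (simp add: algebra_simps)
    moreover have "norm (t *\<^sub>R d m) \<le> 1 * r m"
      unfolding norm_scaleR using t d[of m] by (intro mult_mono) auto
    ultimately show ?thesis
      using diff[OF t, of m] norm_triangle_ineq4[of "t *\<^sub>R d m" "c t - c 0 - integral {0..t} (u m)"]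
      by linarith
  qed
  have "compact (c ` {0..1})" by (intro compact_continuous_image c) auto
  then obtain \<eta> where \<eta>: "\<eta> > 0" "(\<Union>x\<in>c ` {0..1}. cball x \<eta>) \<subseteq> P"
    by (rule compact_subset_open_imp_cball_epsilon_subset[OF _ P(1)]) (use P(2) in auto)
  have "\<forall>\<^sub>F m in sequentially. r m < min 1 (\<eta> / 2)"
    using r \<eta>(1) by (intro order_tendstoD(2)) auto
  then obtain m0 where m0: "\<And>m. m \<ge> m0 \<Longrightarrow> r m < 1 \<and> r m < \<eta> / 2"
    by (auto simp: eventually_sequentially)
  \<comment> \<open>A compact tube around the image of c inside P. For bounded velocities G is
    bounded over it, which yields the dominating constant.\<close>
  define K where "K = (\<lambda>z. fst z + snd z) ` (c ` {0..1} \<times> cball 0 \<eta>)"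
  have "compact K"
    unfolding K_def using \<open>compact (c ` {0..1})\<close>
    by (intro compact_continuous_image compact_Times) (auto intro!: continuous_intros c)
  have "K \<subseteq> P"
    using \<eta>(2) unfolding K_def by (force simp: dist_norm)
  have wK: "w m t \<in> K" if "m \<ge> m0" "t \<in> {0..1}" for m t
  proof -
    have "norm (w m t - c t) \<le> \<eta>" using wc[OF that(2), of m] m0[OF that(1)] by linarith
    moreover have "w m t = c t + (w m t - c t)" by simp
    ultimately show ?thesis
      unfolding K_def using that(2) by (intro image_eqI[of _ _ "(c t, w m t - c t)"]) auto
  qed
  have w'B: "w' m t \<in> cball 0 (B' + 1)" if "m \<ge> m0" "t \<in> {0..1}" for m t
    using u_norm'[OF that(2), of m] d[of m] m0[OF that(1)] norm_triangle_ineq[of "u m t" "d m"]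
    by (auto simp: w'_def)
  have GK: "continuous_on (K \<times> cball 0 (B' + 1)) (\<lambda>z. G (fst z) (snd z))"
    by (rule continuous_on_subset[OF G]) (use \<open>K \<subseteq> P\<close> in auto)
  have "compact (K \<times> cball (0::'b) (B' + 1))"
    using \<open>compact K\<close> by (intro compact_Times) auto
  then have "bounded ((\<lambda>z. G (fst z) (snd z)) ` (K \<times> cball 0 (B' + 1)))"
    using GK by (intro compact_imp_bounded compact_continuous_image)
  then obtain M where M: "\<And>p v. p \<in> K \<Longrightarrow> v \<in> cball 0 (B' + 1) \<Longrightarrow> \<bar>G p v\<bar> \<le> M"
    unfolding bounded_iff by fastforce
  have Gw: "continuous_on {0..1} (\<lambda>t. G (w m t) (w' m t))" if "m \<ge> m0" for m
  proof -
    have "continuous_on {0..1} (\<lambda>t. (w m t, w' m t))"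
      using C1[of m] C1_curve_continuous[OF C1[of m]] by (intro continuous_intros) (auto simp: C1_curve_def)
    moreover have "(\<lambda>t. (w m t, w' m t)) ` {0..1} \<subseteq> K \<times> cball 0 (B' + 1)"
      using wK[OF that] w'B[OF that] by auto
    ultimately show ?thesis using continuous_on_compose2[OF GK] by fastforce
  qed
  have "(\<lambda>m. integral {0..1} (\<lambda>t. if t \<in> N then 0 else G (w (m + m0) t) (w' (m + m0) t)))
      \<longlonglongrightarrow> integral {0..1} (\<lambda>t. if t \<in> N then 0 else G (c t) (c' t))"
  proof (rule Equivalence_Lebesgue_Henstock_Integration.dominated_convergence(2)[where h = "\<lambda>_. max M 0"])
    show "(\<lambda>t. if t \<in> N then 0 else G (w (m + m0) t) (w' (m + m0) t)) integrable_on {0..1}" for m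
      by (rule integrable_spike[OF integrable_continuous_real[OF Gw[of "m + m0"]], of N])
        (use N in \<open>auto simp: negligible_finite\<close>)
    show "norm (if t \<in> N then 0 else G (w (m + m0) t) (w' (m + m0) t)) \<le> max M 0" if "t \<in> {0..1}" for m t
      using M[OF wK[OF _ that] w'B[OF _ that], of "m + m0" "m + m0"] by auto
    show "(\<lambda>m. if t \<in> N then 0 else G (w (m + m0) t) (w' (m + m0) t)) \<longlonglongrightarrow>
        (if t \<in> N then 0 else G (c t) (c' t))" if t: "t \<in> {0..1}" for t
    proof (cases "t \<in> N")
      case False
      have "(\<lambda>m. 2 * r m) \<longlonglongrightarrow> 2 * 0" by (intro tendsto_intros r)
      then have "(\<lambda>m. w m t - c t) \<longlonglongrightarrow> 0"
        by (intro Lim_null_comparison[of "\<lambda>m. w m t - c t" "\<lambda>m. 2 * r m"]) (auto simp: wc[OF t])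
      then have wl: "(\<lambda>m. w m t) \<longlonglongrightarrow> c t" by (simp add: LIM_zero_iff)
      have "d \<longlonglongrightarrow> 0"
        by (rule Lim_null_comparison[OF _ r]) (simp add: d)
      moreover have "(\<lambda>m. u m t) \<longlonglongrightarrow> 1 *\<^sub>R c' t"
        using False tendsto_scaleR[OF \<kappa>_lim[OF False] tendsto_const[of "c' t"]] by (simp add: u_def)
      ultimately have "(\<lambda>m. w' m t) \<longlonglongrightarrow> 1 *\<^sub>R c' t + 0"
        unfolding w'_def by (intro tendsto_add)
      then have "(\<lambda>m. (w m t, w' m t)) \<longlonglongrightarrow> (c t, c' t)"
        using wl by (intro tendsto_Pair) auto
      moreover have "isCont (\<lambda>z. G (fst z) (snd z)) (c t, c' t)"
        using G P t by (intro continuous_on_interior[OF G]) (auto simp: interior_open open_Times)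
      ultimately have "(\<lambda>m. G (w m t) (w' m t)) \<longlonglongrightarrow> G (c t) (c' t)"
        using isCont_tendsto_compose by fastforce
      from LIMSEQ_ignore_initial_segment[OF this, of m0] show ?thesis using False by simp
    qed simp
  qed auto
  moreover have "integral {0..1} (\<lambda>t. if t \<in> N then 0 else G (w (m + m0) t) (w' (m + m0) t)) =
      integral {0..1} (\<lambda>t. G (w (m + m0) t) (w' (m + m0) t))" for m
    by (rule integral_spike[of N]) (use N in \<open>auto simp: negligible_finite\<close>)
  moreover have "integral {0..1} (\<lambda>t. if t \<in> N then 0 else G (c t) (c' t)) =
      integral {0..1} (\<lambda>t. G (c t) (c' t))"
    by (rule integral_spike[of N]) (use N in \<open>auto simp: negligible_finite\<close>)
  ultimately have "(\<lambda>m. integral {0..1} (\<lambda>t. G (w (m + m0) t) (w' (m + m0) t)))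
      \<longlonglongrightarrow> integral {0..1} (\<lambda>t. G (c t) (c' t))" by simp
  then have "\<forall>\<^sub>F m in sequentially. integral {0..1} (\<lambda>t. G (w (m + m0) t) (w' (m + m0) t)) <
      integral {0..1} (\<lambda>t. G (c t) (c' t)) + \<epsilon>"
    using \<epsilon> by (intro order_tendstoD(2)) auto
  then obtain m where m: "integral {0..1} (\<lambda>t. G (w (m + m0) t) (w' (m + m0) t)) <
      integral {0..1} (\<lambda>t. G (c t) (c' t)) + \<epsilon>"
    by (auto simp: eventually_sequentially)
  show ?thesis
  proof (rule exI[of _ "w (m + m0)"], rule exI[of _ "w' (m + m0)"], intro conjI ballI)
    show "w (m + m0) 0 = c 0" by (simp add: w_def)
    show "w (m + m0) 1 = c 1" by (simp add: w_def d_def)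
  qed (use C1 m Jw wK \<open>K \<subseteq> P\<close> in \<open>auto simp: subset_iff\<close>)
qed

text \<open>Adding \<open>\<delta>\<close> to the speed before reparametrising keeps the new parameter a \<open>C\<^sup>1\<close> diffeomorphism.\<close>

lemma constant_speed_reparametrisation:
  fixes w w' :: "real \<Rightarrow> 'b::real_normed_vector" and G :: "'b \<Rightarrow> 'b \<Rightarrow> real"
  assumes w: "C1_curve w w'" and G: "continuous_on {0..1} (\<lambda>t. G (w t) (w' t))"
    and G0: "\<And>t. t \<in> {0..1} \<Longrightarrow> 0 \<le> G (w t) (w' t)" and hom: "\<And>p v k. G p (k *\<^sub>R v) = k\<^sup>2 * G p v"
    and \<delta>: "\<delta> > 0"
  defines "l \<equiv> integral {0..1} (\<lambda>t. sqrt (G (w t) (w' t)))"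
  shows "\<exists>\<theta> \<theta>'. C1_curve (w \<circ> \<theta>) (\<lambda>t. \<theta>' t *\<^sub>R w' (\<theta> t)) \<and> (\<forall>t\<in>{0..1}. \<theta> t \<in> {0..1}) \<and>
    \<theta> 0 = 0 \<and> \<theta> 1 = 1 \<and>
    (\<forall>t\<in>{0..1}. G (w (\<theta> t)) (\<theta>' t *\<^sub>R w' (\<theta> t)) \<le> (l + \<delta>)\<^sup>2)"
proof -
  have l0: "l \<ge> 0"
    unfolding l_def by (intro integral_nonneg integrable_continuous_real continuous_intros G) (auto simp: G0)
  \<comment> \<open>Clamping extends the speed to the whole line, so the new parameter lives on
    [-1, 2] and the inverse function rule also applies at the points 0 and 1.\<close>
  define cl where "cl = (\<lambda>s::real. max 0 (min 1 s))"
  have cl: "cl s \<in> {0..1}" "s \<in> {0..1} \<Longrightarrow> cl s = s" for s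
    by (auto simp: cl_def)
  \<comment> \<open>Normalised to have integral 1 over the unit interval, which gives
    \<open>\<sigma> 1 = 1\<close>; the summand \<delta> makes it strictly positive.\<close>
  define q where "q = (\<lambda>s. (sqrt (G (w (cl s)) (w' (cl s))) + \<delta>) / (l + \<delta>))"
  have q_cont: "continuous_on S q" for S
  proof -
    have "continuous_on S (\<lambda>s. G (w (cl s)) (w' (cl s)))"
      by (rule continuous_on_compose2[OF G]) (use cl in \<open>auto simp: cl_def intro!: continuous_intros\<close>)
    then show ?thesis
      unfolding q_def using l0 \<delta> by (intro continuous_intros) auto
  qed
  have q_pos: "q s > 0" for s
    using G0[OF cl(1)[of s]] l0 \<delta> by (auto simp: q_def intro!: divide_pos_pos add_nonneg_pos)
  define \<sigma> where "\<sigma> = (\<lambda>t. integral {-1..t} q - integral {-1..0} q)"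
  have \<sigma>_der: "(\<sigma> has_vector_derivative q t) (at t within {-1..2})" if "t \<in> {-1..2}" for t
    unfolding \<sigma>_def using integral_has_vector_derivative[OF q_cont that]
    by (auto intro!: derivative_eq_intros)
  have int: "at t within {-1..2} = at t" if "-1 < t" "t < 2" for t :: real
    by (rule at_within_interior) (use that in simp)
  have \<sigma>_cont: "continuous_on {-1..2} \<sigma>"
    unfolding continuous_on_eq_continuous_within using \<sigma>_der by (meson has_vector_derivative_continuous)
  have \<sigma>_less: "\<sigma> s < \<sigma> t" if "-1 \<le> s" "s < t" "t \<le> 2" for s t
  proof (rule DERIV_pos_imp_increasing_open[OF that(2)])
    fix x assume x: "s < x" "x < t"
    then have "(\<sigma> has_vector_derivative q x) (at x)"
      using \<sigma>_der[of x] int[of x] that by auto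
    then show "\<exists>y. DERIV \<sigma> x :> y \<and> 0 < y"
      using q_pos by (auto simp: has_real_derivative_iff_has_vector_derivative)
  qed (use continuous_on_subset[OF \<sigma>_cont] that in auto)
  have \<sigma>_inj: "inj_on \<sigma> {-1..2}"
    by (rule inj_onI) (metis \<sigma>_less atLeastAtMost_iff less_irrefl linorder_neqE)
  have \<sigma>0: "\<sigma> 0 = 0" by (simp add: \<sigma>_def)
  have \<sigma>1: "\<sigma> 1 = 1"
  proof -
    have "integral {-1..1} q = integral {-1..0} q + integral {0..1} q"
      by (rule Henstock_Kurzweil_Integration.integral_combine[symmetric]) (auto intro!: integrable_continuous_real q_cont)
    moreover have "integral {0..1} q = integral {0..1} (\<lambda>s. (sqrt (G (w s) (w' s)) + \<delta>) / (l + \<delta>))"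
      by (rule integral_cong) (simp add: q_def cl)
    moreover have "integral {0..1} (\<lambda>s. (sqrt (G (w s) (w' s)) + \<delta>) / (l + \<delta>)) = (l + \<delta>) / (l + \<delta>)"
    proof -
      have "integral {0..1} (\<lambda>s. sqrt (G (w s) (w' s)) + \<delta>) = l + \<delta>"
        unfolding l_def by (subst integral_add) (auto intro!: integrable_continuous_real continuous_intros G)
      then show ?thesis by simp
    qed
    ultimately show ?thesis using l0 \<delta> by (simp add: \<sigma>_def)
  qed
  define \<theta> where "\<theta> = inv_into {-1..2} \<sigma>"
  have \<theta>\<sigma>: "\<theta> (\<sigma> t) = t" if "t \<in> {-1..2}" for t
    unfolding \<theta>_def using \<sigma>_inj that by (rule inv_into_f_f)
  have \<theta>_ex: "\<exists>t\<in>{0..1}. \<sigma> t = y \<and> \<theta> y = t" if "y \<in> {0..1}" for y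
  proof -
    have "\<exists>t\<ge>0. t \<le> 1 \<and> \<sigma> t = y"
      using that \<sigma>0 \<sigma>1 continuous_on_subset[OF \<sigma>_cont, of "{0..1}"] by (intro IVT') auto
    then show ?thesis using \<theta>\<sigma> by auto
  qed
  then have \<theta>_in: "\<theta> y \<in> {0..1}" "\<sigma> (\<theta> y) = y" if "y \<in> {0..1}" for y
    using that by auto
  have \<theta>_der: "(\<theta> has_real_derivative inverse (q (\<theta> y))) (at y)" if y: "y \<in> {0..1}" for y
  proof -
    have t: "\<theta> y \<in> {0..1}" by (rule \<theta>_in[OF y])
    have "(\<sigma> has_vector_derivative q (\<theta> y)) (at (\<theta> y))"
      using \<sigma>_der[of "\<theta> y"] int[of "\<theta> y"] t by auto
    then have "(\<sigma> has_derivative (\<lambda>x. q (\<theta> y) * x)) (at (\<theta> y))"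
      by (simp add: has_vector_derivative_def mult.commute)
    moreover have "\<sigma> (\<theta> y) \<in> interior (\<sigma> ` {-1..2})"
    proof -
      have "{\<sigma> (-1)<..<\<sigma> 2} \<subseteq> \<sigma> ` {-1..2}"
      proof
        fix z assume "z \<in> {\<sigma> (-1)<..<\<sigma> 2}"
        then have "\<exists>t\<ge>-1. t \<le> 2 \<and> \<sigma> t = z"
          using \<sigma>_cont by (intro IVT') auto
        then show "z \<in> \<sigma> ` {-1..2}" by auto
      qed
      then have "{\<sigma> (-1)<..<\<sigma> 2} \<subseteq> interior (\<sigma> ` {-1..2})" by (rule interior_maximal) simp
      moreover have "\<sigma> (\<theta> y) \<in> {\<sigma> (-1)<..<\<sigma> 2}" using \<sigma>_less[of "-1" "\<theta> y"] \<sigma>_less[of "\<theta> y" 2] t by auto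
      ultimately show ?thesis by blast
    qed
    ultimately have "(\<theta> has_derivative (\<lambda>x. inverse (q (\<theta> y)) * x)) (at (\<sigma> (\<theta> y)))"
      using \<theta>\<sigma> \<sigma>_cont t q_pos[of "\<theta> y"]
      by (intro has_derivative_inverse[of "{-1..2}" "\<theta> y" \<sigma>]) (auto simp: fun_eq_iff bounded_linear_mult_right)
    then show ?thesis
      using \<theta>_in(2)[OF y] by (simp add: has_field_derivative_def)
  qed
  define \<theta>' where "\<theta>' = (\<lambda>y. inverse (q (\<theta> y)))"
  have \<theta>_cont: "continuous_on {0..1} \<theta>"
    using \<theta>_der by (meson DERIV_continuous continuous_at_imp_continuous_on)
  have "C1_curve (w \<circ> \<theta>) (\<lambda>t. \<theta>' t *\<^sub>R w' (\<theta> t))"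
    unfolding C1_curve_def
  proof
    have w'_cont: "continuous_on {0..1} w'" using w by (simp add: C1_curve_def)
    have "continuous_on {0..1} (\<lambda>t. w' (\<theta> t))"
      by (rule continuous_on_compose2[OF w'_cont \<theta>_cont]) (use \<theta>_in in auto)
    moreover have "continuous_on {0..1} (\<lambda>t. q (\<theta> t))"
      by (rule continuous_on_compose2[OF q_cont[of UNIV] \<theta>_cont]) auto
    then have "continuous_on {0..1} \<theta>'"
      unfolding \<theta>'_def using q_pos by (intro continuous_on_inverse) (auto simp: less_imp_neq[symmetric])
    ultimately show "continuous_on {0..1} (\<lambda>t. \<theta>' t *\<^sub>R w' (\<theta> t))" by (intro continuous_intros)
    show "\<forall>t\<in>{0..1}. (w \<circ> \<theta> has_vector_derivative \<theta>' t *\<^sub>R w' (\<theta> t)) (at t within {0..1})"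
    proof
      fix t :: real assume t: "t \<in> {0..1}"
      have "(\<theta> has_vector_derivative \<theta>' t) (at t within {0..1})"
        using \<theta>_der[OF t] unfolding \<theta>'_def has_real_derivative_iff_has_vector_derivative
        by (rule has_vector_derivative_at_within)
      moreover have "(w has_vector_derivative w' (\<theta> t)) (at (\<theta> t) within \<theta> ` {0..1})"
        using w \<theta>_in[OF t] unfolding C1_curve_def
        by (auto intro: has_vector_derivative_within_subset[of _ _ _ "{0..1}"] dest: \<theta>_in)
      ultimately show "(w \<circ> \<theta> has_vector_derivative \<theta>' t *\<^sub>R w' (\<theta> t)) (at t within {0..1})"
        by (rule vector_diff_chain_within)
    qed
  qed
  moreover have "G (w (\<theta> t)) (\<theta>' t *\<^sub>R w' (\<theta> t)) \<le> (l + \<delta>)\<^sup>2" if t: "t \<in> {0..1}" for t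
  proof -
    define g where "g = sqrt (G (w (\<theta> t)) (w' (\<theta> t)))"
    have g: "g \<ge> 0" "G (w (\<theta> t)) (w' (\<theta> t)) = g\<^sup>2"
      using G0[OF \<theta>_in(1)[OF t]] by (auto simp: g_def)
    \<comment> \<open>The new speed is (l + \<delta>) g / (g + \<delta>). Because of \<delta> it is
      not constant, but it never exceeds l + \<delta>.\<close>
    have "\<theta>' t = (l + \<delta>) / (g + \<delta>)"
      using cl(2)[OF \<theta>_in(1)[OF t]] by (simp add: \<theta>'_def q_def g_def)
    then have "G (w (\<theta> t)) (\<theta>' t *\<^sub>R w' (\<theta> t)) = (l + \<delta>)\<^sup>2 * (g / (g + \<delta>))\<^sup>2"
      by (simp add: hom g(2) power_divide)
    also have "\<dots> \<le> (l + \<delta>)\<^sup>2 * 1"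
      using g(1) \<delta> by (intro mult_left_mono power_le_one) auto
    finally show ?thesis by simp
  qed
  moreover have "\<theta> 0 = 0" "\<theta> 1 = 1"
    using \<theta>\<sigma>[of 0] \<theta>\<sigma>[of 1] \<sigma>0 \<sigma>1 by auto
  ultimately show ?thesis using \<theta>_in(1) by blast
qed

section \<open>Energy densities of curves of sections\<close>

lemma continuous_on_local:
  assumes "\<And>x. x \<in> S \<Longrightarrow> \<exists>U. open U \<and> x \<in> U \<and> continuous_on (S \<inter> U) f"
  shows "continuous_on S f"
  unfolding continuous_on_def
proof
  fix x assume x: "x \<in> S"
  then obtain U where U: "open U" "x \<in> U" "continuous_on (S \<inter> U) f" using assms by blast
  have "at x within (S \<inter> U) = at x within S"
    by (rule at_within_nhd[OF U(2,1)]) auto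
  moreover have "(f \<longlongrightarrow> f x) (at x within (S \<inter> U))"
    using U x by (auto simp: continuous_on_def)
  ultimately show "(f \<longlongrightarrow> f x) (at x within S)" by simp
qed

lemma atin_top_of_set: "a \<in> S \<Longrightarrow> atin (top_of_set S) a = at a within S"
  by (simp add: atin_subtopology_within filter_eq_iff eventually_atin_within eventually_at_topological) blast

lemma continuous_map_top_of_set_iff:
  "continuous_map (top_of_set S) Y f \<longleftrightarrow> (\<forall>t\<in>S. limitin Y f (f t) (at t within S))"
  by (simp add: continuous_map_atin atin_top_of_set)

locale metric_bundle = hermitian_bundle n A E
  for n :: nat and A :: "'m::{t2_space, second_countable_topology} chart set"
    and E :: "('m, 'e, 'r::finite) vbundle" +
  fixes \<alpha> :: "'m \<Rightarrow> real"
  assumes \<alpha>_cont: "continuous_on UNIV \<alpha>" and \<alpha>_bound: "\<alpha> x > - 1 / real CARD('r)"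
begin

lemma fibre_metric_nonneg':
  assumes "h \<in> Herm_pos E x" "v \<in> Herm E x"
  shows "0 \<le> fibre_metric E \<alpha> x h v v"
  by (rule triv_at[of x]) (rule fibre_metric_nonneg[OF _ assms \<alpha>_bound])

text \<open>The fibre itself varies with z. Where X z stays in one trivialisation, the metric is the
  matrix expression, whose continuity is known.\<close>

lemma continuous_on_fibre_metric:
  fixes X :: "'z::topological_space \<Rightarrow> 'm"
  assumes X: "continuous_on S X"
    and h: "\<And>z. z \<in> S \<Longrightarrow> h z \<in> Herm_pos E (X z)" and v: "\<And>z. z \<in> S \<Longrightarrow> v z \<in> Herm E (X z)"
    and hc: "\<And>V \<Phi> i j. (V, \<Phi>) \<in> trivs E \<Longrightarrow>
      continuous_on {z \<in> S. X z \<in> V} (\<lambda>z. h z (frame E \<Phi> (X z) i) (frame E \<Phi> (X z) j))"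
    and vc: "\<And>V \<Phi> i j. (V, \<Phi>) \<in> trivs E \<Longrightarrow>
      continuous_on {z \<in> S. X z \<in> V} (\<lambda>z. v z (frame E \<Phi> (X z) i) (frame E \<Phi> (X z) j))"
  shows "continuous_on S (\<lambda>z. fibre_metric E \<alpha> (X z) (h z) (v z) (v z))"
proof (rule continuous_on_local)
  fix z0 assume z0: "z0 \<in> S"
  obtain V \<Phi> where V: "(V, \<Phi>) \<in> trivs E" "X z0 \<in> V" by (rule triv_at)
  obtain U where U: "open U" "U \<inter> S = X -` V \<inter> S"
    using X triv_open[OF V(1)] by (auto simp: continuous_on_open_invariant)
  then have eq: "S \<inter> U = {z \<in> S. X z \<in> V}" by auto
  have "continuous_on (S \<inter> U) (\<lambda>z. form_mat E \<Phi> (X z) (h z))"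
    "continuous_on (S \<inter> U) (\<lambda>z. form_mat E \<Phi> (X z) (v z))"
    unfolding eq form_mat_def by (intro continuous_on_vec_lambda hc vc V(1))+
  moreover have "continuous_on (S \<inter> U) (\<lambda>z. \<alpha> (X z))"
    by (rule continuous_on_compose2[OF \<alpha>_cont]) (use continuous_on_subset[OF X] in auto)
  moreover have iso: "fibre_frame E (X z) \<Phi>" if "z \<in> S \<inter> U" for z
    using triv_iso[OF V(1)] that eq by (auto intro!: fibre_frame.intro)
  then have "form_mat E \<Phi> (X z) (h z) \<in> posdef" if "z \<in> S \<inter> U" for z
    using fibre_frame.Herm_pos_iff[OF iso[OF that]] h that by auto
  ultimately have "continuous_on (S \<inter> U) (\<lambda>z. mat_metric (\<alpha> (X z)) (form_mat E \<Phi> (X z) (h z)) (form_mat E \<Phi> (X z) (v z)))"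
    by (intro continuous_on_mat_metric)
  then have "continuous_on (S \<inter> U) (\<lambda>z. fibre_metric E \<alpha> (X z) (h z) (v z) (v z))"
    by (rule continuous_on_eq) (use fibre_frame.fibre_metric_eq[OF iso] h v in auto)
  moreover have "z0 \<in> U" using z0 V eq by auto
  ultimately show "\<exists>U. open U \<and> z0 \<in> U \<and> continuous_on (S \<inter> U) (\<lambda>z. fibre_metric E \<alpha> (X z) (h z) (v z) (v z))"
    using U(1) by blast
qed

text \<open>Continuity in t of the coefficients, uniformly on compact sets of x and without
  derivatives. It follows from continuity into \<open>CT\<close> as well as from the existence of
  velocities, and it suffices for joint continuity in (t, x).\<close>

definition ucurve :: "real set \<Rightarrow> (real \<Rightarrow> 'm \<Rightarrow> 'e form) \<Rightarrow> bool"
  where "ucurve S q \<longleftrightarrow> (\<forall>t\<in>S. q t \<in> SS) \<and>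
    (\<forall>t\<in>S. \<forall>U \<phi> V \<Phi> K i j \<epsilon>. (U, \<phi>) \<in> A \<longrightarrow> (V, \<Phi>) \<in> trivs E \<longrightarrow> K \<subseteq> U \<inter> V \<longrightarrow> compact K \<longrightarrow>
      (0::real) < \<epsilon> \<longrightarrow> (\<forall>\<^sub>F s in at t within S. \<forall>x\<in>K.
         norm (coefficient E \<Phi> i j (q s) x - coefficient E \<Phi> i j (q t) x) < \<epsilon>))"

lemma ucurve_continuous_map:
  assumes "continuous_map (top_of_set S) CT q"
  shows "ucurve S q"
proof -
  have "limitin CT q (q t) (at t within S)" if "t \<in> S" for t
    using assms that by (simp add: continuous_map_top_of_set_iff)
  moreover from this have "q t \<in> SS" if "t \<in> S" for t
    using that by (auto simp: limitin_def topspace_CT)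
  ultimately show ?thesis
    unfolding ucurve_def using limitin_CT_uniform by blast
qed

lemma coefficient_bounded:
  assumes "s \<in> SS" "(V, \<Phi>) \<in> trivs E" "K \<subseteq> V" "compact K"
  obtains M where "M \<ge> 0" "\<And>x. x \<in> K \<Longrightarrow> norm (coefficient E \<Phi> i j s x) \<le> M"
proof -
  have "continuous_on K (coefficient E \<Phi> i j s)"
    using smooth_fun_continuous_on[OF SS_smooth[OF assms(1,2)] triv_open[OF assms(2)]] assms(3)
    by (rule continuous_on_subset)
  then have "bounded (coefficient E \<Phi> i j s ` K)"
    using assms(4) compact_imp_bounded compact_continuous_image by blast
  then obtain M where "\<And>x. x \<in> K \<Longrightarrow> norm (coefficient E \<Phi> i j s x) \<le> M"
    by (auto simp: bounded_iff)
  then show ?thesis using that[of "max M 0"] by (auto simp: le_max_iff_disj)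
qed

text \<open>Near t the coefficients of the difference quotients stay within 1 of those of
  \<open>v t\<close>, which are bounded by M on K, so the increments are at most |s - t| (M +
  1).\<close>

lemma ucurve_velocity:
  assumes SS: "\<And>t. t \<in> S \<Longrightarrow> \<gamma> t \<in> SS" and v: "\<And>t. t \<in> S \<Longrightarrow> has_velocity CT \<gamma> (v t) t S"
  shows "ucurve S \<gamma>"
  unfolding ucurve_def
proof (intro conjI ballI allI impI)
  fix t U \<phi> V \<Phi> K i j and \<epsilon> :: real
  assume a: "t \<in> S" "(U, \<phi>) \<in> A" "(V, \<Phi>) \<in> trivs E" "K \<subseteq> U \<inter> V" "compact K" "0 < \<epsilon>"
  let ?c = "coefficient E \<Phi> i j"
  have lim: "limitin CT (\<lambda>s. (\<gamma> s - \<gamma> t) /\<^sub>R (s - t)) (v t) (at t within S)"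
    using v[OF a(1)] by (simp add: has_velocity_def)
  then have vt: "v t \<in> SS" by (simp add: limitin_def topspace_CT)
  obtain M where M: "M \<ge> 0" "\<And>x. x \<in> K \<Longrightarrow> norm (?c (v t) x) \<le> M"
    using coefficient_bounded[OF vt a(3) _ a(5)] a(4) by blast
  have "\<forall>\<^sub>F s in at t within S. \<forall>x\<in>K. norm (?c ((\<gamma> s - \<gamma> t) /\<^sub>R (s - t)) x - ?c (v t) x) < 1"
    by (rule limitin_CT_uniform[OF lim a(3,2,4,5)]) simp
  moreover have "((\<lambda>s. \<bar>s - t\<bar> * (M + 1)) \<longlongrightarrow> \<bar>t - t\<bar> * (M + 1)) (at t within S)"
    by (intro tendsto_intros)
  then have "\<forall>\<^sub>F s in at t within S. \<bar>s - t\<bar> * (M + 1) < \<epsilon>"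
    using a(6) by (intro order_tendstoD(2)) auto
  moreover have "\<forall>\<^sub>F s in at t within S. s \<noteq> t"
    by (simp add: eventually_at_filter)
  ultimately show "\<forall>\<^sub>F s in at t within S. \<forall>x\<in>K. norm (?c (\<gamma> s) x - ?c (\<gamma> t) x) < \<epsilon>"
  proof eventually_elim
    case (elim s)
    show ?case
    proof
      fix x assume x: "x \<in> K"
      let ?q = "(\<gamma> s - \<gamma> t) /\<^sub>R (s - t)"
      have "norm (?c ?q x - ?c (v t) x) < 1" using elim(1) x by blast
      then have "norm (?c ?q x) \<le> M + 1"
        using M(2)[OF x] norm_triangle_ineq2[of "?c ?q x" "?c (v t) x"] by linarith
      moreover have "?c (\<gamma> s) x - ?c (\<gamma> t) x = (s - t) *\<^sub>R ?c ?q x"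
        using elim(3) by (simp add: coefficient_scaleR coefficient_diff)
      ultimately have "norm (?c (\<gamma> s) x - ?c (\<gamma> t) x) \<le> \<bar>s - t\<bar> * (M + 1)"
        by (simp add: mult_left_mono)
      then show "norm (?c (\<gamma> s) x - ?c (\<gamma> t) x) < \<epsilon>" using elim(2) by linarith
    qed
  qed
qed (rule SS)

text \<open>Uniformity over a compact neighbourhood of x0 accounts for the change of t, and
  continuity of the single section at time t0 for the change of x.\<close>

lemma ucurve_joint:
  assumes q: "ucurve S q" and V: "(V, \<Phi>) \<in> trivs E"
  shows "continuous_on (S \<times> V) (\<lambda>z. coefficient E \<Phi> i j (q (fst z)) (snd z))"
  unfolding continuous_on_def
proof
  let ?c = "coefficient E \<Phi> i j"
  fix z0 assume "z0 \<in> S \<times> V"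
  then obtain t0 x0 where z0: "z0 = (t0, x0)" "t0 \<in> S" "x0 \<in> V" by auto
  obtain U \<phi> where U: "(U, \<phi>) \<in> A" "x0 \<in> U" by (rule chart_at)
  obtain N C where NC: "open N" "closed C" "x0 \<in> N" "N \<subseteq> C" "C \<subseteq> U \<inter> V"
    by (rule closed_nbhd[of "U \<inter> V" x0]) (use z0 U chart_open[OF U(1)] triv_open[OF V] in auto)
  have C: "compact C" using NC(2) compact_UNIV closed_Int_compact[of C UNIV] by simp
  have "continuous_on V (?c (q t0))"
  proof (rule smooth_fun_continuous_on[OF SS_smooth[OF _ V] triv_open[OF V]])
    show "q t0 \<in> SS" using q z0(2) unfolding ucurve_def by blast
  qed
  then have c0: "isCont (?c (q t0)) x0"
    using continuous_on_eq_continuous_at[OF triv_open[OF V]] z0(3) by blast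
  show "((\<lambda>z. ?c (q (fst z)) (snd z)) \<longlongrightarrow> ?c (q (fst z0)) (snd z0)) (at z0 within S \<times> V)"
    unfolding tendsto_iff
  proof (intro allI impI)
    fix e :: real assume e: "e > 0"
    then have e2: "0 < e / 2" by simp
    have "\<forall>\<^sub>F s in at t0 within S. \<forall>x\<in>C. norm (?c (q s) x - ?c (q t0) x) < e / 2"
      using q z0(2) U(1) V NC(5) C e2 unfolding ucurve_def by blast
    then obtain O1 where O1: "open O1" "t0 \<in> O1"
      "\<And>s. s \<in> O1 \<Longrightarrow> s \<noteq> t0 \<Longrightarrow> s \<in> S \<Longrightarrow> \<forall>x\<in>C. norm (?c (q s) x - ?c (q t0) x) < e / 2"
      unfolding eventually_at_topological by blast
    have "(?c (q t0) \<longlongrightarrow> ?c (q t0) x0) (nhds x0)"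
      using c0 unfolding isCont_def tendsto_at_iff_tendsto_nhds .
    then have "\<forall>\<^sub>F x in nhds x0. dist (?c (q t0) x) (?c (q t0) x0) < e / 2"
      using e2 by (rule tendstoD)
    then obtain O2 where O2: "open O2" "x0 \<in> O2" "\<And>x. x \<in> O2 \<Longrightarrow> dist (?c (q t0) x) (?c (q t0) x0) < e / 2"
      unfolding eventually_nhds by blast
    show "\<forall>\<^sub>F z in at z0 within S \<times> V. dist (?c (q (fst z)) (snd z)) (?c (q (fst z0)) (snd z0)) < e"
      unfolding eventually_at_topological
    proof (intro exI[of _ "O1 \<times> (O2 \<inter> N)"] conjI ballI impI)
      show "open (O1 \<times> (O2 \<inter> N))" using O1 O2 NC by (intro open_Times) auto
      show "z0 \<in> O1 \<times> (O2 \<inter> N)" using O1 O2 NC z0 by auto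
      fix z assume z: "z \<in> O1 \<times> (O2 \<inter> N)" "z \<in> S \<times> V"
      then obtain s x where sx: "z = (s, x)" "s \<in> O1" "x \<in> O2" "x \<in> C" "s \<in> S"
        using NC by auto
      have "norm (?c (q s) x - ?c (q t0) x) < e / 2"
        using O1(3)[of s] sx e2 by (cases "s = t0") auto
      moreover have "norm (?c (q t0) x - ?c (q t0) x0) < e / 2"
        using O2(3) sx by (simp add: dist_norm)
      ultimately have "norm ((?c (q s) x - ?c (q t0) x) + (?c (q t0) x - ?c (q t0) x0)) < e"
        using norm_triangle_ineq[of "?c (q s) x - ?c (q t0) x" "?c (q t0) x - ?c (q t0) x0"] by linarith
      then show "dist (?c (q (fst z)) (snd z)) (?c (q (fst z0)) (snd z0)) < e"
        by (simp add: sx z0 dist_norm)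
    qed
  qed
qed

lemma density_continuous:
  assumes h: "ucurve S h" and v: "ucurve S v" and pos: "\<And>t x. t \<in> S \<Longrightarrow> h t x \<in> Herm_pos E x"
  shows "continuous_on (S \<times> UNIV)
    (\<lambda>z. fibre_metric E \<alpha> (snd z) (h (fst z) (snd z)) (v (fst z) (snd z)) (v (fst z) (snd z)))"
proof (rule continuous_on_fibre_metric)
  have eq: "{z \<in> S \<times> UNIV. snd z \<in> V} = S \<times> V" for V :: "'m set" by auto
  show "continuous_on {z \<in> S \<times> UNIV. snd z \<in> V}
      (\<lambda>z. h (fst z) (snd z) (frame E \<Phi> (snd z) i) (frame E \<Phi> (snd z) j))"
    "continuous_on {z \<in> S \<times> UNIV. snd z \<in> V}
      (\<lambda>z. v (fst z) (snd z) (frame E \<Phi> (snd z) i) (frame E \<Phi> (snd z) j))"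
    if "(V, \<Phi>) \<in> trivs E" for V \<Phi> i j
    using ucurve_joint[OF h that, of i j] ucurve_joint[OF v that, of i j] unfolding eq
    by (simp_all add: coefficient_def)
qed (use pos v in \<open>auto simp: ucurve_def SS_iff intro: continuous_on_snd continuous_on_id\<close>)

section \<open>Restriction of paths of sections to the fibres\<close>

lemma has_velocity_eval:
  assumes "has_velocity CT \<gamma> v t S"
  shows "has_velocity (fibre_top E x) (\<lambda>t. \<gamma> t x) (v x) t S"
  using limitin_CT_eval[OF assms[unfolded has_velocity_def], of x]
  by (simp add: has_velocity_def scaleR_fun_def)

text \<open>Uniqueness is tested pointwise: velocities in \<open>CT\<close> evaluate to velocities
  in the fibres, where limits are unique.\<close>

lemma velocity_CT:
  assumes "has_velocity CT \<gamma> v t {0..1}" "t \<in> {0..1}"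
  shows "velocity CT \<gamma> t = v"
proof (rule velocity_eq[OF assms(1)])
  fix w assume "has_velocity CT \<gamma> w t {0..1}"
  then show "w = v"
    using has_velocity_fibre_unique[OF has_velocity_eval[OF assms(1)] has_velocity_eval[of \<gamma> w] assms(2)] by auto
qed

lemma C1_path_on_eval:
  assumes "C1_path_on CT a b \<gamma>"
  shows "C1_path_on (fibre_top E x) a b (\<lambda>t. \<gamma> t x)"
proof -
  obtain \<gamma>' where "\<forall>t\<in>{a..b}. has_velocity CT \<gamma> (\<gamma>' t) t {a..b}"
    "\<forall>t\<in>{a..b}. limitin CT \<gamma>' (\<gamma>' t) (at t within {a..b})"
    using assms unfolding C1_path_on_def continuous_map_top_of_set_iff by blast
  then show ?thesis
    unfolding C1_path_on_def continuous_map_top_of_set_iff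
    by (intro exI[of _ "\<lambda>t. \<gamma>' t x"] conjI ballI has_velocity_eval limitin_CT_eval) auto
qed

lemma piecewise_C1_path_eval:
  "piecewise_C1_path CT \<gamma> \<Longrightarrow> piecewise_C1_path (fibre_top E x) (\<lambda>t. \<gamma> t x)"
  unfolding piecewise_C1_path_def using C1_path_on_eval by meson

definition density :: "(real \<Rightarrow> 'm \<Rightarrow> 'e form) \<Rightarrow> real \<Rightarrow> 'm \<Rightarrow> real"
  where "density \<gamma> t x = fibre_metric E \<alpha> x (\<gamma> t x) (velocity CT \<gamma> t x) (velocity CT \<gamma> t x)"

lemma path_length_L2:
  "path_length CT (L2_metric E \<alpha> \<mu>) \<gamma> = integral {0..1} (\<lambda>t. sqrt (\<integral>x. density \<gamma> t x \<partial>\<mu>))"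
  by (simp add: path_length_def L2_metric_def density_def)

text \<open>Collects everything that the integral inequalities require of a path, with the finitely
  many times at which the velocity may jump set aside in N.\<close>

lemma path_density:
  assumes \<gamma>: "piecewise_C1_path CT \<gamma>" and pos: "\<forall>t\<in>{0..1}. \<gamma> t \<in> SP"
  obtains N B where "finite N" "0 \<in> N" "1 \<in> N"
    "continuous_on (({0..1} - N) \<times> UNIV) (\<lambda>z. density \<gamma> (fst z) (snd z))"
    "\<And>t x. t \<in> {0..1} - N \<Longrightarrow> 0 \<le> density \<gamma> t x" "\<And>t x. t \<in> {0..1} - N \<Longrightarrow> density \<gamma> t x \<le> B"
    "\<And>x. fibre_dist E \<alpha> x (\<gamma> 0 x) (\<gamma> 1 x) \<le> integral {0..1} (\<lambda>t. sqrt (density \<gamma> t x))"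
proof -
  obtain k :: nat and \<tau> where \<tau>: "\<tau> 0 = 0" "\<tau> k = 1" "\<And>i. i < k \<Longrightarrow> \<tau> i < \<tau> (Suc i)"
    and C1: "\<And>i. i < k \<Longrightarrow> C1_path_on CT (\<tau> i) (\<tau> (Suc i)) \<gamma>"
    using \<gamma> unfolding piecewise_C1_path_def by blast
  let ?I = "\<lambda>i. {\<tau> i..\<tau> (Suc i)}"
  have "\<forall>i. \<exists>v. i < k \<longrightarrow> (\<forall>t\<in>?I i. has_velocity CT \<gamma> (v t) t (?I i)) \<and> continuous_map (top_of_set (?I i)) CT v"
    using C1 unfolding C1_path_on_def by blast
  then obtain v where v: "\<And>i t. i < k \<Longrightarrow> t \<in> ?I i \<Longrightarrow> has_velocity CT \<gamma> (v i t) t (?I i)"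
    "\<And>i. i < k \<Longrightarrow> continuous_map (top_of_set (?I i)) CT (v i)"
    by metis
  have I01: "?I i \<subseteq> {0..1}" if "i < k" for i
    using breakpoints_mono[of k \<tau> 0 i] breakpoints_mono[of k \<tau> "Suc i" k] that \<tau> by auto
  have posI: "\<gamma> t \<in> SS" "\<gamma> t x \<in> Herm_pos E x" if "t \<in> {0..1}" for t x
    using pos that by (auto simp: SP_iff)
  \<comment> \<open>Formed with the velocity \<open>v i\<close> of the closed piece, which is
    continuous up to both ends; compactness therefore bounds it although the density may jump at
    breakpoints.\<close>
  define F where "F = (\<lambda>i z. fibre_metric E \<alpha> (snd z) (\<gamma> (fst z) (snd z)) (v i (fst z) (snd z)) (v i (fst z) (snd z)))"
  have F: "continuous_on (?I i \<times> UNIV) (F i)" if "i < k" for i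
    unfolding F_def
  proof (rule density_continuous)
    show "ucurve (?I i) \<gamma>"
      by (rule ucurve_velocity[of _ _ "v i"]) (use posI I01[OF that] v(1)[OF that] in auto)
    show "ucurve (?I i) (v i)" by (rule ucurve_continuous_map[OF v(2)[OF that]])
  qed (use posI I01[OF that] in auto)
  have "\<forall>i. \<exists>M. i < k \<longrightarrow> (\<forall>z\<in>?I i \<times> UNIV. \<bar>F i z\<bar> \<le> M)"
  proof
    fix i
    have "compact (?I i \<times> (UNIV :: 'm set))" by (intro compact_Times compact_UNIV) simp
    then have "bounded (F i ` (?I i \<times> UNIV))" if "i < k"
      using F[OF that] compact_imp_bounded compact_continuous_image by blast
    then show "\<exists>M. i < k \<longrightarrow> (\<forall>z\<in>?I i \<times> UNIV. \<bar>F i z\<bar> \<le> M)"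
      unfolding bounded_iff by (metis imageI real_norm_def)
  qed
  then obtain M where M: "\<And>i z. i < k \<Longrightarrow> z \<in> ?I i \<times> UNIV \<Longrightarrow> \<bar>F i z\<bar> \<le> M i" by metis
  define N where "N = \<tau> ` {..k}"
  have vel: "velocity CT \<gamma> t = v i t" "has_velocity CT \<gamma> (v i t) t {0..1}"
    if "i < k" "\<tau> i < t" "t < \<tau> (Suc i)" for i t
  proof -
    show hv: "has_velocity CT \<gamma> (v i t) t {0..1}"
      by (rule piecewise_C1_velocity[OF \<tau> that v(1)]) (use that in auto)
    show "velocity CT \<gamma> t = v i t"
      by (rule velocity_CT[OF hv]) (use that I01[OF that(1)] in auto)
  qed
  have piece: "\<exists>i<k. \<tau> i < t \<and> t < \<tau> (Suc i)" if "t \<in> {0..1} - N" for t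
    using breakpoint_interval[of \<tau> t k] that \<tau>(1,2) by (auto simp: N_def)
  have dens: "density \<gamma> t x = F i (t, x)" if "i < k" "\<tau> i < t" "t < \<tau> (Suc i)" for i t x
    using vel[OF that] by (simp add: density_def F_def)
  have nn: "0 \<le> density \<gamma> t x" if t: "t \<in> {0..1} - N" for t x
  proof -
    obtain i where i: "i < k" "\<tau> i < t" "t < \<tau> (Suc i)" using piece[OF t] by blast
    have "velocity CT \<gamma> t x \<in> Herm E x"
      using has_velocity_in_Herm[OF has_velocity_eval[OF vel(2)[OF i]]] vel(1)[OF i] by simp
    then show ?thesis
      unfolding density_def using posI t by (intro fibre_metric_nonneg') auto
  qed
  show ?thesis
  proof (rule that[of N "\<Sum>i<k. \<bar>M i\<bar>"])
    show "finite N" by (simp add: N_def)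
    show "0 \<in> N" "1 \<in> N" using \<tau> by (force simp: N_def)+
    show "0 \<le> density \<gamma> t x" if "t \<in> {0..1} - N" for t x using that by (rule nn)
    show "density \<gamma> t x \<le> (\<Sum>i<k. \<bar>M i\<bar>)" if "t \<in> {0..1} - N" for t x
    proof -
      obtain i where i: "i < k" "\<tau> i < t" "t < \<tau> (Suc i)" using piece[OF \<open>t \<in> {0..1} - N\<close>] by blast
      have "density \<gamma> t x \<le> \<bar>M i\<bar>"
        using M[OF i(1), of "(t, x)"] dens[OF i] i by auto
      also have "\<dots> \<le> (\<Sum>i<k. \<bar>M i\<bar>)"
        using i by (intro member_le_sum) auto
      finally show ?thesis .
    qed
    show "continuous_on (({0..1} - N) \<times> UNIV) (\<lambda>z. density \<gamma> (fst z) (snd z))"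
    proof (rule continuous_on_local)
      fix z assume z: "z \<in> ({0..1} - N) \<times> (UNIV :: 'm set)"
      then have "fst z \<in> {0..1} - N" by auto
      then obtain i where i: "i < k" "\<tau> i < fst z" "fst z < \<tau> (Suc i)" using piece by blast
      let ?U = "{\<tau> i<..<\<tau> (Suc i)} \<times> (UNIV :: 'm set)"
      have "continuous_on ?U (F i)"
        by (rule continuous_on_subset[OF F[OF i(1)]]) auto
      then have "continuous_on ?U (\<lambda>z. density \<gamma> (fst z) (snd z))"
        by (rule continuous_on_eq) (use dens[OF i(1)] in auto)
      then have "continuous_on ((({0..1} - N) \<times> UNIV) \<inter> ?U) (\<lambda>z. density \<gamma> (fst z) (snd z))"
        by (rule continuous_on_subset) auto
      moreover have "open ?U" by (intro open_Times) auto
      moreover have "z \<in> ?U" using i by (cases z) auto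
      ultimately show "\<exists>U. open U \<and> z \<in> U \<and>
          continuous_on ((({0..1} - N) \<times> UNIV) \<inter> U) (\<lambda>z. density \<gamma> (fst z) (snd z))" by blast
    qed
    fix x
    obtain V \<Phi> where iso: "fibre_iso E x \<Phi>" by (rule triv_at)
    have "fibre_dist E \<alpha> x (\<gamma> 0 x) (\<gamma> 1 x) \<le> path_length (fibre_top E x) (fibre_metric E \<alpha> x) (\<lambda>t. \<gamma> t x)"
      using fibre_dist_le[OF iso \<alpha>_bound piecewise_C1_path_eval[OF \<gamma>]] posI by auto
    also have "\<dots> = integral {0..1} (\<lambda>t. sqrt (density \<gamma> t x))"
      unfolding density_def
    proof (rule path_length_eq[of N])
      show "finite N" by (simp add: N_def)
      fix t assume t: "t \<in> {0..1} - N"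
      obtain i where i: "i < k" "\<tau> i < t" "t < \<tau> (Suc i)" using piece[OF t] by blast
      show "velocity (fibre_top E x) (\<lambda>t. \<gamma> t x) t = velocity CT \<gamma> t x"
        using velocity_fibre[OF has_velocity_eval[OF vel(2)[OF i]]] vel(1)[OF i] t by simp
    qed
    finally show "fibre_dist E \<alpha> x (\<gamma> 0 x) (\<gamma> 1 x) \<le> integral {0..1} (\<lambda>t. sqrt (density \<gamma> t x))" .
  qed
qed

end

section \<open>Inequalities for integrals\<close>

abbreviation unit_leb :: "real measure"
  where "unit_leb \<equiv> restrict_space lborel {0..1}"

lemma finite_measure_unit_leb: "finite_measure unit_leb"
  by (intro finite_measureI) (simp add: emeasure_restrict_space space_restrict_space)

lemma measure_unit_leb: "Sigma_Algebra.measure unit_leb {0..1} = 1"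
  by (simp add: measure_restrict_space)

text \<open>Lengths are Henstock-Kurzweil integrals, whereas Fubini is applied to Bochner integrals;
  for bounded measurable functions both have the same value.\<close>

lemma integral_unit_leb:
  fixes f :: "real \<Rightarrow> real"
  assumes "f \<in> borel_measurable unit_leb" "\<And>t. t \<in> {0..1} \<Longrightarrow> \<bar>f t\<bar> \<le> C"
  shows "integral {0..1} f = (LINT t|unit_leb. f t)"
proof -
  interpret finite_measure unit_leb by (rule finite_measure_unit_leb)
  have "integrable unit_leb f"
    by (rule integrable_const_bound[of _ C]) (use assms in \<open>auto simp: space_restrict_space\<close>)
  then have "set_integrable lborel {0..1} f"
    by (subst (asm) integrable_restrict_space) (auto simp: set_integrable_def)
  then have "(LINT t:{0..1}|lborel. f t) = integral {0..1} f"
    by (rule set_borel_integral_eq_integral)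
  then show ?thesis
    by (subst integral_restrict_space) (auto simp: set_lebesgue_integral_def)
qed

text \<open>The discriminant argument for the nonnegative quadratic polynomial that integrates (f -
  l g)^2. Boundedness on a finite measure space makes all products integrable.\<close>

lemma Cauchy_Schwarz_bounded:
  fixes f g :: "'a \<Rightarrow> real"
  assumes M: "finite_measure M" and f: "f \<in> borel_measurable M" "\<And>x. x \<in> space M \<Longrightarrow> \<bar>f x\<bar> \<le> C"
    and g: "g \<in> borel_measurable M" "\<And>x. x \<in> space M \<Longrightarrow> \<bar>g x\<bar> \<le> C"
  shows "(\<integral>x. f x * g x \<partial>M) \<le> sqrt (\<integral>x. (f x)\<^sup>2 \<partial>M) * sqrt (\<integral>x. (g x)\<^sup>2 \<partial>M)"
proof -
  interpret finite_measure M by fact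
  have int: "integrable M (\<lambda>x. u x * v x)"
    if "u \<in> borel_measurable M" "\<And>x. x \<in> space M \<Longrightarrow> \<bar>u x\<bar> \<le> C"
      "v \<in> borel_measurable M" "\<And>x. x \<in> space M \<Longrightarrow> \<bar>v x\<bar> \<le> C" for u v :: "'a \<Rightarrow> real"
  proof (rule integrable_const_bound[of _ "C * C"])
    have "norm (u x * v x) \<le> C * C" if "x \<in> space M" for x
      unfolding real_norm_def abs_mult
      using \<open>\<And>x. x \<in> space M \<Longrightarrow> \<bar>u x\<bar> \<le> C\<close>[OF that] \<open>\<And>x. x \<in> space M \<Longrightarrow> \<bar>v x\<bar> \<le> C\<close>[OF that]
      by (intro mult_mono) auto
    then show "AE x in M. norm (u x * v x) \<le> C * C" by simp
  qed (use that in auto)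
  let ?a = "\<integral>x. f x * f x \<partial>M" and ?b = "\<integral>x. f x * g x \<partial>M" and ?c = "\<integral>x. g x * g x \<partial>M"
  have quad: "0 \<le> ?a - 2 * l * ?b + l\<^sup>2 * ?c" for l
  proof -
    have "0 \<le> (\<integral>x. (f x - l * g x)\<^sup>2 \<partial>M)" by simp
    also have "\<dots> = (\<integral>x. f x * f x - (2 * l) * (f x * g x) + l\<^sup>2 * (g x * g x) \<partial>M)"
      by (intro Bochner_Integration.integral_cong refl) (simp add: power2_eq_square algebra_simps)
    also have "\<dots> = ?a - 2 * l * ?b + l\<^sup>2 * ?c"
      using int[OF f f] int[OF f g] int[OF g g] by simp
    finally show ?thesis .
  qed
  have a0: "0 \<le> ?a" and c0: "0 \<le> ?c" by simp_all
  have "?b\<^sup>2 \<le> ?a * ?c"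
  proof (cases "?c = 0")
    case False
    then have c: "?c > 0" using c0 by (metis order_le_less)
    have "0 \<le> ?a - 2 * (?b / ?c) * ?b + (?b / ?c)\<^sup>2 * ?c" by (rule quad)
    also have "\<dots> = ?a - ?b\<^sup>2 / ?c" using c by (simp add: power2_eq_square field_simps)
    finally have "?b\<^sup>2 / ?c \<le> ?a" by simp
    then show ?thesis using c by (simp add: divide_le_eq)
  next
    case True
    have "?b = 0"
    proof (rule ccontr)
      assume b: "?b \<noteq> 0"
      \<comment> \<open>For \<open>?c = 0\<close> the polynomial is affine in l, and this l makes it
        equal to -1.\<close>
      have "2 * ((?a + 1) / (2 * ?b)) * ?b = ?a + 1" using b by simp
      with quad[of "(?a + 1) / (2 * ?b)"] have "0 \<le> ?a - (?a + 1)" by (simp only: True mult_zero_right add_0_right)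
      then show False by simp
    qed
    then show ?thesis by (simp only: True) simp
  qed
  then have "?b \<le> sqrt (?a * ?c)" by (rule real_le_rsqrt)
  then show ?thesis by (simp add: real_sqrt_mult power2_eq_square)
qed

text \<open>Continuity gives Borel measurability on the product space; second countability
  identifies its Borel sets with the product sigma algebra that Fubini uses.\<close>

lemma measurable_density:
  fixes F :: "real \<Rightarrow> 'm::second_countable_topology \<Rightarrow> real"
  assumes \<mu>: "sets \<mu> = sets borel" and S: "S \<in> sets borel"
    and F: "continuous_on (S \<times> UNIV) (\<lambda>z. F (fst z) (snd z))"
  shows "(\<lambda>z. indicator S (fst z) * F (fst z) (snd z)) \<in> borel_measurable (unit_leb \<Otimes>\<^sub>M \<mu>)"
proof -
  have bp: "(borel :: real measure) \<Otimes>\<^sub>M (borel :: 'm measure) = borel" by (rule borel_prod)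
  have "S \<times> UNIV \<in> sets (borel \<Otimes>\<^sub>M (borel :: 'm measure))"
    using S by (intro pair_measureI) auto
  then have "S \<times> UNIV \<in> sets (borel :: (real \<times> 'm) measure)" unfolding bp .
  from borel_measurable_continuous_on_indicator[OF this F]
  have m: "(\<lambda>z. indicator (S \<times> UNIV) z *\<^sub>R F (fst z) (snd z)) \<in> borel_measurable (borel \<Otimes>\<^sub>M (borel :: 'm measure))"
    by (simp add: bp)
  have "(\<lambda>z. z) \<in> (unit_leb \<Otimes>\<^sub>M \<mu>) \<rightarrow>\<^sub>M (borel \<Otimes>\<^sub>M (borel :: 'm measure))"
  proof -
    have "fst \<in> (unit_leb \<Otimes>\<^sub>M \<mu>) \<rightarrow>\<^sub>M borel"
      by (rule measurable_compose[OF measurable_fst]) (auto intro: measurable_restrict_space1)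
    moreover have "snd \<in> (unit_leb \<Otimes>\<^sub>M \<mu>) \<rightarrow>\<^sub>M (borel :: 'm measure)"
      using measurable_snd measurable_cong_sets[OF refl \<mu>] by blast
    ultimately have "(\<lambda>z. (fst z, snd z)) \<in> (unit_leb \<Otimes>\<^sub>M \<mu>) \<rightarrow>\<^sub>M (borel \<Otimes>\<^sub>M (borel :: 'm measure))"
      by (rule measurable_Pair)
    then show ?thesis by simp
  qed
  from measurable_compose[OF this m] show ?thesis
    by (simp add: indicator_times)
qed

text \<open>The first claim contains Minkowski's integral inequality, proved by duality with D
  itself as test function. The other two are the Cauchy-Schwarz inequality against the constant 1 on
  the unit interval, followed by Fubini in the case of \<open>integral_sqrt_le_sqrt\<close>.\<close>

lemma
  fixes F :: "real \<Rightarrow> 'm::second_countable_topology \<Rightarrow> real"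
  assumes \<mu>: "sets \<mu> = sets borel" "finite_measure \<mu>" and N: "finite N"
    and F: "continuous_on (({0..1} - N) \<times> UNIV) (\<lambda>z. F (fst z) (snd z))"
    and F0: "\<And>t x. t \<in> {0..1} - N \<Longrightarrow> 0 \<le> F t x" and FB: "\<And>t x. t \<in> {0..1} - N \<Longrightarrow> F t x \<le> B"
  shows L2_norm_integral_le: "\<And>D :: 'm \<Rightarrow> real. D \<in> borel_measurable borel \<Longrightarrow> (\<And>x. 0 \<le> D x) \<Longrightarrow>
      (\<And>x. D x \<le> integral {0..1} (\<lambda>t. sqrt (F t x))) \<Longrightarrow>
      sqrt (\<integral>x. (D x)\<^sup>2 \<partial>\<mu>) \<le> integral {0..1} (\<lambda>t. sqrt (\<integral>x. F t x \<partial>\<mu>))"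
    and integral_sqrt_le_sqrt: "integral {0..1} (\<lambda>t. sqrt (\<integral>x. F t x \<partial>\<mu>)) \<le> sqrt (\<integral>x. integral {0..1} (\<lambda>t. F t x) \<partial>\<mu>)"
    and sqrt_integral_le: "\<And>x. integral {0..1} (\<lambda>t. sqrt (F t x)) \<le> sqrt (integral {0..1} (\<lambda>t. F t x))"
proof -
  interpret u: finite_measure unit_leb by (rule finite_measure_unit_leb)
  interpret m: finite_measure \<mu> by fact
  interpret um: finite_measure "unit_leb \<Otimes>\<^sub>M \<mu>"
    by (rule finite_measure_pair_measure) unfold_locales
  interpret p: pair_sigma_finite unit_leb \<mu> by unfold_locales
  have sp: "space \<mu> = UNIV" using sets_eq_imp_space_eq[OF \<mu>(1)] by simp
  define S where "S = {0..1} - N"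
  \<comment> \<open>Setting F to 0 at the exceptional times makes bounds and measurability hold
    everywhere and alters no integral over time.\<close>
  define G where "G = (\<lambda>t x. indicator S t * F t x)"
  define b where "b = max B 0"
  have b: "b \<ge> 0" by (simp add: b_def)
  have "S \<in> sets borel"
    unfolding S_def using finite_imp_closed[OF N] by (intro sets.Diff) auto
  then have Gm: "(\<lambda>z. G (fst z) (snd z)) \<in> borel_measurable (unit_leb \<Otimes>\<^sub>M \<mu>)"
    unfolding G_def using measurable_density[OF \<mu>(1)] F by (simp add: S_def)
  have G: "0 \<le> G t x" "G t x \<le> b" "\<bar>G t x\<bar> \<le> b" for t x
    using F0[of t x] FB[of t x] by (auto simp: G_def S_def b_def indicator_def)
  have Gt: "(\<lambda>t. G t x) \<in> borel_measurable unit_leb" for x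
    using measurable_compose[OF measurable_Pair2'[of x \<mu> unit_leb] Gm] sp by simp
  have Gx: "(\<lambda>x. G t x) \<in> borel_measurable \<mu>" if "t \<in> {0..1}" for t
    using measurable_compose[OF measurable_Pair1'[of t unit_leb \<mu>] Gm] that by (simp add: space_restrict_space)
  have spike: "integral {0..1} (\<lambda>t. \<phi> (F t)) = integral {0..1} (\<lambda>t. \<phi> (G t))" for \<phi> :: "('m \<Rightarrow> real) \<Rightarrow> real"
  proof (rule integral_spike[of N])
    show "\<phi> (G t) = \<phi> (F t)" if "t \<in> {0..1} - N" for t
      using that by (simp add: G_def S_def)
  qed (use N in \<open>auto simp: negligible_finite\<close>)
  have sq: "sqrt (G t x) \<le> sqrt b" "\<bar>sqrt (G t x)\<bar> \<le> sqrt b" for t x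
    using G by auto
  have It: "integral {0..1} (\<lambda>t. F t x) = (LINT t|unit_leb. G t x)"
    "integral {0..1} (\<lambda>t. sqrt (F t x)) = (LINT t|unit_leb. sqrt (G t x))" for x
    using spike[of "\<lambda>f. f x"] spike[of "\<lambda>f. sqrt (f x)"] Gt[of x] G(3)[of _ x] sq(2)[of _ x]
    by (auto intro!: integral_unit_leb simp del: real_sqrt_abs)
  define L where "L = (\<lambda>t. \<integral>x. G t x \<partial>\<mu>)"
  have L0: "0 \<le> L t" for t
    unfolding L_def using G by simp
  have Lm: "L \<in> borel_measurable unit_leb"
    unfolding L_def using Gm m.borel_measurable_lebesgue_integral[of "\<lambda>t x. G t x" unit_leb] by (simp add: split_def)
  define c where "c = b * measure \<mu> (space \<mu>)"
  have Lc: "L t \<le> c" if "t \<in> {0..1}" for t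
  proof -
    have "L t \<le> (\<integral>x. b \<partial>\<mu>)"
      unfolding L_def using Gx[OF that] G
      by (intro integral_mono m.integrable_const_bound[of _ b]) (auto simp: b)
    then show ?thesis by (simp add: c_def mult.commute)
  qed
  have sL: "\<bar>sqrt (L t)\<bar> \<le> sqrt c" if "t \<in> {0..1}" for t
    using Lc[OF that] L0[of t] by simp
  have IL: "integral {0..1} (\<lambda>t. sqrt (\<integral>x. F t x \<partial>\<mu>)) = (LINT t|unit_leb. sqrt (L t))"
    using spike[of "\<lambda>f. sqrt (\<integral>x. f x \<partial>\<mu>)"] integral_unit_leb[of "\<lambda>t. sqrt (L t)" "sqrt c"] Lm sL
    by (simp add: L_def)
  have intG: "integrable (unit_leb \<Otimes>\<^sub>M \<mu>) (\<lambda>(t, x). G t x)"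
    using Gm G by (intro um.integrable_const_bound[of _ b]) (auto simp: split_def)
  have one: "(LINT t|unit_leb. sqrt (f t)) \<le> sqrt (LINT t|unit_leb. f t)"
    if f: "f \<in> borel_measurable unit_leb" "\<And>t. t \<in> {0..1} \<Longrightarrow> 0 \<le> f t" "\<And>t. t \<in> {0..1} \<Longrightarrow> f t \<le> C" for f C
  proof -
    have "sqrt (f t) \<le> max 1 (sqrt C)" if "t \<in> {0..1}" for t
      using f(3)[OF that] real_sqrt_le_mono[of "f t" C] by (simp add: le_max_iff_disj)
    then have "(LINT t|unit_leb. 1 * sqrt (f t)) \<le> sqrt (LINT t|unit_leb. 1\<^sup>2) * sqrt (LINT t|unit_leb. (sqrt (f t))\<^sup>2)"
      using f by (intro Cauchy_Schwarz_bounded[OF finite_measure_unit_leb, of _ "max 1 (sqrt C)"])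
        (auto simp: space_restrict_space)
    also have "(LINT t|unit_leb. (sqrt (f t))\<^sup>2) = (LINT t|unit_leb. f t)"
      using f by (intro Bochner_Integration.integral_cong) (auto simp: space_restrict_space)
    finally show ?thesis by (simp add: measure_unit_leb)
  qed
  show "integral {0..1} (\<lambda>t. sqrt (F t x)) \<le> sqrt (integral {0..1} (\<lambda>t. F t x))" for x
    unfolding It using Gt G by (intro one[of _ b])
  have "integral {0..1} (\<lambda>t. sqrt (\<integral>x. F t x \<partial>\<mu>)) \<le> sqrt (LINT t|unit_leb. L t)"
    unfolding IL using Lm L0 Lc by (intro one[of _ c])
  also have "(LINT t|unit_leb. L t) = (\<integral>x. (LINT t|unit_leb. G t x) \<partial>\<mu>)"
    unfolding L_def by (rule p.Fubini_integral[OF intG, symmetric])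
  finally show "integral {0..1} (\<lambda>t. sqrt (\<integral>x. F t x \<partial>\<mu>)) \<le> sqrt (\<integral>x. integral {0..1} (\<lambda>t. F t x) \<partial>\<mu>)"
    by (simp add: It)
  fix D :: "'m \<Rightarrow> real"
  assume Dm: "D \<in> borel_measurable borel" and D0: "\<And>x. 0 \<le> D x"
    and D: "\<And>x. D x \<le> integral {0..1} (\<lambda>t. sqrt (F t x))"
  have Dm': "D \<in> borel_measurable \<mu>" using Dm measurable_cong_sets[OF \<mu>(1) refl] by blast
  have sG_int: "integrable unit_leb (\<lambda>t. sqrt (G t x))" for x
    using Gt sq by (intro u.integrable_const_bound[of _ "sqrt b"]) auto
  have DB: "D x \<le> sqrt b" for x
  proof -
    have "D x \<le> (LINT t|unit_leb. sqrt (G t x))" using D[of x] by (simp add: It)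
    also have "\<dots> \<le> (LINT t|unit_leb. sqrt b)"
      using sG_int sq by (intro integral_mono) auto
    also have "\<dots> = sqrt b" by (simp add: measure_unit_leb)
    finally show ?thesis .
  qed
  define R where "R = sqrt (\<integral>x. (D x)\<^sup>2 \<partial>\<mu>)"
  have R0: "R \<ge> 0" by (simp add: R_def)
  have Dabs: "\<bar>D x\<bar> \<le> sqrt b" for x using DB[of x] D0[of x] by simp
  have DGm: "(\<lambda>z. D (snd z) * sqrt (G (fst z) (snd z))) \<in> borel_measurable (unit_leb \<Otimes>\<^sub>M \<mu>)"
    using Gm measurable_compose[OF measurable_snd Dm'] by (intro borel_measurable_times) auto
  have DGb: "\<bar>D x * sqrt (G t x)\<bar> \<le> sqrt b * sqrt b" for t x
    unfolding abs_mult by (intro mult_mono Dabs sq) (use b in auto)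
  have intDG: "integrable (unit_leb \<Otimes>\<^sub>M \<mu>) (\<lambda>(t, x). D x * sqrt (G t x))"
    using DGm DGb by (intro um.integrable_const_bound[of _ "sqrt b * sqrt b"]) (auto simp: split_def)
  \<comment> \<open>One factor D is replaced by its integral bound, the other remains as the test
    function. Fubini and Cauchy-Schwarz at each time then bound R^2 by R times the length.\<close>
  have "R\<^sup>2 = (\<integral>x. D x * D x \<partial>\<mu>)"
    unfolding R_def by (simp add: power2_eq_square)
  also have "\<dots> \<le> (\<integral>x. (LINT t|unit_leb. D x * sqrt (G t x)) \<partial>\<mu>)"
  proof (rule integral_mono)
    have "norm (D x * D x) \<le> sqrt b * sqrt b" for x
      unfolding real_norm_def abs_mult by (intro mult_mono Dabs) (use b in auto)
    then show "integrable \<mu> (\<lambda>x. D x * D x)"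
      using Dm' by (intro m.integrable_const_bound[of _ "sqrt b * sqrt b"]) auto
    show "integrable \<mu> (\<lambda>x. LINT t|unit_leb. D x * sqrt (G t x))"
      using p.integrable_snd[OF intDG] .
    show "D x * D x \<le> (LINT t|unit_leb. D x * sqrt (G t x))" for x
      using D[of x] D0[of x] by (simp add: It mult_left_mono)
  qed
  also have "\<dots> = (LINT t|unit_leb. (\<integral>x. D x * sqrt (G t x) \<partial>\<mu>))"
    by (rule p.Fubini_integral[OF intDG])
  also have "\<dots> \<le> (LINT t|unit_leb. R * sqrt (L t))"
  proof (rule integral_mono)
    show "integrable unit_leb (\<lambda>t. \<integral>x. D x * sqrt (G t x) \<partial>\<mu>)"
      using p.integrable_fst[OF intDG] .
    show "integrable unit_leb (\<lambda>t. R * sqrt (L t))"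
      using Lm sL by (intro integrable_mult_right u.integrable_const_bound[of _ "sqrt c"])
        (auto simp: space_restrict_space)
    fix t assume "t \<in> space unit_leb"
    then have "(\<lambda>x. G t x) \<in> borel_measurable \<mu>" using Gx by (simp add: space_restrict_space)
    then have "(\<integral>x. D x * sqrt (G t x) \<partial>\<mu>) \<le> sqrt (\<integral>x. (D x)\<^sup>2 \<partial>\<mu>) * sqrt (\<integral>x. (sqrt (G t x))\<^sup>2 \<partial>\<mu>)"
      using Dm' Dabs sq by (intro Cauchy_Schwarz_bounded[OF \<mu>(2), of _ "sqrt b"]) auto
    then show "(\<integral>x. D x * sqrt (G t x) \<partial>\<mu>) \<le> R * sqrt (L t)"
      using G(1) by (simp add: R_def L_def)
  qed
  finally have "R * R \<le> R * (LINT t|unit_leb. sqrt (L t))" by (simp add: power2_eq_square)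
  moreover have "0 \<le> (LINT t|unit_leb. sqrt (L t))" using L0 by simp
  ultimately have "R \<le> (LINT t|unit_leb. sqrt (L t))"
    using R0 by (cases "R = 0") auto
  then show "sqrt (\<integral>x. (D x)\<^sup>2 \<partial>\<mu>) \<le> integral {0..1} (\<lambda>t. sqrt (\<integral>x. F t x \<partial>\<mu>))"
    by (simp add: R_def IL)
qed

section \<open>Finite combinations of smooth sections\<close>

context metric_bundle
begin

text \<open>The second argument carries the velocity along, so that it is known for every curve of
  the class and survives all constructions below.\<close>

inductive CC :: "(real \<Rightarrow> 'm \<Rightarrow> 'e form) \<Rightarrow> (real \<Rightarrow> 'm \<Rightarrow> 'e form) \<Rightarrow> bool"
  where
    CC_scale: "C1_curve f f' \<Longrightarrow> s \<in> SS \<Longrightarrow> CC (\<lambda>t. f t *\<^sub>R s) (\<lambda>t. f' t *\<^sub>R s)" for f f' :: "real \<Rightarrow> real"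
  | CC_add: "CC \<sigma> \<sigma>' \<Longrightarrow> CC \<rho> \<rho>' \<Longrightarrow> CC (\<lambda>t. \<sigma> t + \<rho> t) (\<lambda>t. \<sigma>' t + \<rho>' t)"

lemma CC_SS: "CC \<sigma> \<sigma>' \<Longrightarrow> \<sigma> t \<in> SS \<and> \<sigma>' t \<in> SS"
  by (induction rule: CC.induct) (blast intro: SS_add SS_scaleR)+

lemma CC_sconv:
  assumes "CC \<sigma> \<sigma>'" "t \<in> {0..1}"
  shows "sconv (\<lambda>s. (\<sigma> s - \<sigma> t) /\<^sub>R (s - t)) (\<sigma>' t) (at t within {0..1}) \<and>
    sconv \<sigma>' (\<sigma>' t) (at t within {0..1})"
  using assms(1)
proof (induction rule: CC.induct)
  case (CC_scale f f' s)
  have "((\<lambda>s. (f s - f t) /\<^sub>R (s - t)) \<longlongrightarrow> f' t) (at t within {0..1})"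
    using CC_scale(1) assms(2) by (simp add: C1_curve_def has_vector_derivative_iff_quotient)
  from sconv_scaleR[OF CC_scale(2) this]
  have "sconv (\<lambda>s'. (f s' *\<^sub>R s - f t *\<^sub>R s) /\<^sub>R (s' - t)) (f' t *\<^sub>R s) (at t within {0..1})"
    by (simp add: scaleR_diff_left scaleR_diff_right left_diff_distrib right_diff_distrib)
  moreover have "(f' \<longlongrightarrow> f' t) (at t within {0..1})"
    using CC_scale(1) assms(2) by (auto simp: C1_curve_def continuous_on_def)
  ultimately show ?case using sconv_scaleR[OF CC_scale(2)] by blast
next
  case (CC_add \<sigma> \<sigma>' \<rho> \<rho>')
  have eq: "(\<lambda>s. (\<sigma> s + \<rho> s - (\<sigma> t + \<rho> t)) /\<^sub>R (s - t)) =
      (\<lambda>s. (\<sigma> s - \<sigma> t) /\<^sub>R (s - t) + (\<rho> s - \<rho> t) /\<^sub>R (s - t))"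
    by (rule ext) (simp only: scaleR_add_right[symmetric] add_diff_add)
  show ?case
    unfolding eq
    by (rule conjI[OF sconv_add[OF CC_add.IH(1)[THEN conjunct1] CC_add.IH(2)[THEN conjunct1]]
        sconv_add[OF CC_add.IH(1)[THEN conjunct2] CC_add.IH(2)[THEN conjunct2]]])
qed

lemma CC_velocity: "CC \<sigma> \<sigma>' \<Longrightarrow> t \<in> {0..1} \<Longrightarrow> has_velocity CT \<sigma> (\<sigma>' t) t {0..1}"
  unfolding has_velocity_def using CC_sconv sconv_imp_limitin by blast

lemma CC_continuous_map: "CC \<sigma> \<sigma>' \<Longrightarrow> continuous_map (top_of_set {0..1}) CT \<sigma>'"
  unfolding continuous_map_top_of_set_iff using CC_sconv sconv_imp_limitin by blast

lemma CC_piecewise_C1: "CC \<sigma> \<sigma>' \<Longrightarrow> piecewise_C1_path CT \<sigma>"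
  unfolding piecewise_C1_path_def C1_path_on_def
  by (intro exI[of _ "1::nat"] exI[of _ real] conjI allI impI exI[of _ \<sigma>'])
    (auto intro: CC_velocity CC_continuous_map)

lemma CC_ucurve: "CC \<sigma> \<sigma>' \<Longrightarrow> ucurve {0..1} \<sigma>" "CC \<sigma> \<sigma>' \<Longrightarrow> ucurve {0..1} \<sigma>'"
  using ucurve_velocity[of "{0..1}" \<sigma> \<sigma>'] CC_SS CC_velocity ucurve_continuous_map[OF CC_continuous_map]
  by blast+

text \<open>A weight in x is absorbed by the fixed sections and leaves the time coefficients
  alone.\<close>

lemma CC_mult:
  assumes "CC \<sigma> \<sigma>'" and \<rho>: "smooth_fun n A UNIV \<rho>"
  shows "CC (\<lambda>t x. \<rho> x *\<^sub>R \<sigma> t x) (\<lambda>t x. \<rho> x *\<^sub>R \<sigma>' t x)"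
  using assms(1)
proof (induction rule: CC.induct)
  case (CC_scale f f' s)
  have "(\<lambda>t x. \<rho> x *\<^sub>R (g t *\<^sub>R s) x) = (\<lambda>t. g t *\<^sub>R (\<lambda>x. \<rho> x *\<^sub>R s x))" for g :: "real \<Rightarrow> real"
    by (simp add: scaleR_fun_def fun_eq_iff mult.commute)
  then show ?case
    using CC.CC_scale[OF CC_scale(1) SS_smooth_scale[OF CC_scale(2) \<rho>]] by simp
next
  case (CC_add \<sigma> \<sigma>' \<tau> \<tau>')
  have eq: "(\<lambda>t x. \<rho> x *\<^sub>R (a t + b t) x) = (\<lambda>t. (\<lambda>x. \<rho> x *\<^sub>R a t x) + (\<lambda>x. \<rho> x *\<^sub>R b t x))"
    for a b :: "real \<Rightarrow> 'm \<Rightarrow> 'e form"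
    by (intro ext) (simp add: scaleR_fun_def algebra_simps)
  show ?case
    unfolding eq by (rule CC.CC_add[OF CC_add.IH])
qed

lemma CC_zero: "CC (\<lambda>t. 0) (\<lambda>t. 0)"
proof -
  obtain s where s: "s \<in> SS"
  proof
    have "coefficient E \<Phi> i j 0 = (\<lambda>x. 0)" for \<Phi> i j by (simp add: coefficient_def fun_eq_iff)
    moreover have "0 \<in> Herm E x" for x by (rule HermI) simp_all
    ultimately show "0 \<in> SS" using triv_open by (auto simp: SS_iff intro: smooth_fun_const)
  qed
  have "C1_curve (\<lambda>t. 0 :: real) (\<lambda>t. 0)" by (simp add: C1_curve_def)
  from CC_scale[OF this s] show ?thesis by simp
qed

lemma CC_sum:
  assumes "\<And>i. i \<in> I \<Longrightarrow> CC (\<sigma> i) (\<sigma>' i)"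
  shows "CC (\<lambda>t. \<Sum>i\<in>I. \<sigma> i t) (\<lambda>t. \<Sum>i\<in>I. \<sigma>' i t)"
  using assms by (induction I rule: infinite_finite_induct) (auto intro: CC_zero CC_add)

text \<open>The weight depends on x but not on t: it does not enter the velocity, and the energy at
  x sees only the number \<open>\<rho> x\<close>.\<close>

definition combine :: "('m \<Rightarrow> real) \<Rightarrow> (real \<Rightarrow> 'm \<Rightarrow> 'e form) \<Rightarrow> (real \<Rightarrow> 'm \<Rightarrow> 'e form) \<Rightarrow> real \<Rightarrow> 'm \<Rightarrow> 'e form"
  where "combine \<rho> \<sigma> p = (\<lambda>t x. (1 - \<rho> x) *\<^sub>R \<sigma> t x + \<rho> x *\<^sub>R p t x)"

lemma CC_combine:
  assumes "CC \<sigma> \<sigma>'" "CC p p'" "smooth_fun n A UNIV \<rho>"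
  shows "CC (combine \<rho> \<sigma> p) (combine \<rho> \<sigma>' p')"
proof -
  have "smooth_fun n A UNIV (\<lambda>x. 1 - \<rho> x)"
    using assms(3) by (intro smooth_fun_diff smooth_fun_const) auto
  from CC_add[OF CC_mult[OF assms(1) this] CC_mult[OF assms(2,3)]] show ?thesis
    by (simp add: combine_def plus_fun_def)
qed

lemma Herm_pos_convex:
  assumes "v \<in> Herm_pos E x" "w \<in> Herm_pos E x" "0 \<le> c" "c \<le> 1"
  shows "(1 - c) *\<^sub>R v + c *\<^sub>R w \<in> Herm_pos E x"
proof -
  obtain V \<Phi> where "fibre_iso E x \<Phi>" by (rule triv_at)
  then interpret fibre_frame E x \<Phi> by unfold_locales
  show ?thesis
    using assms posdef_convex[of "form_mat E \<Phi> x v" "form_mat E \<Phi> x w" "1 - c" c]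
    by (auto simp: Herm_pos_iff form_mat_add form_mat_scaleR intro!: Herm_add Herm_scaleR)
qed

section \<open>Admissible curves from h1 to h2 and their energies\<close>

definition PP where
  "PP h1 h2 \<sigma> \<sigma>' \<longleftrightarrow> CC \<sigma> \<sigma>' \<and> (\<forall>t\<in>{0..1}. \<forall>x. \<sigma> t x \<in> Herm_pos E x) \<and> \<sigma> 0 = h1 \<and> \<sigma> 1 = h2"

lemma PP_SP: "PP h1 h2 \<sigma> \<sigma>' \<Longrightarrow> t \<in> {0..1} \<Longrightarrow> \<sigma> t \<in> SP"
  using CC_SS by (auto simp: PP_def SP_iff)

lemma PP_combine:
  assumes "PP h1 h2 \<sigma> \<sigma>'" "PP h1 h2 p p'" "smooth_fun n A UNIV \<rho>" "\<And>x. 0 \<le> \<rho> x" "\<And>x. \<rho> x \<le> 1"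
  shows "PP h1 h2 (combine \<rho> \<sigma> p) (combine \<rho> \<sigma>' p')"
proof -
  have "combine \<rho> \<sigma> p 0 = h1" "combine \<rho> \<sigma> p 1 = h2"
    using assms(1,2) by (auto simp: PP_def combine_def fun_eq_iff scaleR_fun_def algebra_simps)
  then show ?thesis
    using assms by (auto simp: PP_def combine_def intro: Herm_pos_convex CC_combine[unfolded combine_def])
qed

lemma PP_line:
  assumes "h1 \<in> SP" "h2 \<in> SP"
  shows "PP h1 h2 (\<lambda>t. (1 - t) *\<^sub>R h1 + t *\<^sub>R h2) (\<lambda>t. (-1) *\<^sub>R h1 + 1 *\<^sub>R h2)"
proof -
  have "C1_curve (\<lambda>t. 1 - t :: real) (\<lambda>t. -1)" "C1_curve (\<lambda>t. t :: real) (\<lambda>t. 1)"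
    by (auto simp: C1_curve_def intro!: derivative_eq_intros)
  then have "CC (\<lambda>t. (1 - t) *\<^sub>R h1 + t *\<^sub>R h2) (\<lambda>t. (-1) *\<^sub>R h1 + 1 *\<^sub>R h2)"
    using assms by (intro CC_add CC_scale) (auto simp: SP_iff)
  moreover have "((1 - t) *\<^sub>R h1 + t *\<^sub>R h2) x \<in> Herm_pos E x" if "t \<in> {0..1}" for t x
    using Herm_pos_convex[of "h1 x" x "h2 x" t] assms that by (simp add: SP_iff scaleR_fun_def plus_fun_def)
  ultimately show ?thesis by (simp add: PP_def)
qed

definition energy :: "(real \<Rightarrow> 'm \<Rightarrow> 'e form) \<Rightarrow> (real \<Rightarrow> 'm \<Rightarrow> 'e form) \<Rightarrow> 'm \<Rightarrow> real"
  where "energy \<sigma> \<sigma>' x = integral {0..1} (\<lambda>t. fibre_metric E \<alpha> x (\<sigma> t x) (\<sigma>' t x) (\<sigma>' t x))"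

lemma density_CC: "CC \<sigma> \<sigma>' \<Longrightarrow> t \<in> {0..1} \<Longrightarrow>
    density \<sigma> t x = fibre_metric E \<alpha> x (\<sigma> t x) (\<sigma>' t x) (\<sigma>' t x)"
  using velocity_CT[OF CC_velocity] by (simp add: density_def)

lemma energy_density: "CC \<sigma> \<sigma>' \<Longrightarrow> energy \<sigma> \<sigma>' x = integral {0..1} (\<lambda>t. density \<sigma> t x)"
  unfolding energy_def by (intro integral_cong) (simp add: density_CC)

lemma coefficient_joint_continuous:
  assumes "ucurve {0..1} q" "(V, \<Phi>) \<in> trivs E"
  shows "continuous_on {z \<in> ({0..1} \<times> UNIV) \<times> {0..1}. snd (fst z) \<in> V}
     (\<lambda>z. q (snd z) (snd (fst z)) (frame E \<Phi> (snd (fst z)) i) (frame E \<Phi> (snd (fst z)) j))"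
    (is "continuous_on ?S _")
proof -
  have "continuous_on ?S (\<lambda>z. (snd z, snd (fst z)))"
    by (intro continuous_intros continuous_on_fst continuous_on_snd continuous_on_id)
  from continuous_on_compose2[OF ucurve_joint[OF assms, of i j] this]
  show ?thesis by (auto simp: coefficient_def image_subset_iff)
qed

text \<open>The weight is treated as an additional real variable. A single continuous function on
  the compact space [0, 1] x M then contains the energies of all combinations of the two curves,
  which yields a bound independent of the weight function.\<close>

lemma combined_energy_continuous:
  assumes "PP h1 h2 \<sigma> \<sigma>'" "PP h1 h2 p p'"
  shows "continuous_on ({0..1} \<times> UNIV) (\<lambda>z. energy (combine (\<lambda>_. fst z) \<sigma> p) (combine (\<lambda>_. fst z) \<sigma>' p') (snd z))"
proof -
  have CC: "CC \<sigma> \<sigma>'" "CC p p'" using assms by (auto simp: PP_def)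
  let ?S = "({0..1} \<times> (UNIV :: 'm set)) \<times> {0..1}"
  let ?c = "\<lambda>\<sigma> p z. combine (\<lambda>_. fst (fst z)) \<sigma> p (snd z) (snd (fst z))"
  have cont: "continuous_on {z \<in> ?S. snd (fst z) \<in> V}
     (\<lambda>z. ?c q q' z (frame E \<Phi> (snd (fst z)) i) (frame E \<Phi> (snd (fst z)) j))"
    if "ucurve {0..1} q" "ucurve {0..1} q'" "(V, \<Phi>) \<in> trivs E" for V \<Phi> i j q q'
    unfolding combine_def plus_fun_def scaleR_fun_def
    by (intro continuous_intros coefficient_joint_continuous that continuous_on_fst continuous_on_snd continuous_on_id)
  have "continuous_on ?S (\<lambda>z. fibre_metric E \<alpha> (snd (fst z)) (?c \<sigma> p z) (?c \<sigma>' p' z) (?c \<sigma>' p' z))"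
  proof (rule continuous_on_fibre_metric)
    show "continuous_on ?S (\<lambda>z. snd (fst z))"
      by (intro continuous_intros continuous_on_fst continuous_on_snd continuous_on_id)
    show "?c \<sigma> p z \<in> Herm_pos E (snd (fst z))" if "z \<in> ?S" for z
      unfolding combine_def using assms that by (intro Herm_pos_convex) (auto simp: PP_def)
    show "?c \<sigma>' p' z \<in> Herm E (snd (fst z))" for z
      unfolding combine_def using CC_SS[OF CC(1)] CC_SS[OF CC(2)]
      by (intro Herm_add Herm_scaleR) (auto simp: SS_iff)
  qed (use cont CC_ucurve CC in blast)+
  then have "continuous_on (({0..1} \<times> UNIV) \<times> cbox 0 1)
      (\<lambda>(z, t). fibre_metric E \<alpha> (snd z) (combine (\<lambda>_. fst z) \<sigma> p t (snd z))
         (combine (\<lambda>_. fst z) \<sigma>' p' t (snd z)) (combine (\<lambda>_. fst z) \<sigma>' p' t (snd z)))"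
    by (simp add: split_def cbox_interval)
  from integral_continuous_on_param[OF this] show ?thesis
    by (simp add: energy_def cbox_interval)
qed

lemma energy_combine: "energy (combine \<rho> \<sigma> p) (combine \<rho> \<sigma>' p') x =
    energy (combine (\<lambda>_. \<rho> x) \<sigma> p) (combine (\<lambda>_. \<rho> x) \<sigma>' p') x"
  by (simp add: energy_def combine_def)

lemma energy_combine_0: "energy (combine (\<lambda>_. 0) \<sigma> p) (combine (\<lambda>_. 0) \<sigma>' p') = energy \<sigma> \<sigma>'"
  and energy_combine_1: "energy (combine (\<lambda>_. 1) \<sigma> p) (combine (\<lambda>_. 1) \<sigma>' p') = energy p p'"
  by (simp_all add: combine_def)

text \<open>The slice at weight 0 of the statement for two curves.\<close>

lemma energy_continuous:
  assumes "PP h1 h2 \<sigma> \<sigma>'" shows "continuous_on UNIV (energy \<sigma> \<sigma>')"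
proof -
  have "continuous_on UNIV (\<lambda>x::'m. (0::real, x))" by (intro continuous_intros)
  from continuous_on_compose2[OF combined_energy_continuous[OF assms assms] this]
  show ?thesis by (simp add: energy_combine_0 image_subset_iff)
qed

lemma energy_nonneg:
  assumes "PP h1 h2 \<sigma> \<sigma>'" shows "0 \<le> energy \<sigma> \<sigma>' x"
proof -
  have "0 \<le> fibre_metric E \<alpha> x (\<sigma> t x) (\<sigma>' t x) (\<sigma>' t x)" if "t \<in> {0..1}" for t
    using assms that CC_SS by (intro fibre_metric_nonneg') (auto simp: PP_def SS_iff)
  then show ?thesis
    unfolding energy_def
    by (cases "(\<lambda>t. fibre_metric E \<alpha> x (\<sigma> t x) (\<sigma>' t x) (\<sigma>' t x)) integrable_on {0..1}")
      (auto intro: integral_nonneg simp: not_integrable_integral)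
qed

end

locale L2_bundle = metric_bundle n A E \<alpha>
  for n :: nat and A :: "'m::{t2_space, second_countable_topology} chart set"
    and E :: "('m, 'e, 'r::finite) vbundle" and \<alpha> :: "'m \<Rightarrow> real" +
  fixes \<mu> :: "'m measure"
  assumes sets_\<mu>: "sets \<mu> = sets borel" and finite_\<mu>: "finite_measure \<mu>"
begin

text \<open>The distance is at most the length of the curve in the fibre, and this at most the root
  of the energy by Cauchy-Schwarz in time.\<close>

lemma fibre_dist_le_energy:
  assumes "PP h1 h2 \<sigma> \<sigma>'"
  shows "fibre_dist E \<alpha> x (h1 x) (h2 x) \<le> sqrt (energy \<sigma> \<sigma>' x)"
proof -
  have CC: "CC \<sigma> \<sigma>'" using assms by (simp add: PP_def)
  obtain N B where N: "finite N" "continuous_on (({0..1} - N) \<times> UNIV) (\<lambda>z. density \<sigma> (fst z) (snd z))"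
    "\<And>t x. t \<in> {0..1} - N \<Longrightarrow> 0 \<le> density \<sigma> t x" "\<And>t x. t \<in> {0..1} - N \<Longrightarrow> density \<sigma> t x \<le> B"
    "\<And>x. fibre_dist E \<alpha> x (\<sigma> 0 x) (\<sigma> 1 x) \<le> integral {0..1} (\<lambda>t. sqrt (density \<sigma> t x))"
    using path_density[OF CC_piecewise_C1[OF CC], of thesis] PP_SP[OF assms] by blast
  have "fibre_dist E \<alpha> x (h1 x) (h2 x) \<le> integral {0..1} (\<lambda>t. sqrt (density \<sigma> t x))"
    using N(5)[of x] assms by (simp add: PP_def)
  also have "\<dots> \<le> sqrt (integral {0..1} (\<lambda>t. density \<sigma> t x))"
    by (rule sqrt_integral_le[OF sets_\<mu> finite_\<mu> N(1-4)])
  finally show ?thesis by (simp add: energy_density[OF CC])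
qed

lemma path_length_le_energy:
  assumes "PP h1 h2 \<sigma> \<sigma>'"
  shows "path_length CT (L2_metric E \<alpha> \<mu>) \<sigma> \<le> sqrt (\<integral>x. energy \<sigma> \<sigma>' x \<partial>\<mu>)"
proof -
  have CC: "CC \<sigma> \<sigma>'" using assms by (simp add: PP_def)
  obtain N B where N: "finite N" "continuous_on (({0..1} - N) \<times> UNIV) (\<lambda>z. density \<sigma> (fst z) (snd z))"
    "\<And>t x. t \<in> {0..1} - N \<Longrightarrow> 0 \<le> density \<sigma> t x" "\<And>t x. t \<in> {0..1} - N \<Longrightarrow> density \<sigma> t x \<le> B"
    using path_density[OF CC_piecewise_C1[OF CC], of thesis] PP_SP[OF assms] by blast
  show ?thesis
    using integral_sqrt_le_sqrt[OF sets_\<mu> finite_\<mu> N] by (simp add: path_length_L2 energy_density[OF CC])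
qed

lemma continuous_bounded:
  fixes f :: "'m \<Rightarrow> real"
  assumes "continuous_on UNIV f"
  obtains C where "\<And>x. \<bar>f x\<bar> \<le> C"
proof -
  have "bounded (range f)"
    using assms compact_UNIV compact_continuous_image compact_imp_bounded by blast
  then show ?thesis using that by (auto simp: bounded_iff)
qed

lemma integrable_bounded:
  fixes f :: "'m \<Rightarrow> real"
  assumes "f \<in> borel_measurable borel" "\<And>x. \<bar>f x\<bar> \<le> C"
  shows "integrable \<mu> f"
proof (rule finite_measure.integrable_const_bound[OF finite_\<mu>, of _ C])
  show "f \<in> borel_measurable \<mu>"
    using assms(1) measurable_cong_sets[OF sets_\<mu> refl] by blast
qed (use assms(2) in auto)

lemma energy_measurable: "PP h1 h2 \<sigma> \<sigma>' \<Longrightarrow> energy \<sigma> \<sigma>' \<in> borel_measurable borel"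
  by (rule borel_measurable_continuous_onI[OF energy_continuous])

lemma energy_integrable: "PP h1 h2 \<sigma> \<sigma>' \<Longrightarrow> integrable \<mu> (energy \<sigma> \<sigma>')"
  by (rule continuous_bounded[OF energy_continuous]) (auto intro: integrable_bounded energy_measurable)

text \<open>Where the weight lies strictly between 0 and 1 the energy of the combination is
  controlled only by a uniform bound, so the minimum appears only in the limit. The positive part
  measures the excess in a way that adds up under repeated combination.\<close>

lemma energy_min:
  assumes P: "PP h1 h2 \<sigma> \<sigma>'" "PP h1 h2 p p'" and \<epsilon>: "\<epsilon> > 0"
  shows "\<exists>s s'. PP h1 h2 s s' \<and>
    (\<integral>x. max 0 (energy s s' x - min (energy \<sigma> \<sigma>' x) (energy p p' x)) \<partial>\<mu>) < \<epsilon>"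
proof -
  define W where "W = {x. energy p p' x < energy \<sigma> \<sigma>' x}"
  have "open W"
    unfolding W_def by (rule open_Collect_less) (use energy_continuous P in blast)+
  then obtain \<rho> :: "nat \<Rightarrow> 'm \<Rightarrow> real" where \<rho>: "\<And>m. smooth_fun n A UNIV (\<rho> m)"
    "\<And>m x. 0 \<le> \<rho> m x" "\<And>m x. \<rho> m x \<le> 1" "\<And>x. (\<lambda>m. \<rho> m x) \<longlonglongrightarrow> indicator W x"
    by (rule smooth_indicator_approx) blast
  let ?s = "\<lambda>m. combine (\<rho> m) \<sigma> p" and ?s' = "\<lambda>m. combine (\<rho> m) \<sigma>' p'"
  have PP: "PP h1 h2 (?s m) (?s' m)" for m
    by (rule PP_combine[OF P \<rho>(1-3)])
  define Q where "Q = (\<lambda>z. energy (combine (\<lambda>_. fst z) \<sigma> p) (combine (\<lambda>_. fst z) \<sigma>' p') (snd z))"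
  have Q: "continuous_on ({0..1} \<times> UNIV) Q"
    unfolding Q_def by (rule combined_energy_continuous[OF P])
  have eQ: "energy (?s m) (?s' m) x = Q (\<rho> m x, x)" for m x
    by (subst energy_combine) (simp add: Q_def)
  have "compact ({0..1::real} \<times> (UNIV :: 'm set))" by (intro compact_Times compact_UNIV) simp
  then have "bounded (Q ` ({0..1} \<times> UNIV))"
    using Q compact_imp_bounded compact_continuous_image by blast
  then obtain C where C: "\<And>z. z \<in> {0..1} \<times> UNIV \<Longrightarrow> \<bar>Q z\<bar> \<le> C"
    unfolding bounded_iff by (metis imageI real_norm_def)
  let ?g = "\<lambda>x. min (energy \<sigma> \<sigma>' x) (energy p p' x)"
  have g0: "0 \<le> ?g x" for x using energy_nonneg[OF P(1)] energy_nonneg[OF P(2)] by simp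
  let ?f = "\<lambda>m x. max 0 (energy (?s m) (?s' m) x - ?g x)"
  have gm: "?g \<in> borel_measurable borel"
    using energy_measurable P by (intro borel_measurable_min) blast+
  have fm: "?f m \<in> borel_measurable \<mu>" for m
  proof -
    have "?f m \<in> borel_measurable borel"
      using energy_measurable[OF PP[of m]] gm by (intro borel_measurable_max borel_measurable_diff) auto
    then show ?thesis using measurable_cong_sets[OF sets_\<mu> refl] by blast
  qed
  have "(\<lambda>m. \<integral>x. ?f m x \<partial>\<mu>) \<longlonglongrightarrow> (\<integral>x. 0 \<partial>\<mu>)"
  proof (rule integral_dominated_convergence[where w = "\<lambda>_. max C 0"])
    show "integrable \<mu> (\<lambda>_. max C 0)"
      using finite_\<mu> by (simp add: finite_measure.integrable_const)
    have "norm (?f m x) \<le> max C 0" for m x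
      using C[of "(\<rho> m x, x)"] g0[of x] \<rho>(2,3) by (auto simp: eQ)
    then show "AE x in \<mu>. norm (?f m x) \<le> max C 0" for m by simp
    have "(\<lambda>m. ?f m x) \<longlonglongrightarrow> 0" for x
    proof -
      have "(\<lambda>m. Q (\<rho> m x, x)) \<longlonglongrightarrow> Q (indicator W x, x)"
        by (rule continuous_on_tendsto_compose[OF Q])
          (use \<rho>(2,3) tendsto_Pair[OF \<rho>(4)[of x] tendsto_const[of x]] in \<open>auto simp: indicator_def\<close>)
      moreover have "Q (indicator W x, x) = ?g x"
        by (auto simp: Q_def energy_combine_0 energy_combine_1 W_def indicator_def)
      ultimately have "(\<lambda>m. ?f m x) \<longlonglongrightarrow> max 0 (?g x - ?g x)"
        unfolding eQ by (intro tendsto_intros) auto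
      then show ?thesis by simp
    qed
    then show "AE x in \<mu>. (\<lambda>m. ?f m x) \<longlonglongrightarrow> 0" by simp
  qed (use fm in auto)
  then have "\<forall>\<^sub>F m in sequentially. (\<integral>x. ?f m x \<partial>\<mu>) < \<epsilon>"
    using \<epsilon> by (intro order_tendstoD(2)) auto
  then show ?thesis using PP by (auto simp: eventually_sequentially)
qed

end

section \<open>Almost minimal curves of sections\<close>

lemma form_mat_tendsto:
  assumes "limitin (fibre_top E x) f l F"
  shows "((\<lambda>s. form_mat E \<Phi> x (f s)) \<longlongrightarrow> form_mat E \<Phi> x l) F"
  using assms by (intro vec_tendstoI) (simp add: limitin_fibre_top form_mat_def)

lemma mat_metric_scaleR: "mat_metric a H (k *\<^sub>R V) = k\<^sup>2 * mat_metric a H V"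
  by (simp add: mat_metric_def matrix_scaleR_left matrix_scaleR_right Determinants.trace_def
      sum_distrib_left[symmetric] power2_eq_square algebra_simps)

lemma adj_scaleR: "adj (c *\<^sub>R M) = c *\<^sub>R adj M"
  and adj_add: "adj (M + M') = adj M + adj M'"
  and adj_0: "adj 0 = 0"
  by (simp_all add: adj_def Finite_Cartesian_Product.vec_eq_iff)

lemma adj_sum: "adj (\<Sum>b\<in>I. f b) = (\<Sum>b\<in>I. adj (f b))"
  by (induction I rule: infinite_finite_induct) (simp_all add: adj_0 adj_add)

lemma bounded_linear_adj: "bounded_linear (adj :: complex ^ 'r ^ 'r \<Rightarrow> _)"
  by (intro linear_conv_bounded_linear[THEN iffD1] linearI)
    (simp_all add: adj_add adj_scaleR)

text \<open>Half of \<epsilon> pays for smoothing the corners and half for the reparametrisation.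
  The speed is bounded at each time so that the energy, its integrated square, is at most the square
  of the length plus \<epsilon>.\<close>

lemma (in fibre_frame) almost_minimal_path:
  assumes \<gamma>: "piecewise_C1_path (fibre_top E x) \<gamma>" "\<forall>t\<in>{0..1}. \<gamma> t \<in> Herm_pos E x"
    and \<alpha>: "\<alpha> x > - 1 / real CARD('r)" and \<epsilon>: "\<epsilon> > 0"
  shows "\<exists>z z'. C1_curve z z' \<and>
    (\<forall>t\<in>{0..1}. z t \<in> posdef \<and> adj (z t) = z t \<and> adj (z' t) = z' t) \<and>
    z 0 = form_mat E \<Phi> x (\<gamma> 0) \<and> z 1 = form_mat E \<Phi> x (\<gamma> 1) \<and>
    (\<forall>t\<in>{0..1}. mat_metric (\<alpha> x) (z t) (z' t) \<le>
      (path_length (fibre_top E x) (fibre_metric E \<alpha> x) \<gamma> + \<epsilon>)\<^sup>2)"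
proof -
  obtain k :: nat and \<tau> where \<tau>: "\<tau> 0 = 0" "\<tau> k = 1" "\<And>i. i < k \<Longrightarrow> \<tau> i < \<tau> (Suc i)"
    and C1: "\<And>i. i < k \<Longrightarrow> C1_path_on (fibre_top E x) (\<tau> i) (\<tau> (Suc i)) \<gamma>"
    using \<gamma>(1) unfolding piecewise_C1_path_def by blast
  let ?I = "\<lambda>i. {\<tau> i..\<tau> (Suc i)}"
  let ?m = "form_mat E \<Phi> x"
  have "\<forall>i. \<exists>v. i < k \<longrightarrow> (\<forall>t\<in>?I i. has_velocity (fibre_top E x) \<gamma> (v t) t (?I i)) \<and>
      continuous_map (top_of_set (?I i)) (fibre_top E x) v"
    using C1 unfolding C1_path_on_def by blast
  then obtain v where v: "\<And>i t. i < k \<Longrightarrow> t \<in> ?I i \<Longrightarrow> has_velocity (fibre_top E x) \<gamma> (v i t) t (?I i)"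
    "\<And>i. i < k \<Longrightarrow> continuous_map (top_of_set (?I i)) (fibre_top E x) (v i)"
    by metis
  have I01: "?I i \<subseteq> {0..1}" if "i < k" for i
    using breakpoints_mono[of k \<tau> 0 i] breakpoints_mono[of k \<tau> "Suc i" k] that \<tau> by auto
  define N where "N = \<tau> ` {..k}"
  have N: "finite N" "0 \<in> N" "1 \<in> N" using \<tau> by (force simp: N_def)+
  have piece: "\<exists>i<k. \<tau> i < t \<and> t < \<tau> (Suc i)" if "t \<in> {0..1} - N" for t
    using breakpoint_interval[of \<tau> t k] that \<tau>(1,2) by (auto simp: N_def)
  define c where "c = (\<lambda>t. ?m (\<gamma> t))"
  define c' where "c' = (\<lambda>t. ?m (velocity (fibre_top E x) \<gamma> t))"
  have der: "(c has_vector_derivative ?m (v i t)) (at t within ?I i)" if "i < k" "t \<in> ?I i" for i t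
    using form_mat_tendsto[OF v(1)[OF that, unfolded has_velocity_def], of \<Phi>]
    by (simp add: has_vector_derivative_iff_quotient c_def form_mat_diff form_mat_scaleR)
  have vcont: "continuous_on (?I i) (\<lambda>t. ?m (v i t))" if "i < k" for i
    unfolding continuous_on_def
    by (intro ballI form_mat_tendsto) (use v(2)[OF that] in \<open>simp add: continuous_map_top_of_set_iff\<close>)
  have vel: "velocity (fibre_top E x) \<gamma> t = v i t" "has_velocity (fibre_top E x) \<gamma> (v i t) t {0..1}"
    if "i < k" "\<tau> i < t" "t < \<tau> (Suc i)" for i t
  proof -
    show hv: "has_velocity (fibre_top E x) \<gamma> (v i t) t {0..1}"
      by (rule piecewise_C1_velocity[OF \<tau> that v(1)]) (use that in auto)
    show "velocity (fibre_top E x) \<gamma> t = v i t"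
      by (rule velocity_fibre[OF hv]) (use that I01[OF that(1)] in auto)
  qed
  have "\<forall>i. \<exists>M. i < k \<longrightarrow> (\<forall>t\<in>?I i. norm (?m (v i t)) \<le> M)"
  proof
    fix i
    have "bounded ((\<lambda>t. ?m (v i t)) ` ?I i)" if "i < k"
      using vcont[OF that] by (intro compact_imp_bounded compact_continuous_image) auto
    then show "\<exists>M. i < k \<longrightarrow> (\<forall>t\<in>?I i. norm (?m (v i t)) \<le> M)"
      unfolding bounded_iff by (metis imageI)
  qed
  then obtain M where M: "\<And>i t. i < k \<Longrightarrow> t \<in> ?I i \<Longrightarrow> norm (?m (v i t)) \<le> M i" by metis
  have c_cont: "continuous_on {0..1} c"
  proof -
    have "continuous_on (\<Union>i\<in>{..<k}. ?I i) c"
    proof (rule continuous_on_closed_Union)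
      show "continuous_on (?I i) c" if "i \<in> {..<k}" for i
        unfolding continuous_on_eq_continuous_within using der that has_vector_derivative_continuous by blast
    qed auto
    moreover have "{0..1} \<subseteq> (\<Union>i\<in>{..<k}. ?I i)"
    proof
      fix t :: real assume t: "t \<in> {0..1}"
      show "t \<in> (\<Union>i\<in>{..<k}. ?I i)"
      proof (cases "t \<in> N")
        case False
        then obtain i where "i < k" "\<tau> i < t" "t < \<tau> (Suc i)" using piece t by blast
        then show ?thesis by (intro UN_I[of i]) auto
      next
        case True
        then obtain j where j: "j \<le> k" "t = \<tau> j" by (auto simp: N_def)
        have "k \<noteq> 0" using \<tau>(1,2) by (metis zero_neq_one)
        show ?thesis
        proof (cases "j = k")
          case True
          then show ?thesis
            using j \<open>k \<noteq> 0\<close> \<tau>(3)[of "k - 1"] by (intro UN_I[of "k - 1"]) auto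
        next
          case False
          then show ?thesis using j \<tau>(3)[of j] by (intro UN_I[of j]) auto
        qed
      qed
    qed
    ultimately show ?thesis by (rule continuous_on_subset)
  qed
  have c_adj: "c t \<in> posdef" "adj (c t) = c t" if "t \<in> {0..1}" for t
    using \<gamma>(2) that Herm_adj by (auto simp: c_def Herm_pos_iff)
  have c'_at: "(c has_vector_derivative c' t) (at t)" "norm (c' t) \<le> (\<Sum>i<k. \<bar>M i\<bar>)" "adj (c' t) = c' t"
    "fibre_metric E \<alpha> x (\<gamma> t) (velocity (fibre_top E x) \<gamma> t) (velocity (fibre_top E x) \<gamma> t) = mat_metric (\<alpha> x) (c t) (c' t)"
    if t: "t \<in> {0..1} - N" for t
  proof -
    obtain i where i: "i < k" "\<tau> i < t" "t < \<tau> (Suc i)" using piece[OF t] by blast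
    have "at t within ?I i = at t" by (rule at_within_interior) (use i in auto)
    then show "(c has_vector_derivative c' t) (at t)"
      using der[OF i(1), of t] i vel(1)[OF i] by (simp add: c'_def)
    have "norm (c' t) \<le> \<bar>M i\<bar>" using M[OF i(1), of t] i vel(1)[OF i] by (auto simp: c'_def)
    also have "\<dots> \<le> (\<Sum>i<k. \<bar>M i\<bar>)" using i by (intro member_le_sum) auto
    finally show "norm (c' t) \<le> (\<Sum>i<k. \<bar>M i\<bar>)" .
    have H: "velocity (fibre_top E x) \<gamma> t \<in> Herm E x"
      using has_velocity_in_Herm[OF vel(2)[OF i]] vel(1)[OF i] by simp
    then show "adj (c' t) = c' t" by (simp add: c'_def Herm_adj)
    show "fibre_metric E \<alpha> x (\<gamma> t) (velocity (fibre_top E x) \<gamma> t) (velocity (fibre_top E x) \<gamma> t) = mat_metric (\<alpha> x) (c t) (c' t)"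
      using \<gamma>(2) t H by (simp add: fibre_metric_eq c_def c'_def)
  qed
  have c'_cont: "continuous_on ({0..1} - N) c'"
  proof (rule continuous_on_local)
    fix t assume "t \<in> {0..1} - N"
    then obtain i where i: "i < k" "\<tau> i < t" "t < \<tau> (Suc i)" using piece by blast
    have "continuous_on {\<tau> i<..<\<tau> (Suc i)} (\<lambda>t. ?m (v i t))"
      by (rule continuous_on_subset[OF vcont[OF i(1)]]) auto
    then have "continuous_on {\<tau> i<..<\<tau> (Suc i)} c'"
      by (rule continuous_on_eq) (use vel(1)[OF i(1)] in \<open>auto simp: c'_def\<close>)
    then have "continuous_on (({0..1} - N) \<inter> {\<tau> i<..<\<tau> (Suc i)}) c'"
      by (rule continuous_on_subset) auto
    then show "\<exists>U. open U \<and> t \<in> U \<and> continuous_on (({0..1} - N) \<inter> U) c'"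
      using i by (intro exI[of _ "{\<tau> i<..<\<tau> (Suc i)}"]) auto
  qed
  have Gc: "continuous_on (posdef \<times> UNIV) (\<lambda>z. mat_metric (\<alpha> x) (fst z :: complex ^ 'r ^ 'r) (snd z))"
    by (rule continuous_on_mat_metric) (auto intro: continuous_intros continuous_on_fst continuous_on_snd continuous_on_id)
  let ?L = "path_length (fibre_top E x) (fibre_metric E \<alpha> x) \<gamma>"
  have L: "integral {0..1} (\<lambda>t. sqrt (mat_metric (\<alpha> x) (c t) (c' t))) = ?L"
    unfolding path_length_def
    by (rule integral_spike[of N]) (use N(1) c'_at(4) in \<open>auto simp: negligible_finite\<close>)
  have "\<exists>w w'. C1_curve w w' \<and> (\<forall>t\<in>{0..1}. w t \<in> posdef \<and> adj (w t) = w t \<and> adj (w' t) = w' t) \<and>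
      w 0 = c 0 \<and> w 1 = c 1 \<and> integral {0..1} (\<lambda>t. sqrt (mat_metric (\<alpha> x) (w t) (w' t))) <
        integral {0..1} (\<lambda>t. sqrt (mat_metric (\<alpha> x) (c t) (c' t))) + \<epsilon> / 2"
    \<comment> \<open>The functional G is the root of the matrix metric, so its integral is the
      length, and J is \<open>adj\<close>.\<close>
    by (rule corner_smoothing[OF N c_cont c'_at(1) c'_cont c'_at(2) posdef_open c_adj(1) _ bounded_linear_adj c_adj(2) c'_at(3)])
      (use \<epsilon> Gc in \<open>auto intro: continuous_on_real_sqrt\<close>)
  then obtain w w' where w: "C1_curve w w'" "\<And>t. t \<in> {0..1} \<Longrightarrow> w t \<in> posdef \<and> adj (w t) = w t \<and> adj (w' t) = w' t"
    "w 0 = c 0" "w 1 = c 1" "integral {0..1} (\<lambda>t. sqrt (mat_metric (\<alpha> x) (w t) (w' t))) < ?L + \<epsilon> / 2"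
    unfolding L by blast
  have "continuous_on {0..1} (\<lambda>t. (w t, w' t))"
    using w(1) C1_curve_continuous[OF w(1)] by (intro continuous_intros) (auto simp: C1_curve_def)
  from continuous_on_compose2[OF Gc this] have wc: "continuous_on {0..1} (\<lambda>t. mat_metric (\<alpha> x) (w t) (w' t))"
    using w(2) by (auto simp: image_subset_iff)
  have w0: "0 \<le> mat_metric (\<alpha> x) (w t) (w' t)" if "t \<in> {0..1}" for t
    using w(2)[OF that] \<alpha> by (intro mat_metric_nonneg) auto
  let ?l = "integral {0..1} (\<lambda>t. sqrt (mat_metric (\<alpha> x) (w t) (w' t)))"
  have l0: "0 \<le> ?l"
    by (intro integral_nonneg integrable_continuous_real continuous_on_real_sqrt wc) (auto simp: w0)
  obtain \<theta> \<theta>' where \<theta>: "C1_curve (w \<circ> \<theta>) (\<lambda>t. \<theta>' t *\<^sub>R w' (\<theta> t))" "\<And>t. t \<in> {0..1} \<Longrightarrow> \<theta> t \<in> {0..1}"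
    "\<theta> 0 = 0" "\<theta> 1 = 1"
    "\<And>t. t \<in> {0..1} \<Longrightarrow> mat_metric (\<alpha> x) (w (\<theta> t)) (\<theta>' t *\<^sub>R w' (\<theta> t)) \<le> (?l + \<epsilon> / 2)\<^sup>2"
    using constant_speed_reparametrisation[of w w' "mat_metric (\<alpha> x)" "\<epsilon> / 2", OF w(1) wc w0 mat_metric_scaleR] \<epsilon> by auto
  have "(w \<circ> \<theta>) t \<in> posdef \<and> adj ((w \<circ> \<theta>) t) = (w \<circ> \<theta>) t \<and> adj (\<theta>' t *\<^sub>R w' (\<theta> t)) = \<theta>' t *\<^sub>R w' (\<theta> t)"
    if "t \<in> {0..1}" for t
    using w(2)[OF \<theta>(2)[OF that]] by (simp add: adj_scaleR)
  moreover have "(w \<circ> \<theta>) 0 = form_mat E \<Phi> x (\<gamma> 0)" "(w \<circ> \<theta>) 1 = form_mat E \<Phi> x (\<gamma> 1)"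
    using \<theta> w by (auto simp: c_def)
  moreover have "mat_metric (\<alpha> x) ((w \<circ> \<theta>) t) (\<theta>' t *\<^sub>R w' (\<theta> t)) \<le> (?L + \<epsilon>)\<^sup>2" if "t \<in> {0..1}" for t
  proof -
    have "mat_metric (\<alpha> x) ((w \<circ> \<theta>) t) (\<theta>' t *\<^sub>R w' (\<theta> t)) \<le> (?l + \<epsilon> / 2)\<^sup>2"
      using \<theta>(5)[OF that] by simp
    also have "\<dots> \<le> (?L + \<epsilon>)\<^sup>2"
      using w(5) l0 \<epsilon> by (intro power_mono) auto
    finally show ?thesis .
  qed
  ultimately show ?thesis
    using \<theta>(1) by (intro exI[of _ "w \<circ> \<theta>"] exI[of _ "\<lambda>t. \<theta>' t *\<^sub>R w' (\<theta> t)"]) blast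
qed

context metric_bundle
begin

definition local_section :: "'m set \<Rightarrow> ('e \<Rightarrow> complex ^ 'r) \<Rightarrow> ('m \<Rightarrow> real) \<Rightarrow> complex ^ 'r ^ 'r \<Rightarrow> 'm \<Rightarrow> 'e form"
  where "local_section V \<Phi> \<rho> M = (\<lambda>x. if x \<in> V then \<rho> x *\<^sub>R mat_form E \<Phi> x M else 0)"

text \<open>In another trivialisation the coefficients are sesquilinear in the transition functions,
  hence smooth on V \<inter> V'; the closed set C permits extension by zero to V'.\<close>

lemma local_section_SS:
  assumes V: "(V, \<Phi>) \<in> trivs E" and \<rho>: "smooth_fun n A UNIV \<rho>"
    and C: "closed C" "C \<subseteq> V" "\<And>x. x \<notin> C \<Longrightarrow> \<rho> x = 0" and M: "adj M = M"
  shows "local_section V \<Phi> \<rho> M \<in> SS"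
  unfolding SS_iff
proof (intro conjI allI impI)
  fix x
  have "0 \<in> Herm E x" by (rule HermI) simp_all
  then show "local_section V \<Phi> \<rho> M x \<in> Herm E x"
    using fibre_frame.mat_form_Herm[OF fibre_frame.intro[OF triv_iso[OF V]] M]
    by (auto simp: local_section_def intro: Herm_scaleR)
next
  fix V' \<Psi> i j assume V': "(V', \<Psi>) \<in> trivs E"
  show "smooth_fun n A V' (coefficient E \<Psi> i j (local_section V \<Phi> \<rho> M))"
  proof (rule smooth_fun_extend[of V C V'])
    let ?f = "\<lambda>x. \<rho> x *\<^sub>R (\<Sum>k\<in>UNIV. \<Sum>l\<in>UNIV. \<Phi> (frame E \<Psi> x i) $ k * cnj (\<Phi> (frame E \<Psi> x j) $ l) * M $ k $ l)"
    have op: "open (V \<inter> V')" using V V' triv_open by blast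
    have tr: "smooth_fun n A (V \<inter> V') (\<lambda>x. \<Phi> (frame E \<Psi> x i) $ k)" for i k
      by (subst Int_commute) (rule triv_transition[OF V' V])
    have "smooth_fun n A (V \<inter> V') (\<lambda>x. \<Phi> (frame E \<Psi> x i) $ k * cnj (\<Phi> (frame E \<Psi> x j) $ l) * M $ k $ l)" for k l
      by (rule smooth_fun_mult[OF op smooth_fun_mult[OF op tr smooth_fun_linear[OF bounded_linear_cnj op tr]]
            smooth_fun_const[OF op]])
    then have f: "smooth_fun n A (V \<inter> V') ?f"
      by (intro smooth_fun_scaleR[OF op smooth_fun_subset[OF \<rho>]] smooth_fun_sum[OF op]) auto
    have eq: "coefficient E \<Psi> i j (local_section V \<Phi> \<rho> M) x = ?f x" if "x \<in> V \<inter> V'" for x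
    proof -
      interpret fibre_frame E x \<Psi> by unfold_locales (use triv_iso[OF V'] that in auto)
      show ?thesis
        using that by (simp add: coefficient_def local_section_def mat_form_def frame_T scaleR_fun_def)
    qed
    show "smooth_fun n A (V \<inter> V') (coefficient E \<Psi> i j (local_section V \<Phi> \<rho> M))"
      by (rule smooth_fun_cong[OF op eq, THEN iffD2, OF _ f])
    show "coefficient E \<Psi> i j (local_section V \<Phi> \<rho> M) x = 0" if "x \<in> V' - C" for x
      using that C(3) by (simp add: coefficient_def local_section_def scaleR_fun_def)
  qed (use V V' C triv_open in auto)
qed

text \<open>The real-linear projection onto Hermitian matrices. Standard basis matrices need not be
  Hermitian, yet every summand of a curve in \<open>CC\<close> has to be a section of Hermitian
  forms.\<close>

definition sym_mat :: "complex ^ 'r ^ 'r \<Rightarrow> complex ^ 'r ^ 'r"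
  where "sym_mat M = (1 / 2) *\<^sub>R (M + adj M)"

lemma sym_mat_adj: "adj (sym_mat M) = sym_mat M"
  by (simp add: sym_mat_def adj_def Finite_Cartesian_Product.vec_eq_iff)

lemma mat_form_sum: "mat_form E \<Phi> x (\<Sum>b\<in>I. c b *\<^sub>R M b) = (\<Sum>b\<in>I. c b *\<^sub>R mat_form E \<Phi> x (M b))"
proof -
  have add: "mat_form E \<Phi> x (M + M') = mat_form E \<Phi> x M + mat_form E \<Phi> x M'" for M M'
    by (auto simp: mat_form_def fun_eq_iff sum.distrib algebra_simps)
  have scale: "mat_form E \<Phi> x (c *\<^sub>R M) = c *\<^sub>R mat_form E \<Phi> x M" for c M
    by (auto simp: mat_form_def fun_eq_iff scaleR_fun_def scaleR_sum_right)
  have zero: "mat_form E \<Phi> x 0 = 0" using scale[of 0 0] by simp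
  show ?thesis
    by (induction I rule: infinite_finite_induct) (simp_all add: zero add scale)
qed

lemma sum_fun_apply: "(\<Sum>b\<in>I. f b) x = (\<Sum>b\<in>I. f b x)"
  by (induction I rule: infinite_finite_induct) auto

text \<open>The curve is expanded in the standard basis with symmetrised basis matrices; its real
  coordinates are the time coefficients. The expansion is an equality of functions on the whole
  line, hence the symmetry assumption for every real t.\<close>

lemma CC_local_section:
  assumes "(V, \<Phi>) \<in> trivs E" "smooth_fun n A UNIV \<rho>"
    "closed C" "C \<subseteq> V" "\<And>x. x \<notin> C \<Longrightarrow> \<rho> x = 0"
    and y: "C1_curve y y'" "\<And>t. adj (y t) = y t" "\<And>t. adj (y' t) = y' t"
  shows "CC (\<lambda>t. local_section V \<Phi> \<rho> (y t)) (\<lambda>t. local_section V \<Phi> \<rho> (y' t))"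
proof -
  have exp: "local_section V \<Phi> \<rho> M = (\<Sum>b\<in>Basis. (M \<bullet> b) *\<^sub>R local_section V \<Phi> \<rho> (sym_mat b))"
    if "adj M = M" for M
  proof -
    have "M = sym_mat M" using that by (simp add: sym_mat_def flip: scaleR_2)
    also have "\<dots> = sym_mat (\<Sum>b\<in>Basis. (M \<bullet> b) *\<^sub>R b)" by (simp add: euclidean_representation)
    also have "\<dots> = (\<Sum>b\<in>Basis. (M \<bullet> b) *\<^sub>R sym_mat b)"
    proof -
      have "adj (\<Sum>b\<in>Basis. (M \<bullet> b) *\<^sub>R b) = (\<Sum>b\<in>Basis. (M \<bullet> b) *\<^sub>R adj b)"
        by (simp add: adj_sum adj_scaleR)
      then show ?thesis
        by (simp add: sym_mat_def scaleR_add_right sum.distrib scaleR_sum_right)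
    qed
    finally have "mat_form E \<Phi> x M = (\<Sum>b\<in>Basis. (M \<bullet> b) *\<^sub>R mat_form E \<Phi> x (sym_mat b))" for x
      using mat_form_sum by metis
    then show ?thesis
      by (auto simp: local_section_def fun_eq_iff sum_fun_apply scaleR_fun_def scaleR_sum_right mult.commute)
  qed
  have "CC (\<lambda>t. \<Sum>b\<in>Basis. (y t \<bullet> b) *\<^sub>R local_section V \<Phi> \<rho> (sym_mat b))
      (\<lambda>t. \<Sum>b\<in>Basis. (y' t \<bullet> b) *\<^sub>R local_section V \<Phi> \<rho> (sym_mat b))"
  proof (intro CC_sum CC_scale)
    fix b :: "complex ^ 'r ^ 'r"
    show "C1_curve (\<lambda>t. y t \<bullet> b) (\<lambda>t. y' t \<bullet> b)"
      using y(1) unfolding C1_curve_def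
      by (auto intro!: continuous_intros bounded_linear.has_vector_derivative[OF bounded_linear_inner_left])
    show "local_section V \<Phi> \<rho> (sym_mat b) \<in> SS"
      by (rule local_section_SS[OF assms(1-5) sym_mat_adj])
  qed
  then show ?thesis
    using exp[OF y(2)] exp[OF y(3)] by simp
qed

end

text \<open>For a non-integrable f the integral is 0, whence the assumption 0 \<le> c.\<close>

lemma integral_le_const:
  fixes f :: "real \<Rightarrow> real"
  assumes "\<And>t. t \<in> {0..1} \<Longrightarrow> f t \<le> c" "0 \<le> c"
  shows "integral {0..1} f \<le> c"
proof (cases "f integrable_on {0..1}")
  case True
  then have "integral {0..1} f \<le> integral {0..1} (\<lambda>_::real. c)"
    by (intro integral_le) (use assms in auto)
  then show ?thesis by simp
qed (simp add: not_integrable_integral assms)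

context metric_bundle
begin

text \<open>The straight line serves as the path; it keeps the set of lengths nonempty, as reasoning
  about \<open>Inf\<close> requires.\<close>

lemma fibre_path_exists:
  assumes "h1 \<in> SP" "h2 \<in> SP"
  shows "\<exists>\<gamma>. piecewise_C1_path (fibre_top E x) \<gamma> \<and> (\<forall>t\<in>{0..1}. \<gamma> t \<in> Herm_pos E x) \<and>
    \<gamma> 0 = h1 x \<and> \<gamma> 1 = h2 x"
proof -
  obtain l l' where l: "PP h1 h2 l l'" using PP_line[OF assms] by blast
  then show ?thesis
    using piecewise_C1_path_eval[OF CC_piecewise_C1, of l l' x] unfolding PP_def
    by (intro exI[of _ "\<lambda>t. l t x"]) blast
qed

lemma fibre_dist_nonneg:
  assumes "h1 \<in> SP" "h2 \<in> SP"
  shows "0 \<le> fibre_dist E \<alpha> x (h1 x) (h2 x)"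
proof -
  obtain V \<Phi> where iso: "fibre_iso E x \<Phi>" by (rule triv_at)
  show ?thesis
    unfolding fibre_dist_def riemannian_dist_def
  proof (rule cInf_greatest)
    show "{path_length (fibre_top E x) (fibre_metric E \<alpha> x) \<gamma> | \<gamma>. piecewise_C1_path (fibre_top E x) \<gamma> \<and>
        (\<forall>t\<in>{0..1}. \<gamma> t \<in> Herm_pos E x) \<and> \<gamma> 0 = h1 x \<and> \<gamma> 1 = h2 x} \<noteq> {}"
      using fibre_path_exists[OF assms, of x] by blast
    fix L assume "L \<in> {path_length (fibre_top E x) (fibre_metric E \<alpha> x) \<gamma> | \<gamma>. piecewise_C1_path (fibre_top E x) \<gamma> \<and>
        (\<forall>t\<in>{0..1}. \<gamma> t \<in> Herm_pos E x) \<and> \<gamma> 0 = h1 x \<and> \<gamma> 1 = h2 x}"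
    then obtain \<gamma> where "L = path_length (fibre_top E x) (fibre_metric E \<alpha> x) \<gamma>"
      "piecewise_C1_path (fibre_top E x) \<gamma>" "\<forall>t\<in>{0..1}. \<gamma> t \<in> Herm_pos E x" by blast
    then show "0 \<le> L" using fibre_path_length_nonneg[OF iso \<alpha>_bound] by simp
  qed
qed

text \<open>Over the support of the bump function the curve is a convex combination of the straight
  line and a slightly displaced copy of the fibre path, so openness and convexity of the positive
  forms keep it positive. At x0 it is the fibre path itself.\<close>

lemma almost_minimal_PP:
  assumes h: "h1 \<in> SP" "h2 \<in> SP" and \<eta>: "\<eta> > 0"
  shows "\<exists>p p'. PP h1 h2 p p' \<and> energy p p' x0 < (fibre_dist E \<alpha> x0 (h1 x0) (h2 x0))\<^sup>2 + \<eta>"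
proof -
  obtain V \<Phi> where V: "(V, \<Phi>) \<in> trivs E" "x0 \<in> V" "fibre_iso E x0 \<Phi>" by (rule triv_at)
  interpret fibre_frame E x0 \<Phi> by unfold_locales fact
  define D where "D = fibre_dist E \<alpha> x0 (h1 x0) (h2 x0)"
  have D0: "D \<ge> 0" unfolding D_def by (rule fibre_dist_nonneg[OF h])
  \<comment> \<open>Since e \<le> 1, one has 4 D e + 4 e^2 < (4 D + 5) e \<le> \<eta>.\<close>
  define e where "e = min 1 (\<eta> / (4 * D + 5))"
  have e: "e > 0" "(D + 2 * e)\<^sup>2 < D\<^sup>2 + \<eta>"
  proof -
    show e0: "e > 0" using \<eta> D0 by (simp add: e_def)
    have "e * e \<le> e * 1" using e0 by (intro mult_left_mono) (auto simp: e_def)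
    then have a: "e * e \<le> e" by (simp only: mult_1_right)
    have "e \<le> \<eta> / (4 * D + 5)" by (simp add: e_def)
    then have "e * (4 * D + 5) \<le> \<eta>" using D0 by (subst (asm) pos_le_divide_eq) auto
    then have "4 * (D * e) + 5 * e \<le> \<eta>" by (simp add: algebra_simps)
    then have "4 * (D * e) + 4 * (e * e) < \<eta>" using a e0 by linarith
    moreover have "(D + 2 * e)\<^sup>2 = D\<^sup>2 + (4 * (D * e) + 4 * (e * e))" by (simp add: power2_eq_square algebra_simps)
    ultimately show "(D + 2 * e)\<^sup>2 < D\<^sup>2 + \<eta>" by linarith
  qed
  let ?X = "{path_length (fibre_top E x0) (fibre_metric E \<alpha> x0) \<gamma> | \<gamma>.
     piecewise_C1_path (fibre_top E x0) \<gamma> \<and> (\<forall>t\<in>{0..1}. \<gamma> t \<in> Herm_pos E x0) \<and> \<gamma> 0 = h1 x0 \<and> \<gamma> 1 = h2 x0}"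
  have "?X \<noteq> {}" using fibre_path_exists[OF h, of x0] by blast
  moreover have "Inf ?X < D + e"
    using e(1) by (simp add: D_def fibre_dist_def riemannian_dist_def)
  ultimately obtain L where "L \<in> ?X" "L < D + e" by (meson cInf_lessD)
  then obtain \<gamma> where \<gamma>: "piecewise_C1_path (fibre_top E x0) \<gamma>" "\<forall>t\<in>{0..1}. \<gamma> t \<in> Herm_pos E x0"
    "\<gamma> 0 = h1 x0" "\<gamma> 1 = h2 x0" and len: "path_length (fibre_top E x0) (fibre_metric E \<alpha> x0) \<gamma> < D + e"
    by blast
  let ?L = "path_length (fibre_top E x0) (fibre_metric E \<alpha> x0) \<gamma>"
  have L0: "0 \<le> ?L" by (rule fibre_path_length_nonneg[OF V(3) \<alpha>_bound \<gamma>(1,2)])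
  define H1 where "H1 = (\<lambda>x. form_mat E \<Phi> x (h1 x))"
  define H2 where "H2 = (\<lambda>x. form_mat E \<Phi> x (h2 x))"
  obtain z z' where z: "C1_curve z z'"
    "\<And>t. t \<in> {0..1} \<Longrightarrow> z t \<in> posdef \<and> adj (z t) = z t \<and> adj (z' t) = z' t"
    "z 0 = H1 x0" "z 1 = H2 x0" "\<And>t. t \<in> {0..1} \<Longrightarrow> mat_metric (\<alpha> x0) (z t) (z' t) \<le> (?L + e)\<^sup>2"
    using almost_minimal_path[where \<alpha> = \<alpha>, OF \<gamma>(1,2) \<alpha>_bound e(1)] unfolding H1_def H2_def \<gamma>(3,4) by blast
  have "compact (z ` {0..1})"
    using C1_curve_continuous[OF z(1)] by (intro compact_continuous_image) auto
  then obtain d where d: "d > 0" "(\<Union>x\<in>z ` {0..1}. ball x d) \<subseteq> posdef"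
    by (rule compact_subset_open_imp_ball_epsilon_subset[OF _ posdef_open]) (use z(2) in auto)
  have Hc: "continuous_on V (\<lambda>x. form_mat E \<Phi> x (h x))" if "h \<in> SP" for h
  proof -
    have "continuous_on V (\<lambda>x. h x (frame E \<Phi> x i) (frame E \<Phi> x j))" for i j
      using smooth_fun_continuous_on[OF SS_smooth[OF _ V(1)] triv_open[OF V(1)]] that
      by (simp add: SP_iff coefficient_def[abs_def])
    then show ?thesis unfolding form_mat_def by (intro continuous_on_vec_lambda)
  qed
  \<comment> \<open>d is a distance by which the whole fibre path may be moved within
    \<open>posdef\<close>. On W both end values lie within d/2 of those at x0, so adapting the path
    to them moves it by less than d.\<close>
  define W where "W = (V \<inter> H1 -` ball (H1 x0) (d / 2)) \<inter> (V \<inter> H2 -` ball (H2 x0) (d / 2))"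
  have "open W"
    unfolding W_def H1_def H2_def using Hc h triv_open[OF V(1)]
    by (intro open_Int continuous_open_preimage) auto
  moreover have "x0 \<in> W" using V d by (simp add: W_def)
  ultimately obtain \<rho> :: "'m \<Rightarrow> real" and C where \<rho>: "smooth_fun n A UNIV \<rho>" "\<And>x. 0 \<le> \<rho> x" "\<And>x. \<rho> x \<le> 1"
    "\<rho> x0 = 1" and C: "closed C" "C \<subseteq> W" "\<And>x. x \<notin> C \<Longrightarrow> \<rho> x = 0"
    by (rule bump_function) blast
  \<comment> \<open>The deviation of the fibre path from its chord: it vanishes at both ends, so
    adding it to the straight line preserves h1 and h2. The value 0 off the unit interval makes it
    Hermitian for all t, as \<open>CC_local_section\<close> demands.\<close>
  define y where "y = (\<lambda>t. if t \<in> {0..1} then z t - ((1 - t) *\<^sub>R z 0 + t *\<^sub>R z 1) else 0)"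
  define y' where "y' = (\<lambda>t. if t \<in> {0..1} then z' t + z 0 - z 1 else 0)"
  have y: "C1_curve y y'"
    unfolding C1_curve_def
  proof (intro conjI ballI)
    have "continuous_on {0..1} (\<lambda>t. z' t + z 0 - z 1)"
      using z(1) by (intro continuous_intros) (simp add: C1_curve_def)
    then show "continuous_on {0..1} y'" by (rule continuous_on_eq) (simp add: y'_def)
    fix t :: real assume t: "t \<in> {0..1}"
    have "((\<lambda>t. z t - ((1 - t) *\<^sub>R z 0 + t *\<^sub>R z 1)) has_vector_derivative
        z' t - ((0 - 1) *\<^sub>R z 0 + 1 *\<^sub>R z 1)) (at t within {0..1})"
      using z(1) t unfolding C1_curve_def
      by (auto intro!: derivative_eq_intros)
    then have "((\<lambda>t. z t - ((1 - t) *\<^sub>R z 0 + t *\<^sub>R z 1)) has_vector_derivative y' t) (at t within {0..1})"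
      using t by (simp add: y'_def algebra_simps)
    then show "(y has_vector_derivative y' t) (at t within {0..1})"
      by (rule has_vector_derivative_transform[OF t, rotated]) (simp add: y_def)
  qed
  have ends: "adj (z 0) = z 0" "adj (z 1) = z 1" using z(2)[of 0] z(2)[of 1] by auto
  have adj_diff: "adj (M - M') = adj M - adj M'" for M M' :: "complex ^ 'r ^ 'r"
    by (simp add: adj_def Finite_Cartesian_Product.vec_eq_iff)
  have ya: "adj (y t) = y t" "adj (y' t) = y' t" for t
    using z(2) ends by (simp_all add: y_def y'_def adj_diff adj_add adj_scaleR adj_0)
  define q where "q = (\<lambda>t. local_section V \<Phi> \<rho> (y t))"
  define q' where "q' = (\<lambda>t. local_section V \<Phi> \<rho> (y' t))"
  have "CC q q'"
    unfolding q_def q'_def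
    by (rule CC_local_section[OF V(1) \<rho>(1) C(1) _ C(3) y ya]) (use C(2) in \<open>auto simp: W_def\<close>)
  define l where "l = (\<lambda>t. (1 - t) *\<^sub>R h1 + t *\<^sub>R h2)"
  define l' where "l' = (\<lambda>t::real. (-1) *\<^sub>R h1 + 1 *\<^sub>R h2)"
  have l: "PP h1 h2 l l'" unfolding l_def l'_def by (rule PP_line[OF h])
  define p where "p = (\<lambda>t. l t + q t)"
  define p' where "p' = (\<lambda>t. l' t + q' t)"
  have CC: "CC p p'"
    unfolding p_def p'_def using l \<open>CC q q'\<close> by (intro CC_add) (auto simp: PP_def)
  have mat: "form_mat E \<Phi> x (p t x) = (1 - t) *\<^sub>R H1 x + t *\<^sub>R H2 x + \<rho> x *\<^sub>R y t"
    "form_mat E \<Phi> x (p' t x) = H2 x - H1 x + \<rho> x *\<^sub>R y' t" if "x \<in> V" for x t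
  proof -
    interpret b: fibre_frame E x \<Phi> by unfold_locales (rule triv_iso[OF V(1) that])
    have "(\<lambda>t. l t + q t) t x = (1 - t) *\<^sub>R h1 x + t *\<^sub>R h2 x + \<rho> x *\<^sub>R mat_form E \<Phi> x (y t)"
      "(\<lambda>t. l' t + q' t) t x = (-1) *\<^sub>R h1 x + 1 *\<^sub>R h2 x + \<rho> x *\<^sub>R mat_form E \<Phi> x (y' t)"
      using that by (simp_all add: l_def l'_def q_def q'_def local_section_def scaleR_fun_def fun_eq_iff)
    then show "form_mat E \<Phi> x (p t x) = (1 - t) *\<^sub>R H1 x + t *\<^sub>R H2 x + \<rho> x *\<^sub>R y t"
      "form_mat E \<Phi> x (p' t x) = H2 x - H1 x + \<rho> x *\<^sub>R y' t"
      unfolding p_def p'_def H1_def H2_def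
      by (simp_all only: form_mat_add form_mat_scaleR b.form_mat_form) simp
  qed
  have pos: "p t x \<in> Herm_pos E x" if t: "t \<in> {0..1}" for t x
  proof (cases "x \<in> C")
    case True
    then have x: "x \<in> V" "norm (H1 x - H1 x0) < d / 2" "norm (H2 x - H2 x0) < d / 2"
      using C(2) by (auto simp: W_def dist_norm norm_minus_commute)
    interpret b: fibre_frame E x \<Phi> by unfold_locales (rule triv_iso[OF V(1) x(1)])
    \<comment> \<open>The fibre path displaced so as to join the end values at x. The matrix of
      \<open>p t x\<close> is the convex combination of the straight line and Y with weight
      \<open>\<rho> x\<close>.\<close>
    define Y where "Y = z t + ((1 - t) *\<^sub>R (H1 x - H1 x0) + t *\<^sub>R (H2 x - H2 x0))"
    have "norm ((1 - t) *\<^sub>R (H1 x - H1 x0)) \<le> (1 - t) * (d / 2)" "norm (t *\<^sub>R (H2 x - H2 x0)) \<le> t * (d / 2)"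
      unfolding norm_scaleR using x(2,3) t by (auto intro!: mult_mono simp del: times_divide_eq_right)
    then have "norm ((1 - t) *\<^sub>R (H1 x - H1 x0) + t *\<^sub>R (H2 x - H2 x0)) \<le> (1 - t) * (d / 2) + t * (d / 2)"
      by (intro order_trans[OF norm_triangle_ineq] add_mono)
    also have "\<dots> < d" using d(1) by (simp add: field_simps)
    finally have "dist Y (z t) < d" by (simp only: Y_def dist_norm add_diff_cancel_left')
    then have "Y \<in> ball (z t) d" by (simp add: dist_commute)
    then have Y: "Y \<in> posdef" using d(2) t by blast
    have "(1 - t) *\<^sub>R H1 x + t *\<^sub>R H2 x \<in> posdef"
      using h t x b.Herm_pos_iff unfolding H1_def H2_def by (intro posdef_convex) (auto simp: SP_iff)
    from posdef_convex[OF this Y, of "1 - \<rho> x" "\<rho> x"]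
    have "(1 - \<rho> x) *\<^sub>R ((1 - t) *\<^sub>R H1 x + t *\<^sub>R H2 x) + \<rho> x *\<^sub>R Y \<in> posdef"
      using \<rho>(2,3)[of x] by simp
    also have "(1 - \<rho> x) *\<^sub>R ((1 - t) *\<^sub>R H1 x + t *\<^sub>R H2 x) + \<rho> x *\<^sub>R Y = form_mat E \<Phi> x (p t x)"
      using t z(3,4) by (simp add: mat(1)[OF x(1)] Y_def y_def algebra_simps)
    finally show ?thesis using CC_SS[OF CC, of t] by (simp add: b.Herm_pos_iff SS_iff)
  next
    case False
    then have "p t x = l t x" using C(3) by (simp add: p_def q_def local_section_def scaleR_fun_def fun_eq_iff)
    then show ?thesis using l t by (simp add: PP_def)
  qed
  have "mat_form E \<Phi> x 0 = 0" for x by (auto simp: mat_form_def fun_eq_iff)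
  then have "q 0 = 0" "q 1 = 0"
    by (auto simp: q_def y_def local_section_def fun_eq_iff scaleR_fun_def)
  then have PP: "PP h1 h2 p p'"
    using CC pos l by (simp add: PP_def p_def)
  have "energy p p' x0 \<le> (?L + e)\<^sup>2"
    unfolding energy_def
  proof (rule integral_le_const)
    fix t :: real assume t: "t \<in> {0..1}"
    have "form_mat E \<Phi> x0 (p t x0) = z t" "form_mat E \<Phi> x0 (p' t x0) = z' t"
      using t z(3,4) \<rho>(4) by (simp_all add: mat[OF V(2)] y_def y'_def algebra_simps)
    moreover have "p' t x0 \<in> Herm E x0" using CC_SS[OF CC, of t] by (simp add: SS_iff)
    ultimately show "fibre_metric E \<alpha> x0 (p t x0) (p' t x0) (p' t x0) \<le> (?L + e)\<^sup>2"
      using pos[OF t, of x0] z(5)[OF t] by (simp add: fibre_metric_eq)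
  qed simp
  also have "\<dots> \<le> (D + 2 * e)\<^sup>2" using len L0 e(1) by (intro power_mono) auto
  also have "\<dots> < D\<^sup>2 + \<eta>" by (rule e(2))
  finally show ?thesis using PP unfolding D_def by blast
qed

end

context L2_bundle
begin

theorem L2_dist_eq:
  assumes h: "h1 \<in> SP" "h2 \<in> SP"
  shows "L2_dist n A E \<alpha> \<mu> h1 h2 = sqrt (\<integral>x. (fibre_dist E \<alpha> x (h1 x) (h2 x))\<^sup>2 \<partial>\<mu>)"
proof -
  define D where "D = (\<lambda>x. fibre_dist E \<alpha> x (h1 x) (h2 x))"
  have D0: "0 \<le> D x" for x unfolding D_def by (rule fibre_dist_nonneg[OF h])
  have D_le: "(D x)\<^sup>2 \<le> energy p p' x" if "PP h1 h2 p p'" for p p' x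
  proof -
    have "(D x)\<^sup>2 \<le> (sqrt (energy p p' x))\<^sup>2"
      using fibre_dist_le_energy[OF that, of x] D0[of x] by (intro power_mono) (auto simp: D_def)
    then show ?thesis using energy_nonneg[OF that, of x] by simp
  qed
  have near: "\<exists>p p'. PP h1 h2 p p' \<and> energy p p' x < q" if "(D x)\<^sup>2 < q" for x q
    using almost_minimal_PP[OF h, of "q - (D x)\<^sup>2" x] that by (simp add: D_def)
  define Q where "Q = {(p, p'). PP h1 h2 p p'}"
  define e where "e = (\<lambda>P x. energy (fst P) (snd P) x)"
  have e_cont: "continuous_on UNIV (e P)" and e_nn: "0 \<le> e P x" and e_ge: "(D x)\<^sup>2 \<le> e P x"
    if "P \<in> Q" for P x
    using that energy_continuous energy_nonneg D_le by (auto simp: Q_def e_def)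
  have op: "open {x. e P x < q}" if "P \<in> Q" for P q
    using e_cont[OF that] by (intro open_Collect_less continuous_on_const)
  \<comment> \<open>This shows that the squared distance is upper semicontinuous, and the same union
    is the cover from which a countable family is drawn.\<close>
  have lt: "{x. (D x)\<^sup>2 < q} = \<Union>((\<lambda>P. {x. e P x < q}) ` Q)" for q
  proof (rule equalityI; rule subsetI)
    fix x assume "x \<in> {x. (D x)\<^sup>2 < q}"
    then obtain p p' where "PP h1 h2 p p'" "energy p p' x < q" using near by blast
    then show "x \<in> \<Union>((\<lambda>P. {x. e P x < q}) ` Q)"
      by (intro UN_I[of "(p, p')"]) (auto simp: Q_def e_def)
  next
    fix x assume "x \<in> \<Union>((\<lambda>P. {x. e P x < q}) ` Q)"
    then obtain P where "P \<in> Q" "e P x < q" by blast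
    then show "x \<in> {x. (D x)\<^sup>2 < q}" using e_ge[of P x] by simp
  qed
  have "open {x. (D x)\<^sup>2 < q}" for q
    unfolding lt using op by (intro open_Union) auto
  then have D2m: "(\<lambda>x. (D x)\<^sup>2) \<in> borel_measurable borel"
    by (subst borel_measurable_iff_less) auto
  then have "(\<lambda>x. sqrt ((D x)\<^sup>2)) \<in> borel_measurable borel" by measurable
  then have Dm: "D \<in> borel_measurable borel" using D0 by simp
  \<comment> \<open>For each level q the Lindeloef property selects countably many curves; the
    rational levels then suffice to approach the infimum at every x.\<close>
  have "\<exists>K. countable K \<and> K \<subseteq> Q \<and> {x. (D x)\<^sup>2 < q} = \<Union>((\<lambda>P. {x. e P x < q}) ` K)" for q
  proof -
    have opF: "\<And>S. S \<in> (\<lambda>P. {x. e P x < q}) ` Q \<Longrightarrow> open S"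
      by (erule imageE) (simp only: op)
    obtain F where F: "F \<subseteq> (\<lambda>P. {x. e P x < q}) ` Q" "countable F" "\<Union>F = \<Union>((\<lambda>P. {x. e P x < q}) ` Q)"
      using Lindelof[OF opF] by metis
    then obtain K where K: "countable K" "K \<subseteq> Q" "F = (\<lambda>P. {x. e P x < q}) ` K"
      using countable_subset_image[of F "\<lambda>P. {x. e P x < q}" Q] by blast
    show ?thesis
      by (rule exI[of _ K]) (simp only: K(1,2) lt F(3)[symmetric] K(3))
  qed
  then obtain K where K: "\<And>q. countable (K q)" "\<And>q. K q \<subseteq> Q"
    "\<And>q. {x. (D x)\<^sup>2 < q} = \<Union>((\<lambda>P. {x. e P x < q}) ` K q)"
    by metis
  \<comment> \<open>The straight line is included so that the set is nonempty when it is
    enumerated.\<close>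
  define K' where "K' = insert (\<lambda>t. (1 - t) *\<^sub>R h1 + t *\<^sub>R h2, \<lambda>t. (-1) *\<^sub>R h1 + 1 *\<^sub>R h2) (\<Union>q\<in>\<rat>. K q)"
  have K': "countable K'" "K' \<noteq> {}" "K' \<subseteq> Q"
    using K PP_line[OF h] by (auto simp: K'_def Q_def countable_rat)
  define P where "P = from_nat_into K'"
  have PQ: "P j \<in> Q" for j using from_nat_into[OF K'(2)] K'(3) by (auto simp: P_def)
  have P_near: "\<exists>j. e (P j) x < q" if less: "(D x)\<^sup>2 < q" for x q
  proof -
    obtain r where r: "r \<in> \<rat>" "(D x)\<^sup>2 < r" "r < q" using Rats_dense_in_real[OF less] by blast
    then have "x \<in> \<Union>((\<lambda>P. {x. e P x < r}) ` K r)" using K(3)[of r] by blast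
    then obtain k where "k \<in> K r" "e k x < r" by blast
    then have "k \<in> K'" "e k x < q" using r by (auto simp: K'_def)
    then show ?thesis using from_nat_into_surj[OF K'(1)] unfolding P_def by metis
  qed
  \<comment> \<open>The minimum of the first J + 1 energies. It tends to
    \<open>(D x)\<^sup>2\<close> at every x and is bounded by the energy of the first curve.\<close>
  define g where "g = (\<lambda>J x. MIN j\<in>{..J}. e (P j) x)"
  have g_Suc: "g (Suc J) x = min (g J x) (e (P (Suc J)) x)" and g_0: "g 0 x = e (P 0) x" for J x
    by (simp_all add: g_def atMost_Suc Min_insert min.commute)
  have g_ge: "(D x)\<^sup>2 \<le> g J x" and g_le: "j \<le> J \<Longrightarrow> g J x \<le> e (P j) x" for J j x
    using e_ge[OF PQ] by (auto simp: g_def intro!: Min_le)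
  have e_meas: "e (P j) \<in> borel_measurable borel" for j
    by (rule borel_measurable_continuous_onI[OF e_cont[OF PQ]])
  have g_meas: "g J \<in> borel_measurable borel" for J
  proof (induction J)
    case 0 show ?case using e_meas[of 0] by (simp add: g_0[abs_def])
  next
    case (Suc J) then show ?case using e_meas[of "Suc J"] by (simp add: g_Suc[abs_def])
  qed
  have e_bdd: "\<exists>c. \<forall>x. \<bar>e R x\<bar> \<le> c" if "R \<in> Q" for R
    using continuous_bounded[OF e_cont[OF that]] by metis
  obtain c where c: "\<And>x. \<bar>e (P 0) x\<bar> \<le> c" using e_bdd[OF PQ[of 0]] by blast
  have D2_nn: "0 \<le> (D x)\<^sup>2" for x by simp
  have g_c: "\<bar>g J x\<bar> \<le> c" for J x
    using g_le[of 0 J x] c[of x] order_trans[OF D2_nn[of x] g_ge[of x J]] by auto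
  have D_c: "\<bar>(D x)\<^sup>2\<bar> \<le> c" for x
    using e_ge[OF PQ[of 0], of x] c[of x] by auto
  have g_int: "integrable \<mu> (g J)" for J by (rule integrable_bounded[OF g_meas g_c])
  have "(\<lambda>J. \<integral>x. g J x \<partial>\<mu>) \<longlonglongrightarrow> (\<integral>x. (D x)\<^sup>2 \<partial>\<mu>)"
  proof (rule integral_dominated_convergence[where w = "\<lambda>_. c"])
    show "(\<lambda>x. (D x)\<^sup>2) \<in> borel_measurable \<mu>" "g J \<in> borel_measurable \<mu>" for J
      using D2m g_meas measurable_cong_sets[OF sets_\<mu> refl] by blast+
    show "integrable \<mu> (\<lambda>_. c)" using finite_\<mu> by (simp add: finite_measure.integrable_const)
    show "AE x in \<mu>. norm (g J x) \<le> c" for J using g_c by simp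
    have "(\<lambda>J. g J x) \<longlonglongrightarrow> (D x)\<^sup>2" for x
    proof (rule order_tendstoI)
      fix a assume "a < (D x)\<^sup>2"
      then have "a < g J x" for J using g_ge[of x J] by simp
      then show "\<forall>\<^sub>F J in sequentially. a < g J x" by simp
    next
      fix a assume "(D x)\<^sup>2 < a"
      then obtain j where j: "e (P j) x < a" using P_near by blast
      then have "g J x < a" if "J \<ge> j" for J using g_le[OF that, of x] by simp
      then show "\<forall>\<^sub>F J in sequentially. g J x < a" by (auto simp: eventually_sequentially)
    qed
    then show "AE x in \<mu>. (\<lambda>J. g J x) \<longlonglongrightarrow> (D x)\<^sup>2" by simp
  qed
  \<comment> \<open>\<open>g J\<close> need not be the energy of any curve. Repeated use of
    \<open>energy_min\<close> approximates it by one, half of \<epsilon> going to the earlier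
    minimum and half to the new combination.\<close>
  have approx: "\<exists>s\<in>Q. (\<integral>x. max 0 (e s x - g J x) \<partial>\<mu>) < \<epsilon>" if "\<epsilon> > 0" for J \<epsilon>
    using that
  proof (induction J arbitrary: \<epsilon>)
    case 0
    show ?case using 0 PQ[of 0] by (intro bexI[of _ "P 0"]) (simp_all add: g_0)
  next
    case (Suc J)
    obtain \<sigma> where \<sigma>: "\<sigma> \<in> Q" "(\<integral>x. max 0 (e \<sigma> x - g J x) \<partial>\<mu>) < \<epsilon> / 2"
      using Suc.IH[of "\<epsilon> / 2"] Suc.prems by auto
    let ?P = "P (Suc J)"
    obtain s where s: "s \<in> Q" "(\<integral>x. max 0 (e s x - min (e \<sigma> x) (e ?P x)) \<partial>\<mu>) < \<epsilon> / 2"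
      using energy_min[of h1 h2 "fst \<sigma>" "snd \<sigma>" "fst ?P" "snd ?P" "\<epsilon> / 2"] \<sigma>(1) PQ[of "Suc J"] Suc.prems
      by (auto simp: Q_def e_def)
    have int: "integrable \<mu> (\<lambda>x. max 0 (e R x - f x))"
      if R: "R \<in> Q" and f: "f \<in> borel_measurable borel" "\<And>x. 0 \<le> f x" for R f
    proof -
      obtain b where b: "\<And>x. \<bar>e R x\<bar> \<le> b" using e_bdd[OF R] by blast
      show ?thesis
      proof (rule integrable_bounded)
        show "(\<lambda>x. max 0 (e R x - f x)) \<in> borel_measurable borel"
          using f(1) borel_measurable_continuous_onI[OF e_cont[OF R]] by measurable
        show "\<bar>max 0 (e R x - f x)\<bar> \<le> b" for x using b[of x] f(2)[of x] by auto
      qed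
    qed
    have gJ: "0 \<le> g J x" for J x using order_trans[OF D2_nn[of x] g_ge[of x J]] .
    have "(\<integral>x. max 0 (e s x - g (Suc J) x) \<partial>\<mu>) \<le>
        (\<integral>x. max 0 (e s x - min (e \<sigma> x) (e ?P x)) + max 0 (e \<sigma> x - g J x) \<partial>\<mu>)"
    proof (rule integral_mono)
      show "integrable \<mu> (\<lambda>x. max 0 (e s x - g (Suc J) x))"
        using s(1) g_meas gJ by (rule int)
      show "integrable \<mu> (\<lambda>x. max 0 (e s x - min (e \<sigma> x) (e ?P x)) + max 0 (e \<sigma> x - g J x))"
        using s(1) \<sigma>(1) g_meas gJ e_nn[OF \<sigma>(1)] e_nn[OF PQ] e_meas borel_measurable_continuous_onI[OF e_cont[OF \<sigma>(1)]]
        by (intro Bochner_Integration.integrable_add int borel_measurable_min) auto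
      \<comment> \<open>Replacing \<open>e \<sigma> x\<close> by \<open>g J x\<close> inside the
        minimum lowers it by at most the positive excess of the former over the latter.\<close>
      show "max 0 (e s x - g (Suc J) x) \<le> max 0 (e s x - min (e \<sigma> x) (e ?P x)) + max 0 (e \<sigma> x - g J x)" for x
        unfolding g_Suc by (simp add: max_def min_def)
    qed
    also have "\<dots> = (\<integral>x. max 0 (e s x - min (e \<sigma> x) (e ?P x)) \<partial>\<mu>) + (\<integral>x. max 0 (e \<sigma> x - g J x) \<partial>\<mu>)"
      using s(1) \<sigma>(1) g_meas gJ e_nn[OF \<sigma>(1)] e_nn[OF PQ] e_meas borel_measurable_continuous_onI[OF e_cont[OF \<sigma>(1)]]
      by (intro Bochner_Integration.integral_add int borel_measurable_min) auto
    also have "\<dots> < \<epsilon>" using s(2) \<sigma>(2) by simp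
    finally show ?case using s(1) by blast
  qed
  define I where "I = (\<integral>x. (D x)\<^sup>2 \<partial>\<mu>)"
  have I0: "I \<ge> 0" by (simp add: I_def)
  have upper: "\<exists>s\<in>Q. (\<integral>x. e s x \<partial>\<mu>) < I + \<epsilon>" if \<epsilon>: "\<epsilon> > 0" for \<epsilon>
  proof -
    have "\<forall>\<^sub>F J in sequentially. (\<integral>x. g J x \<partial>\<mu>) < I + \<epsilon> / 2"
      using \<open>(\<lambda>J. \<integral>x. g J x \<partial>\<mu>) \<longlonglongrightarrow> (\<integral>x. (D x)\<^sup>2 \<partial>\<mu>)\<close> \<epsilon> by (intro order_tendstoD(2)) (auto simp: I_def)
    then obtain J where J: "(\<integral>x. g J x \<partial>\<mu>) < I + \<epsilon> / 2" by (auto simp: eventually_sequentially)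
    obtain s where s: "s \<in> Q" "(\<integral>x. max 0 (e s x - g J x) \<partial>\<mu>) < \<epsilon> / 2" using approx[of "\<epsilon> / 2" J] \<epsilon> by auto
    have es: "integrable \<mu> (e s)" using s(1) energy_integrable by (auto simp: Q_def e_def)
    have "(\<integral>x. e s x \<partial>\<mu>) \<le> (\<integral>x. g J x + max 0 (e s x - g J x) \<partial>\<mu>)"
      using es g_int by (intro integral_mono Bochner_Integration.integrable_add integrable_max Bochner_Integration.integrable_diff) auto
    also have "\<dots> = (\<integral>x. g J x \<partial>\<mu>) + (\<integral>x. max 0 (e s x - g J x) \<partial>\<mu>)"
      using es g_int by (intro Bochner_Integration.integral_add integrable_max Bochner_Integration.integrable_diff) auto
    also have "\<dots> < I + \<epsilon>" using J s(2) by simp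
    finally show ?thesis using s(1) by blast
  qed
  let ?X = "{path_length CT (L2_metric E \<alpha> \<mu>) \<gamma> | \<gamma>.
     piecewise_C1_path CT \<gamma> \<and> (\<forall>t\<in>{0..1}. \<gamma> t \<in> SP) \<and> \<gamma> 0 = h1 \<and> \<gamma> 1 = h2}"
  have QX: "path_length CT (L2_metric E \<alpha> \<mu>) (fst s) \<in> ?X" if "s \<in> Q" for s
    using that CC_piecewise_C1 PP_SP by (auto simp: Q_def PP_def)
  have lower: "sqrt I \<le> L" if LX: "L \<in> ?X" for L
  proof -
    obtain \<gamma> where \<gamma>: "piecewise_C1_path CT \<gamma>" "\<forall>t\<in>{0..1}. \<gamma> t \<in> SP" "\<gamma> 0 = h1" "\<gamma> 1 = h2"
      and L: "L = path_length CT (L2_metric E \<alpha> \<mu>) \<gamma>" using LX by blast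
    obtain N B where N: "finite N" "continuous_on (({0..1} - N) \<times> UNIV) (\<lambda>z. density \<gamma> (fst z) (snd z))"
      "\<And>t x. t \<in> {0..1} - N \<Longrightarrow> 0 \<le> density \<gamma> t x" "\<And>t x. t \<in> {0..1} - N \<Longrightarrow> density \<gamma> t x \<le> B"
      "\<And>x. D x \<le> integral {0..1} (\<lambda>t. sqrt (density \<gamma> t x))"
      using path_density[OF \<gamma>(1,2), of thesis] unfolding \<gamma>(3,4) D_def by blast
    show ?thesis
      unfolding L path_length_L2 I_def by (rule L2_norm_integral_le[OF sets_\<mu> finite_\<mu> N(1-4) Dm D0 N(5)])
  qed
  have bdd: "bdd_below ?X" using lower by (rule bdd_belowI)
  have ne: "?X \<noteq> {}" using QX[OF PQ[of 0]] by blast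
  define Y where "Y = Inf ?X"
  have Y_le: "Y \<le> sqrt (\<integral>x. e s x \<partial>\<mu>)" if s: "s \<in> Q" for s
  proof -
    have "Y \<le> path_length CT (L2_metric E \<alpha> \<mu>) (fst s)"
      unfolding Y_def using QX[OF s] bdd by (rule cInf_lower)
    also have "\<dots> \<le> sqrt (\<integral>x. e s x \<partial>\<mu>)"
      using path_length_le_energy[of h1 h2 "fst s" "snd s"] s by (auto simp: Q_def e_def)
    finally show ?thesis .
  qed
  have "Y = sqrt I"
  proof (rule antisym)
    show "sqrt I \<le> Y" unfolding Y_def using ne lower by (rule cInf_greatest)
    show "Y \<le> sqrt I"
    proof (rule ccontr)
      assume "\<not> Y \<le> sqrt I"
      then have less: "sqrt I < Y" by simp
      have Y0: "0 \<le> Y" using less real_sqrt_ge_zero[OF I0] by linarith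
      have "(sqrt I)\<^sup>2 < Y\<^sup>2" using less I0 by (intro power_strict_mono) auto
      then have "0 < Y\<^sup>2 - I" using I0 by simp
      then obtain s where s: "s \<in> Q" "(\<integral>x. e s x \<partial>\<mu>) < Y\<^sup>2"
        using upper[of "Y\<^sup>2 - I"] by auto
      have "sqrt (\<integral>x. e s x \<partial>\<mu>) < sqrt (Y\<^sup>2)" using s(2) by (rule real_sqrt_less_mono)
      then show False using Y_le[OF s(1)] Y0 by simp
    qed
  qed
  then show ?thesis
    by (simp only: L2_dist_def riemannian_dist_def Y_def I_def D_def)
qed

end

section \<open>Finiteness of the Riemannian volume\<close>

text \<open>Each point has a closed neighbourhood inside a chart on which the Gram determinant and
  the coordinates are bounded, so its volume is at most a constant times that of a box; finitely
  many of them cover M. The integral inequalities and the dominated convergence above rest on this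
  finiteness, which the definition of the volume does not state.\<close>

lemma (in compact_manifold) finite_measure_riemannian_volume:
  assumes g: "riemannian_metric n A g" and \<mu>: "riemannian_volume n A g \<mu>"
  shows "finite_measure \<mu>"
proof -
  have sets: "sets \<mu> = sets borel" and vol: "\<And>U \<phi> B. (U, \<phi>) \<in> A \<Longrightarrow> B \<in> sets borel \<Longrightarrow> B \<subseteq> U \<Longrightarrow>
      emeasure \<mu> B = (\<integral>\<^sup>+y. ennreal (sqrt (Determinant.det (gram_matrix n A g (U, \<phi>) (inv_into U \<phi> y)))) *
               indicator (\<phi> ` B) y \<partial>PiM {..<n} (\<lambda>_. lborel))"
    using \<mu> unfolding riemannian_volume_def by blast+
  have "\<exists>N C. open N \<and> x \<in> N \<and> N \<subseteq> C \<and> closed C \<and> emeasure \<mu> C < \<infinity>" for x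
  proof -
    obtain U \<phi> where U: "(U, \<phi>) \<in> A" "x \<in> U" by (rule chart_at)
    obtain N C where NC: "open N" "closed C" "x \<in> N" "N \<subseteq> C" "C \<subseteq> U"
      by (rule closed_nbhd[OF chart_open[OF U(1)] U(2)])
    have comp: "compact C" using NC(2) compact_UNIV closed_Int_compact[of C UNIV] by simp
    let ?f = "\<lambda>x. Determinant.det (gram_matrix n A g (U, \<phi>) x)"
    let ?G = "\<lambda>i j x. g x (coord_vector n A (U, \<phi>) i x) (coord_vector n A (U, \<phi>) j x)"
    have G: "continuous_on C (?G i j)" if "i < n" "j < n" for i j
    proof -
      have "\<forall>(U, \<phi>)\<in>A. \<forall>i<n. \<forall>j<n.
          smooth_fun n A U (\<lambda>p. g p (coord_vector n A (U, \<phi>) i p) (coord_vector n A (U, \<phi>) j p))"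
        using g unfolding riemannian_metric_def by (rule conjunct2)
      from bspec[OF this U(1)] that have "smooth_fun n A U (?G i j)" by simp
      from smooth_fun_continuous_on[OF this chart_open[OF U(1)]] show ?thesis
        using NC(5) by (rule continuous_on_subset)
    qed
    \<comment> \<open>The Leibniz expansion exhibits the determinant as a polynomial in the entries,
      which are continuous on C.\<close>
    have det: "?f = (\<lambda>x. \<Sum>p\<in>{p. p permutes {0..<n}}. signof p * (\<Prod>i = 0..<n. ?G i (p i) x))"
    proof
      fix x
      have "(\<Prod>i = 0..<n. gram_matrix n A g (U, \<phi>) x $$ (i, p i)) = (\<Prod>i = 0..<n. ?G i (p i) x)"
        if "p permutes {0..<n}" for p
        using that by (intro prod.cong refl) (auto simp: gram_matrix_def permutes_in_image)
      then show "?f x = (\<Sum>p\<in>{p. p permutes {0..<n}}. signof p * (\<Prod>i = 0..<n. ?G i (p i) x))"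
        by (simp add: Determinant.det_def gram_matrix_def)
    qed
    have "continuous_on C ?f"
      unfolding det by (intro continuous_intros G) (auto simp: permutes_in_image)
    then have "bounded (?f ` C)" using comp compact_continuous_image compact_imp_bounded by blast
    then obtain b where b: "\<And>x. x \<in> C \<Longrightarrow> \<bar>?f x\<bar> \<le> b" by (auto simp: bounded_iff)
    have "\<forall>i. \<exists>r. i < n \<longrightarrow> (\<forall>x\<in>C. \<bar>\<phi> x i\<bar> \<le> r)"
    proof
      fix i
      have "bounded ((\<lambda>x. \<phi> x i) ` C)" if "i < n"
        using smooth_fun_continuous_on[OF chart_coord_smooth[OF U(1) that] chart_open[OF U(1)]] NC(5) comp
        by (intro compact_imp_bounded compact_continuous_image) (auto intro: continuous_on_subset)
      then show "\<exists>r. i < n \<longrightarrow> (\<forall>x\<in>C. \<bar>\<phi> x i\<bar> \<le> r)"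
        unfolding bounded_iff by (metis imageI real_norm_def)
    qed
    then obtain r where r: "\<And>i x. i < n \<Longrightarrow> x \<in> C \<Longrightarrow> \<bar>\<phi> x i\<bar> \<le> r i" by metis
    let ?P = "PiM {..<n} (\<lambda>_. lborel :: real measure)"
    let ?Box = "\<Pi>\<^sub>E i\<in>{..<n}. {- r i..r i}"
    have sub: "\<phi> ` C \<subseteq> ?Box"
    proof
      fix y assume "y \<in> \<phi> ` C"
      then obtain x where x: "x \<in> C" "y = \<phi> x" by blast
      then have "y \<in> Rn n" using NC(5) chart_image_subset_Rn[OF U(1)] by blast
      moreover have "y i \<in> {- r i..r i}" if "i < n" for i
        using r[OF that x(1)] by (auto simp: x(2) abs_le_iff)
      ultimately show "y \<in> ?Box" by (simp add: Rn_def PiE_iff)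
    qed
    interpret product_sigma_finite "\<lambda>_ :: nat. lborel :: real measure" by unfold_locales
    have box: "emeasure ?P ?Box < \<infinity>"
      by (subst emeasure_PiM) (auto simp: emeasure_lborel_Icc_eq ennreal_prod_eq_top less_top[symmetric] intro!: ennreal_less_top)
    have "emeasure \<mu> C = (\<integral>\<^sup>+y. ennreal (sqrt (?f (inv_into U \<phi> y))) * indicator (\<phi> ` C) y \<partial>?P)"
      using U(1) NC by (intro vol) auto
    also have "\<dots> \<le> (\<integral>\<^sup>+y. ennreal (sqrt b) * indicator ?Box y \<partial>?P)"
    proof (rule nn_integral_mono)
      fix y
      show "ennreal (sqrt (?f (inv_into U \<phi> y))) * indicator (\<phi> ` C) y \<le> ennreal (sqrt b) * indicator ?Box y"
      proof (cases "y \<in> \<phi> ` C")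
        case True
        then obtain x where x: "x \<in> C" "y = \<phi> x" by auto
        then have "inv_into U \<phi> y = x" using chart_inv[OF U(1)] NC(5) by auto
        then have "?f (inv_into U \<phi> y) \<le> b" using b[OF x(1)] by simp
        moreover have "y \<in> ?Box" using sub True by blast
        ultimately show ?thesis using True by (simp add: ennreal_leI)
      qed simp
    qed
    also have "\<dots> = ennreal (sqrt b) * emeasure ?P ?Box"
      by (intro nn_integral_cmult_indicator sets_PiM_I_finite) auto
    also have "\<dots> < \<infinity>" using box by (simp add: ennreal_mult_less_top)
    finally show ?thesis using NC by blast
  qed
  then obtain N C where NC: "\<And>x. open (N x)" "\<And>x. x \<in> N x" "\<And>x. N x \<subseteq> C x" "\<And>x. closed (C x)"
    "\<And>x. emeasure \<mu> (C x) < \<infinity>"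
    by metis
  obtain F where F: "finite F" "UNIV \<subseteq> (\<Union>x\<in>F. N x)"
    by (rule compactE_image[OF compact_UNIV, of UNIV N]) (use NC(1,2) in auto)
  then have "UNIV \<subseteq> (\<Union>x\<in>F. C x)" using NC(3) by blast
  then have "emeasure \<mu> (space \<mu>) \<le> emeasure \<mu> (\<Union>x\<in>F. C x)"
    using NC(4) F(1) sets by (intro emeasure_mono sets.finite_UN) auto
  also have "\<dots> \<le> (\<Sum>x\<in>F. emeasure \<mu> (C x))"
    using F(1) NC(4) sets by (intro emeasure_subadditive_finite) auto
  also have "\<dots> < \<infinity>" using F(1) NC(5) by (simp add: ennreal_sum_less_top)
  finally show ?thesis by (intro finite_measureI) auto
qed

theorem theorem4p1:
  fixes A :: "'m::{t2_space, second_countable_topology} chart set"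
    and E :: "('m, 'e, 'r::finite) vbundle"
    and g :: "'m metric_field" and \<mu> :: "'m measure"
    and \<alpha> :: "'m \<Rightarrow> real" and h1 h2 :: "'m \<Rightarrow> 'e form" and n :: nat
  assumes "compact (UNIV :: 'm set)" and "oriented_smooth_manifold n A"
    and "smooth_complex_vector_bundle n A E"
    and "riemannian_metric n A g" and "riemannian_volume n A g \<mu>"
    and "smooth_fun n A UNIV \<alpha>" and "\<forall>x. \<alpha> x > - 1 / real CARD('r)"
    and "h1 \<in> smooth_sections n A E (Herm_pos E)"
    and "h2 \<in> smooth_sections n A E (Herm_pos E)"
  shows "L2_dist n A E \<alpha> \<mu> h1 h2 =
    sqrt (\<integral>x. (fibre_dist E \<alpha> x (h1 x) (h2 x))\<^sup>2 \<partial>\<mu>)"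
proof -
  interpret compact_manifold n A
    using assms(1,2) by (rule compact_manifold.intro)
  have "L2_bundle n A E \<alpha> \<mu>"
  proof (intro L2_bundle.intro metric_bundle.intro hermitian_bundle.intro hermitian_bundle_axioms.intro
      metric_bundle_axioms.intro L2_bundle_axioms.intro)
    show "continuous_on UNIV \<alpha>"
      by (rule smooth_fun_continuous_on[OF assms(6) open_UNIV])
    show "- 1 / real CARD('r) < \<alpha> x" for x
      using assms(7) by blast
    show "sets \<mu> = sets borel"
      using assms(5) by (simp add: riemannian_volume_def)
    show "finite_measure \<mu>"
      by (rule finite_measure_riemannian_volume[OF assms(4,5)])
  qed (fact compact_manifold_axioms assms(3))+
  then show ?thesis
    by (rule L2_bundle.L2_dist_eq) (fact assms(8,9))+
qed

end
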